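(* Let $(S_i(j))_{i\ge 1,j\ge 1}$ be i.i.d. non-negative random variables distributed as $S$, and let $(A(j))_{j\ge 1}$ be i.i.d. non-negative random variables distributed as $A$, independent of $(S_i(j))_{i,j\ge1}$, with $\mathbb{E}[A]=1/\lambda$, $\operatorname{Var}(A)=\sigma_A^2<\infty$ and $\mathbb{E}[S-A]=-\mu$ for some $\mu>0$. Let $\Lambda(\theta)=\log \mathbb{E}[\exp(\theta(S-1/\lambda))]$ and assume there exists $\gamma>0$ such that $\Lambda(\gamma)=0$ and $\gamma$ lies in the interior of $\{\theta:\Lambda(\theta)<\infty\}$. Let $Q_1(\infty),\dots,Q_N(\infty)$ be the steady-state queue lengths in the $N$-server fork-join queue with these interarrival and service times. Then, as $N\to\infty$, $$\frac{\max_{i\le N}Q_i(\infty)-\frac{\lambda}{\gamma}\log N}{\sqrt{\log N}}\ \xrightarrow{d}\ \sqrt{\frac{\lambda^2\sigma_A^2}{\Lambda'(\gamma)\gamma}+\frac{\lambda^3\sigma_A^2}{\gamma}}\;X,$$ where $X\sim\mathcal{N}(0,1)$.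
   Context: Fork-join queue with $N$ servers: tasks arrive with i.i.d. interarrival times distributed as $A$. On arrival, each task places one subtask at each of the $N$ single-server FCFS queues; service times are i.i.d. distributed as $S$. $Q_i(\infty)$ denotes the number of subtasks waiting in queue $i$ (not counting the one in service) at an arbitrary time $t$ when the system is in steady state, the arrival process being a stationary renewal process. Explicitly: number the tasks backward in time from $t$, task $1$ being the last arrival before $t$. Let $T(j)=U+\sum_{m=1}^{j-1}A(m)$ be such that $t-T(j)$ is the arrival time of the $j$-th task counted backward, where $U$ has density $x\mapsto\lambda\,\mathbb{P}(A>x)$ on $(0,\infty)$ and is independent of all $A(m)$ and $S_i(m)$, and $A(m)$ is the time between the arrivals of tasks $m+1$ and $m$. Let $S_i(m)$ be the service time of the subtask of task $m$ (counted backward) in queue $i$, and let $\tilde W_i(j)=\sup_{k\ge0}\sum_{m=j}^{j+k-1}(S_i(m+1)-A(m))$ be the steady-state waiting time of the subtask of task $j$ in queue $i$ (empty sum $0$). Then $Q_i(\infty)=\#\{j\ge1:\tilde W_i(j)\ge T(j)\}$, so that $\{\max_{i\le N}Q_i(\infty)\ge j\}=\{\max_{i\le N}\tilde W_i(j)\ge T(j)\}$ for every $j\ge1$. *)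

theory Defs
  imports "HOL-Probability.Probability"
begin

text \<open>
  Tasks are numbered backward in time from the observation time, and queues are numbered from 1:
  \<open>Serv i m\<close> is the service time of task \<open>m\<close> in queue \<open>i\<close>, \<open>Arr m\<close> the time between the
  arrivals of tasks \<open>m + 1\<close> and \<open>m\<close>, and \<open>U\<close> the time since the arrival of task 1. Values of
  \<open>Serv\<close> and \<open>Arr\<close> at index 0 are never used.
\<close>

datatype input_index = Service nat nat | Interarrival nat | Elapsed

primrec input_var ::
  "(nat \<Rightarrow> nat \<Rightarrow> 'a \<Rightarrow> real) \<Rightarrow> (nat \<Rightarrow> 'a \<Rightarrow> real) \<Rightarrow> ('a \<Rightarrow> real) \<Rightarrow> input_index \<Rightarrow> 'a \<Rightarrow> real"
where
  "input_var Serv Arr U (Service i j) = Serv i j"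
| "input_var Serv Arr U (Interarrival j) = Arr j"
| "input_var Serv Arr U Elapsed = U"

definition input_indices :: "input_index set" where
  "input_indices =
     {Service i j | i j. i \<ge> 1 \<and> j \<ge> 1} \<union> {Interarrival j | j. j \<ge> 1} \<union> {Elapsed}"

definition arrival_age :: "(nat \<Rightarrow> 'a \<Rightarrow> real) \<Rightarrow> ('a \<Rightarrow> real) \<Rightarrow> nat \<Rightarrow> 'a \<Rightarrow> real" where
  "arrival_age Arr U j \<omega> = U \<omega> + (\<Sum>m = 1..<j. Arr m \<omega>)"

text \<open>The supremum is taken in the extended reals, so it is meaningful on the null event on which
  the partial sums are unbounded.\<close>

definition waiting_time ::
  "(nat \<Rightarrow> nat \<Rightarrow> 'a \<Rightarrow> real) \<Rightarrow> (nat \<Rightarrow> 'a \<Rightarrow> real) \<Rightarrow> nat \<Rightarrow> nat \<Rightarrow> 'a \<Rightarrow> ereal" where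
  "waiting_time Serv Arr i j \<omega> =
     (SUP k::nat. ereal (\<Sum>m = j..<j + k. Serv i (m + 1) \<omega> - Arr m \<omega>))"

text \<open>In a stable queue the set counted below is almost surely finite; \<^const>\<open>card\<close> gives the
  junk value 0 only on the null event where it is infinite.\<close>

definition queue_length ::
  "(nat \<Rightarrow> nat \<Rightarrow> 'a \<Rightarrow> real) \<Rightarrow> (nat \<Rightarrow> 'a \<Rightarrow> real) \<Rightarrow> ('a \<Rightarrow> real) \<Rightarrow> nat \<Rightarrow> 'a \<Rightarrow> nat" where
  "queue_length Serv Arr U i \<omega> =
     card {j. j \<ge> 1 \<and> waiting_time Serv Arr i j \<omega> \<ge> ereal (arrival_age Arr U j \<omega>)}"

text \<open>The logarithmic moment generating function of \<open>S - 1 / lam\<close>. The value \<open>\<infinity>\<close> is made explicit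
  because a divergent Bochner integral is 0 and \<open>ln 0 = 0\<close>.\<close>

definition log_mgf :: "'a measure \<Rightarrow> ('a \<Rightarrow> real) \<Rightarrow> real \<Rightarrow> real \<Rightarrow> ereal" where
  "log_mgf M S lam \<theta> =
     (if integrable M (\<lambda>\<omega>. exp (\<theta> * (S \<omega> - 1 / lam)))
      then ereal (ln (\<integral>\<omega>. exp (\<theta> * (S \<omega> - 1 / lam)) \<partial>M))
      else \<infinity>)"

end

theory Submission
  imports Defs "HOL-Real_Asymp.Real_Asymp"
begin

text \<open>
  Let \<open>L = log N\<close>, let \<open>X\<^sub>i(k)\<close> be the sum of \<open>k\<close> service times of queue \<open>i\<close>, each centred at
  \<open>1/\<lambda>\<close>, and let \<open>B(n)\<close> be the sum of the first \<open>n\<close> interarrival times, centred at the same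
  value. Since the tasks that still wait are the most recent ones, queue \<open>i\<close> contains at least
  \<open>j\<close> of them iff task \<open>j\<close> still waits in it (\<open>queue_length_ge_iff\<close>), which up to rounding
  means that for some \<open>k\<close>

    \<open>X\<^sub>i(k) \<ge> U + (j - 1)/\<lambda> + B(j - 1 + k)\<close>.

  The right-hand side is the same for all queues; given the arrivals, the walks \<open>X\<^sub>1, X\<^sub>2, \<dots>\<close>
  are independent and identically distributed. Take \<open>j = \<lambda>L/\<gamma> + x sqrt L\<close>. By Cramer's theorem
  the largest of the \<open>N\<close> walks gets to level \<open>L/\<gamma>\<close>, it does so only at times \<open>k\<close> close to
  \<open>\<kappa> L\<close> with \<open>\<kappa> = 1/(\<gamma> \<Lambda>'(\<gamma>))\<close>, and at those times it misses or exceeds this level by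
  \<open>o(sqrt L)\<close>; at all other times it stays below by a multiple of \<open>L\<close>. On the other side, \<open>B\<close>
  fluctuates on the scale \<open>sqrt L\<close>, but it is almost constant over the few relevant values of
  \<open>k\<close>. Hence some queue contains \<open>j\<close> tasks, up to small errors, iff \<open>L/\<gamma> \<ge> (j - 1)/\<lambda> + B(n)\<close>
  with \<open>n = j - 1 + \<kappa> L\<close>, that is, iff \<open>- B(n) \<ge> (x/\<lambda>) sqrt L\<close>. Since \<open>n/L\<close> tends to
  \<open>\<lambda>/\<gamma> + \<kappa>\<close>, the central limit theorem for this single sum gives the normal limit with
  variance \<open>\<lambda>\<^sup>2 \<sigma>\<^sup>2 (\<lambda>/\<gamma> + \<kappa>)\<close>: the sum contains the arrivals after task \<open>j\<close>, which produce
  the first part of \<open>n\<close>, and those before it, which produce the second.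

  That the event is not more likely than claimed (\<open>overload_upper\<close>) is a union bound over \<open>i\<close>
  and \<open>k\<close>. Near \<open>\<kappa> L\<close> the Chernoff bound with exponent \<open>\<gamma>\<close> is used, and Kolmogorov's maximal
  inequality controls \<open>B\<close> (\<open>arrival_window\<close>); away from \<open>\<kappa> L\<close> the exponents \<open>\<gamma> \<plusminus> \<eta>\<close> win a
  factor that is exponential in \<open>L\<close> (\<open>rate_gap\<close>, \<open>far_service_tail\<close>); for very large \<open>k\<close> the
  negative drift of service minus interarrival times suffices (\<open>delay_walk_decay\<close>).

  That it is not less likely (\<open>overload_lower\<close>) needs one fixed \<open>k\<close> near \<open>\<kappa> L\<close> such that a
  single walk reaches \<open>L/\<gamma> - \<epsilon> sqrt L\<close> at time \<open>k\<close> with probability much larger than \<open>1/N\<close>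
  (\<open>likely_level_time\<close>). In place of the exponentially tilted law, expectations weighted by
  \<open>exp (\<gamma> X(k))\<close> are used, which has mean 1. The weight of the event \<open>X(k) < a\<close> falls from
  almost 1 to almost 0 while \<open>k\<close> runs through a window of length \<open>O(L)\<close>, so in one of these
  steps it falls by \<open>1/O(L)\<close>. In that step the walk crosses \<open>a\<close>, with an overshoot that is
  small because single steps have exponential tails, so the weight is at most
  \<open>exp (\<gamma> (a + h))\<close> on the crossing event. The loss of a factor of order \<open>L\<close> is harmless
  against \<open>exp (\<epsilon> sqrt L)\<close>.
\<close>

section \<open>Sums of independent random variables\<close>

text \<open>
  All independent families of this development are read off from the one family of inputs of
  the queue: each member is a function of its own block of inputs.
\<close>

lemma (in prob_space) indep_vars_blocks:
  assumes ind: "indep_vars (\<lambda>_. borel) X I"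
    and K: "\<And>j. j \<in> L \<Longrightarrow> K j \<subseteq> I" and disj: "disjoint_family_on K L"
    and g: "\<And>j. j \<in> L \<Longrightarrow> g j \<in> borel_measurable (PiM (K j) (\<lambda>_. borel))"
    and Y: "\<And>j \<omega>. j \<in> L \<Longrightarrow> Y j \<omega> = g j (restrict (\<lambda>i. X i \<omega>) (K j))"
  shows "indep_vars (\<lambda>_. borel) Y L"
proof -
  have "indep_vars (\<lambda>_. borel) (\<lambda>j \<omega>. g j (restrict (\<lambda>i. X i \<omega>) (K j))) L"
    using indep_vars_compose2[OF indep_vars_restrict[OF ind K disj], where Y = g] g by auto
  then show ?thesis
    by (subst indep_vars_cong[where Y = "\<lambda>j \<omega>. g j (restrict (\<lambda>i. X i \<omega>) (K j))"])
       (auto simp: fun_eq_iff Y)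
qed

lemma (in prob_space) expectation_exp_iid_sum:
  fixes X :: "'i \<Rightarrow> 'a \<Rightarrow> real"
  assumes "finite I" "indep_vars (\<lambda>_. borel) X I"
    and "\<And>i. i \<in> I \<Longrightarrow> distr M borel (X i) = D"
    and "integrable D (\<lambda>x. exp (\<theta> * x))"
  shows "integrable M (\<lambda>\<omega>. exp (\<theta> * (\<Sum>i\<in>I. X i \<omega>)))"
    and "expectation (\<lambda>\<omega>. exp (\<theta> * (\<Sum>i\<in>I. X i \<omega>))) = (\<integral>x. exp (\<theta> * x) \<partial>D) ^ card I"
proof -
  have meas: "X i \<in> borel_measurable M" if "i \<in> I" for i
    using assms(2) that by (auto simp: indep_vars_def)
  have ind: "indep_vars (\<lambda>_. borel) (\<lambda>i \<omega>. exp (\<theta> * X i \<omega>)) I"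
    by (rule indep_vars_compose2[OF assms(2)]) auto
  have int: "integrable M (\<lambda>\<omega>. exp (\<theta> * X i \<omega>))" if "i \<in> I" for i
    using assms(4) unfolding assms(3)[OF that, symmetric]
    by (subst (asm) integrable_distr_eq) (auto intro: meas[OF that])
  have eq: "expectation (\<lambda>\<omega>. exp (\<theta> * X i \<omega>)) = (\<integral>x. exp (\<theta> * x) \<partial>D)" if "i \<in> I" for i
    unfolding assms(3)[OF that, symmetric]
    by (subst integral_distr) (auto intro: meas[OF that])
  have *: "(\<lambda>\<omega>. exp (\<theta> * (\<Sum>i\<in>I. X i \<omega>))) = (\<lambda>\<omega>. \<Prod>i\<in>I. exp (\<theta> * X i \<omega>))"
    using assms(1) by (simp add: sum_distrib_left exp_sum)
  show "integrable M (\<lambda>\<omega>. exp (\<theta> * (\<Sum>i\<in>I. X i \<omega>)))"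
    unfolding * by (rule indep_vars_integrable[OF assms(1) ind int])
  show "expectation (\<lambda>\<omega>. exp (\<theta> * (\<Sum>i\<in>I. X i \<omega>))) = (\<integral>x. exp (\<theta> * x) \<partial>D) ^ card I"
    unfolding * using indep_vars_lebesgue_integral[OF assms(1) ind int] eq by simp
qed

lemma (in prob_space) chernoff_iid_sum:
  fixes X :: "'i \<Rightarrow> 'a \<Rightarrow> real"
  assumes "finite I" "indep_vars (\<lambda>_. borel) X I"
    and "\<And>i. i \<in> I \<Longrightarrow> distr M borel (X i) = D"
    and "integrable D (\<lambda>x. exp (\<theta> * x))" and "\<theta> \<ge> 0"
  shows "prob {\<omega>\<in>space M. y \<le> (\<Sum>i\<in>I. X i \<omega>)} \<le> exp (- \<theta> * y) * (\<integral>x. exp (\<theta> * x) \<partial>D) ^ card I"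
proof -
  note E = expectation_exp_iid_sum[OF assms(1-4)]
  have meas[measurable]: "X i \<in> borel_measurable M" if "i \<in> I" for i
    using assms(2) that by (auto simp: indep_vars_def)
  have "prob {\<omega>\<in>space M. y \<le> (\<Sum>i\<in>I. X i \<omega>)}
      = expectation (\<lambda>\<omega>. indicator {\<omega>\<in>space M. y \<le> (\<Sum>i\<in>I. X i \<omega>)} \<omega>)"
    by simp
  also have "\<dots> \<le> expectation (\<lambda>\<omega>. exp (- \<theta> * y) * exp (\<theta> * (\<Sum>i\<in>I. X i \<omega>)))"
  proof (rule integral_mono)
    fix \<omega> assume "\<omega> \<in> space M"
    show "indicator {\<omega>\<in>space M. y \<le> (\<Sum>i\<in>I. X i \<omega>)} \<omega>
        \<le> exp (- \<theta> * y) * exp (\<theta> * (\<Sum>i\<in>I. X i \<omega>))"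
      using assms(5) mult_left_mono[of y "\<Sum>i\<in>I. X i \<omega>" \<theta>]
      by (auto simp: indicator_def simp flip: exp_add)
  next
    show "integrable M (indicat_real {\<omega>\<in>space M. y \<le> (\<Sum>i\<in>I. X i \<omega>)})"
      by (rule integrable_const_bound[where B = 1]) auto
  qed (use E in simp)
  finally show ?thesis using E by simp
qed

text \<open>
  The right-hand side mentions neither the variables nor their indices, so sums of equally
  many terms from different queues, or started at different tasks, have the same law.
\<close>

lemma (in prob_space) distr_iid_sum:
  fixes X :: "'i \<Rightarrow> 'a \<Rightarrow> real"
  assumes "finite I" "indep_vars (\<lambda>_. borel) X I"
    and "\<And>i. i \<in> I \<Longrightarrow> distr M borel (X i) = D"
  shows "distr M borel (\<lambda>\<omega>. \<Sum>i\<in>I. X i \<omega>)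
       = ((\<lambda>\<nu>. convolution D \<nu>) ^^ card I) (return borel (0::real))"
  using assms
proof (induction I rule: finite_induct)
  case empty
  have "distr M borel (\<lambda>\<omega>. 0::real) = return borel 0"
    by (rule measure_eqI) (auto simp: emeasure_distr emeasure_space_1 indicator_def)
  then show ?case by simp
next
  case (insert i I)
  have meas[measurable]: "X k \<in> borel_measurable M" if "k \<in> insert i I" for k
    using insert.prems(1) that by (auto simp: indep_vars_def)
  have IH: "distr M borel (\<lambda>\<omega>. \<Sum>i\<in>I. X i \<omega>)
       = ((\<lambda>\<nu>. convolution D \<nu>) ^^ card I) (return borel (0::real))"
    by (rule insert.IH[OF indep_vars_subset[OF insert.prems(1)]]) (use insert.prems in auto)
  have "distr M borel (\<lambda>\<omega>. X i \<omega> + (\<Sum>i\<in>I. X i \<omega>))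
      = convolution (distr M borel (X i)) (distr M borel (\<lambda>\<omega>. \<Sum>i\<in>I. X i \<omega>))"
    by (rule sum_indep_random_variable[OF indep_vars_sum[OF insert.hyps insert.prems(1)]])
       (use meas in \<open>auto intro!: borel_measurable_sum\<close>)
  then show ?case using insert.hyps insert.prems(2)[of i] IH by simp
qed

lemma (in prob_space) square_sum_indep:
  fixes X :: "'i \<Rightarrow> 'a \<Rightarrow> real" and v :: real
  assumes "finite I" "indep_vars (\<lambda>_. borel) X I"
    and "\<And>i. i \<in> I \<Longrightarrow> integrable M (X i)"
    and "\<And>i. i \<in> I \<Longrightarrow> expectation (X i) = 0"
    and "\<And>i. i \<in> I \<Longrightarrow> integrable M (\<lambda>\<omega>. (X i \<omega>)\<^sup>2)"
    and "\<And>i. i \<in> I \<Longrightarrow> expectation (\<lambda>\<omega>. (X i \<omega>)\<^sup>2) = v"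
  shows "integrable M (\<lambda>\<omega>. (\<Sum>i\<in>I. X i \<omega>)\<^sup>2) \<and>
         expectation (\<lambda>\<omega>. (\<Sum>i\<in>I. X i \<omega>)\<^sup>2) = card I * v"
  using assms
proof (induction I rule: finite_induct)
  case (insert i I)
  have sub: "indep_vars (\<lambda>_. borel) X I"
    using indep_vars_subset[OF insert.prems(1)] by blast
  define R where "R \<omega> = (\<Sum>i\<in>I. X i \<omega>)" for \<omega>
  have ind: "indep_var borel (X i) borel R"
    using indep_vars_sum[OF insert.hyps insert.prems(1)] unfolding R_def .
  have "integrable M (\<lambda>\<omega>. (R \<omega>)\<^sup>2) \<and> expectation (\<lambda>\<omega>. (R \<omega>)\<^sup>2) = card I * v"
    unfolding R_def
    by (rule insert.IH[OF sub]) (use insert.prems in simp_all)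
  moreover have R: "integrable M R" "expectation R = 0"
    using insert.prems unfolding R_def by auto
  moreover have "integrable M (\<lambda>\<omega>. X i \<omega> * R \<omega>)"
    using indep_var_integrable[OF ind] insert.prems(2) R by simp
  moreover have "expectation (\<lambda>\<omega>. X i \<omega> * R \<omega>) = 0"
    using indep_var_lebesgue_integral[OF ind] insert.prems(2) R insert.prems(3) by simp
  moreover have "(\<lambda>\<omega>. (\<Sum>i\<in>insert i I. X i \<omega>)\<^sup>2) = (\<lambda>\<omega>. (X i \<omega>)\<^sup>2 + 2 * (X i \<omega> * R \<omega>) + (R \<omega>)\<^sup>2)"
    using insert.hyps by (auto simp: R_def power2_eq_square algebra_simps)
  ultimately show ?case
    using insert.hyps insert.prems(4)[of i] insert.prems(5)[of i] by (simp add: ring_distribs)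
qed simp

text \<open>
  Kolmogorov's inequality. On the event that \<open>k\<close> is the first time at which the partial sum
  \<open>R k\<close> leaves \<open>(-c, c)\<close>, the remaining increment is independent of the past and centred, so
  \<open>E (R n)\<^sup>2\<close> restricted to this event is at least \<open>E (R k)\<^sup>2\<close> restricted to it. Summing over
  \<open>k\<close> compares the probability with the variance of the whole sum.
\<close>

lemma (in prob_space) kolmogorov_maximal_inequality:
  fixes X :: "nat \<Rightarrow> 'a \<Rightarrow> real"
  assumes ind: "indep_vars (\<lambda>_. borel) X {a..<a + n}"
    and int: "\<And>i. i \<in> {a..<a + n} \<Longrightarrow> integrable M (X i)"
    and mean: "\<And>i. i \<in> {a..<a + n} \<Longrightarrow> expectation (X i) = 0"
    and sq: "\<And>i. i \<in> {a..<a + n} \<Longrightarrow> integrable M (\<lambda>\<omega>. (X i \<omega>)\<^sup>2)"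
    and var: "\<And>i. i \<in> {a..<a + n} \<Longrightarrow> expectation (\<lambda>\<omega>. (X i \<omega>)\<^sup>2) = v"
    and "c > 0"
  shows "prob {\<omega>\<in>space M. \<exists>k\<le>n. c \<le> \<bar>\<Sum>i=a..<a + k. X i \<omega>\<bar>} \<le> n * v / c\<^sup>2"
proof -
  define R where "R k \<omega> = (\<Sum>i=a..<a + k. X i \<omega>)" for k \<omega>
  have meas: "X i \<in> borel_measurable M" if "i \<in> {a..<a + n}" for i
    using ind that by (auto simp: indep_vars_def)
  have R_meas: "R k \<in> borel_measurable M" if "k \<le> n" for k
    unfolding R_def by (rule borel_measurable_sum, rule meas) (use that in auto)
  define E where "E k = {\<omega>\<in>space M. c \<le> \<bar>R k \<omega>\<bar> \<and> (\<forall>l\<in>{..<k}. \<bar>R l \<omega>\<bar> < c)}" for k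
  have E_sets: "E k \<in> events" if "k \<le> n" for k
  proof -
    have "Measurable.pred M (\<lambda>\<omega>. c \<le> \<bar>R k \<omega>\<bar> \<and> (\<forall>l\<in>{..<k}. \<bar>R l \<omega>\<bar> < c))"
      by (intro pred_intros_logic pred_intros_finite borel_measurable_pred_less
            borel_measurable_le[folded Measurable.pred_def] borel_measurable_abs R_meas borel_measurable_const)
         (use that in auto)
    then show ?thesis unfolding E_def by (simp add: pred_def)
  qed
  have "integrable M (\<lambda>\<omega>. (R k \<omega>)\<^sup>2) \<and> expectation (\<lambda>\<omega>. (R k \<omega>)\<^sup>2) = card {a..<a+k} * v" if "k \<le> n" for k
    unfolding R_def
    by (rule square_sum_indep[OF finite_atLeastLessThan indep_vars_subset[OF ind]])
       (use that in \<open>auto intro: int mean sq var\<close>)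
  then have sqR: "integrable M (\<lambda>\<omega>. (R k \<omega>)\<^sup>2)" "expectation (\<lambda>\<omega>. (R k \<omega>)\<^sup>2) = k * v" if "k \<le> n" for k
    using that by auto
  have step: "c\<^sup>2 * prob (E k) \<le> expectation (\<lambda>\<omega>. indicator (E k) \<omega> * (R n \<omega>)\<^sup>2)" if k: "k \<le> n" for k
  proof -
    \<comment> \<open>\<open>F\<close> is \<open>R k\<close> on the event of first exit at time \<open>k\<close>, written as a function of the past
      alone; \<open>G\<close> is the future increment.\<close>
    define G where "G \<omega> = (\<Sum>i=a+k..<a+n. X i \<omega>)" for \<omega>
    define f where "f x = (if c \<le> \<bar>\<Sum>i=a..<a+k. x i\<bar> \<and> (\<forall>l\<in>{..<k}. \<bar>\<Sum>i=a..<a+l. x i\<bar> < c)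
        then (\<Sum>i=a..<a+k. x i) else 0)" for x :: "nat \<Rightarrow> real"
    define F where "F \<omega> = f (restrict (\<lambda>i. X i \<omega>) {a..<a+k})" for \<omega>
    have sum_meas: "(\<lambda>x. \<Sum>i=a..<a+l. x i) \<in> borel_measurable (PiM {a..<a+k} (\<lambda>_. borel::real measure))"
      if "l \<le> k" for l
      using that by (intro borel_measurable_sum measurable_component_singleton) auto
    have f_meas: "f \<in> borel_measurable (PiM {a..<a+k} (\<lambda>_. borel))"
    proof -
      have "Measurable.pred (PiM {a..<a+k} (\<lambda>_. borel)) (\<lambda>x. \<forall>l\<in>{..<k}. \<bar>\<Sum>i=a..<a+l. x i\<bar> < c)"
        by (intro pred_intros_finite borel_measurable_pred_less borel_measurable_abs sum_meas) auto
      moreover have "Measurable.pred (PiM {a..<a+k} (\<lambda>_. borel)) (\<lambda>x. c \<le> \<bar>\<Sum>i=a..<a+k. x i\<bar>)"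
        by (intro borel_measurable_le[folded Measurable.pred_def] borel_measurable_abs sum_meas) auto
      ultimately show ?thesis
        unfolding f_def by (intro measurable_If sum_meas pred_intros_logic) auto
    qed
    have F_eq: "F \<omega> = indicator (E k) \<omega> * R k \<omega>" if "\<omega> \<in> space M" for \<omega>
    proof -
      have "(\<Sum>i=a..<a+l. restrict (\<lambda>i. X i \<omega>) {a..<a+k} i) = R l \<omega>" if "l \<le> k" for l
        unfolding R_def using that by (intro sum.cong) auto
      then show ?thesis using that by (auto simp: F_def f_def E_def indicator_def)
    qed
    have FG: "indep_var borel F borel G"
    proof -
      have "indep_var borel (f \<circ> (\<lambda>\<omega>. restrict (\<lambda>i. X i \<omega>) {a..<a+k}))
                      borel ((\<lambda>x. \<Sum>i=a+k..<a+n. x i) \<circ> (\<lambda>\<omega>. restrict (\<lambda>i. X i \<omega>) {a+k..<a+n}))"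
        by (rule indep_var_compose[OF indep_var_restrict[OF ind] f_meas]) (use k in auto)
      moreover have "f \<circ> (\<lambda>\<omega>. restrict (\<lambda>i. X i \<omega>) {a..<a+k}) = F"
        by (auto simp: F_def fun_eq_iff)
      moreover have "(\<lambda>x. \<Sum>i=a+k..<a+n. x i) \<circ> (\<lambda>\<omega>. restrict (\<lambda>i. X i \<omega>) {a+k..<a+n}) = G"
        by (auto simp: G_def fun_eq_iff)
      ultimately show ?thesis by simp
    qed
    have R_int: "integrable M (R k)"
      unfolding R_def using k int by (intro Bochner_Integration.integrable_sum) auto
    have G: "integrable M G" "expectation G = 0"
      unfolding G_def using k int mean by (auto)
    have F: "integrable M F"
    proof (subst Bochner_Integration.integrable_cong[OF refl F_eq])
      show "integrable M (\<lambda>\<omega>. indicator (E k) \<omega> * R k \<omega>)"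
        using integrable_mult_indicator[OF E_sets[OF k] R_int] by simp
    qed
    have FG0: "integrable M (\<lambda>\<omega>. F \<omega> * G \<omega>)" "expectation (\<lambda>\<omega>. F \<omega> * G \<omega>) = 0"
      using indep_var_integrable[OF FG F G(1)] indep_var_lebesgue_integral[OF FG F G(1)] G(2) by auto
    have Ek: "integrable M (\<lambda>\<omega>. c\<^sup>2 * indicator (E k) \<omega>)"
      using E_sets[OF k] by (intro integrable_mult_right integrable_const_bound[where B = 1]) auto
    have "expectation (\<lambda>\<omega>. c\<^sup>2 * indicator (E k) \<omega> + 2 * (F \<omega> * G \<omega>))
        \<le> expectation (\<lambda>\<omega>. indicator (E k) \<omega> * (R n \<omega>)\<^sup>2)"
    proof (rule integral_mono)
      show "integrable M (\<lambda>\<omega>. c\<^sup>2 * indicator (E k) \<omega> + 2 * (F \<omega> * G \<omega>))" using Ek FG0 by auto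
      show "integrable M (\<lambda>\<omega>. indicator (E k) \<omega> * (R n \<omega>)\<^sup>2)"
        using integrable_mult_indicator[OF E_sets[OF k] sqR(1)[OF order_refl]] by simp
      fix \<omega> assume \<omega>: "\<omega> \<in> space M"
      have "R n \<omega> = R k \<omega> + G \<omega>"
        unfolding R_def G_def using k by (intro sum.atLeastLessThan_concat[symmetric]) auto
      moreover have "c\<^sup>2 \<le> (R k \<omega>)\<^sup>2" if "\<omega> \<in> E k"
        using that \<open>c > 0\<close> by (auto simp: E_def abs_le_square_iff[symmetric])
      moreover have "(R k \<omega>)\<^sup>2 + 2 * (R k \<omega> * G \<omega>) \<le> (R k \<omega> + G \<omega>)\<^sup>2"
        by (simp add: power2_sum)
      ultimately show "c\<^sup>2 * indicator (E k) \<omega> + 2 * (F \<omega> * G \<omega>) \<le> indicator (E k) \<omega> * (R n \<omega>)\<^sup>2"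
        using F_eq[OF \<omega>] by (cases "\<omega> \<in> E k") auto
    qed
    also have "expectation (\<lambda>\<omega>. c\<^sup>2 * indicator (E k) \<omega> + 2 * (F \<omega> * G \<omega>)) = c\<^sup>2 * prob (E k)"
      using Ek FG0 E_sets[OF k] by simp
    finally show ?thesis .
  qed
  have disj: "disjoint_family_on E {..n}"
  proof (unfold disjoint_family_on_def, intro ballI impI)
    fix k l :: nat assume "k \<noteq> l"
    then consider "k < l" | "l < k" by linarith
    then show "E k \<inter> E l = {}" by cases (force simp: E_def)+
  qed
  have "{\<omega>\<in>space M. \<exists>k\<le>n. c \<le> \<bar>\<Sum>i=a..<a + k. X i \<omega>\<bar>} = (\<Union>k\<in>{..n}. E k)"
  proof (intro equalityI subsetI)
    fix \<omega> assume "\<omega> \<in> {\<omega>\<in>space M. \<exists>k\<le>n. c \<le> \<bar>\<Sum>i=a..<a + k. X i \<omega>\<bar>}"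
    then obtain k where k: "k \<le> n" "c \<le> \<bar>R k \<omega>\<bar>" "\<omega> \<in> space M" by (auto simp: R_def)
    define l where "l = (LEAST l. c \<le> \<bar>R l \<omega>\<bar>)"
    have "c \<le> \<bar>R l \<omega>\<bar>" unfolding l_def using k(2) by (rule LeastI)
    moreover have "l \<le> k" unfolding l_def using k(2) by (rule Least_le)
    moreover have "\<bar>R m \<omega>\<bar> < c" if "m < l" for m
      using not_less_Least[of m "\<lambda>l. c \<le> \<bar>R l \<omega>\<bar>"] that by (auto simp: l_def)
    ultimately show "\<omega> \<in> (\<Union>k\<in>{..n}. E k)" using k by (auto simp: E_def intro!: bexI[of _ l])
  qed (auto simp: E_def R_def)
  then have "prob {\<omega>\<in>space M. \<exists>k\<le>n. c \<le> \<bar>\<Sum>i=a..<a + k. X i \<omega>\<bar>} = (\<Sum>k\<le>n. prob (E k))"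
    using finite_measure_finite_Union[OF finite_atMost _ disj] E_sets by (simp add: image_subset_iff)
  then have "c\<^sup>2 * prob {\<omega>\<in>space M. \<exists>k\<le>n. c \<le> \<bar>\<Sum>i=a..<a + k. X i \<omega>\<bar>} = (\<Sum>k\<le>n. c\<^sup>2 * prob (E k))"
    by (simp add: sum_distrib_left)
  also have "\<dots> \<le> (\<Sum>k\<le>n. expectation (\<lambda>\<omega>. indicator (E k) \<omega> * (R n \<omega>)\<^sup>2))"
    by (intro sum_mono step) auto
  also have "\<dots> = expectation (\<lambda>\<omega>. \<Sum>k\<le>n. indicator (E k) \<omega> * (R n \<omega>)\<^sup>2)"
    using integrable_mult_indicator[OF E_sets sqR(1)[OF order_refl]]
    by (subst Bochner_Integration.integral_sum) auto
  also have "\<dots> \<le> expectation (\<lambda>\<omega>. (R n \<omega>)\<^sup>2)"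
  proof (rule integral_mono)
    show "integrable M (\<lambda>\<omega>. \<Sum>k\<le>n. indicator (E k) \<omega> * (R n \<omega>)\<^sup>2)"
      using integrable_mult_indicator[OF E_sets sqR(1)[OF order_refl]]
      by (intro Bochner_Integration.integrable_sum) auto
    fix \<omega>
    have "(\<Sum>k\<le>n. indicator (E k) \<omega> :: real) = indicator (\<Union>k\<in>{..n}. E k) \<omega>"
      by (rule indicator_UN_disjoint[OF finite_atMost disj, symmetric])
    also have "\<dots> \<le> 1" by (rule indicator_le_1)
    finally show "(\<Sum>k\<le>n. indicator (E k) \<omega> * (R n \<omega>)\<^sup>2) \<le> (R n \<omega>)\<^sup>2"
      unfolding sum_distrib_right[symmetric] by (rule mult_left_le_one_le[rotated 2]) (auto intro: sum_nonneg)
  qed (use sqR in auto)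
  also have "\<dots> = n * v" using sqR by auto
  finally show ?thesis using \<open>c > 0\<close> by (simp add: field_simps)
qed

text \<open>
  The slopes of the convex function \<open>\<eta> \<mapsto> exp (\<eta> z)\<close> at 0 increase with \<open>\<eta>\<close>.
\<close>

lemma exp_slope_bounds:
  fixes z \<eta> b :: real
  assumes "0 < \<eta>" "\<eta> \<le> b"
  shows "z \<le> (exp (\<eta> * z) - 1) / \<eta>" "(exp (\<eta> * z) - 1) / \<eta> \<le> (exp (b * z) - 1) / b"
proof -
  show "z \<le> (exp (\<eta> * z) - 1) / \<eta>"
    using exp_ge_add_one_self[of "\<eta> * z"] assms by (simp add: field_simps)
  have "exp ((1 - \<eta>/b) *\<^sub>R 0 + (\<eta>/b) *\<^sub>R (b * z)) \<le> (1 - \<eta>/b) * exp 0 + (\<eta>/b) * exp (b * z)"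
    by (rule convex_onD[OF exp_convex]) (use assms in auto)
  then show "(exp (\<eta> * z) - 1) / \<eta> \<le> (exp (b * z) - 1) / b"
    using assms by (simp add: divide_simps) (simp add: algebra_simps flip: distrib_left)
qed

text \<open>
  Differentiation under the integral. By convexity the difference quotients lie between the
  derivative at 0 and the quotient at \<open>b\<close>, and these two functions dominate them. The weight
  \<open>w\<close> moves the point of differentiation: \<open>w = 1\<close> gives the derivative at 0, and
  \<open>w x = exp (\<gamma> x)\<close> with \<open>Z = \<plusminus>x\<close> the two one-sided derivatives at \<open>\<gamma>\<close>.
\<close>

lemma exp_moment_right_derivative:
  fixes w Z :: "'a \<Rightarrow> real"
  assumes [measurable]: "Z \<in> borel_measurable M"
    and w: "integrable M w" "\<And>x. w x \<ge> 0"
    and wZ: "integrable M (\<lambda>x. w x * Z x)"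
    and b: "b > 0" "integrable M (\<lambda>x. w x * exp (b * Z x))"
  shows "\<And>\<eta>. \<lbrakk>0 \<le> \<eta>; \<eta> \<le> b\<rbrakk> \<Longrightarrow> integrable M (\<lambda>x. w x * exp (\<eta> * Z x))"
    and "((\<lambda>\<eta>. ((\<integral>x. w x * exp (\<eta> * Z x) \<partial>M) - (\<integral>x. w x \<partial>M)) / \<eta>) \<longlongrightarrow> (\<integral>x. w x * Z x \<partial>M)) (at_right 0)"
proof -
  have [measurable]: "w \<in> borel_measurable M" using w by auto
  show int: "integrable M (\<lambda>x. w x * exp (\<eta> * Z x))" if "0 \<le> \<eta>" "\<eta> \<le> b" for \<eta>
  proof (rule Bochner_Integration.integrable_bound)
    show "integrable M (\<lambda>x. w x + w x * exp (b * Z x))" using w b by auto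
    have "exp (\<eta> * z) \<le> 1 + exp (b * z)" for z
    proof (cases "z \<ge> 0")
      case True
      then have "\<eta> * z \<le> b * z" using that by (intro mult_right_mono) auto
      then show ?thesis by (simp add: add_increasing)
    next
      case False
      then have "\<eta> * z \<le> 0" using that by (simp add: mult_nonneg_nonpos)
      then show ?thesis by (simp add: add_increasing2)
    qed
    from mult_left_mono[OF this w(2)] have "w x * exp (\<eta> * Z x) \<le> w x + w x * exp (b * Z x)" for x
      by (metis distrib_left mult.right_neutral)
    then show "AE x in M. norm (w x * exp (\<eta> * Z x)) \<le> norm (w x + w x * exp (b * Z x))"
      using w(2) by (auto simp: abs_mult)
  qed measurable
  show "((\<lambda>\<eta>. ((\<integral>x. w x * exp (\<eta> * Z x) \<partial>M) - (\<integral>x. w x \<partial>M)) / \<eta>) \<longlongrightarrow> (\<integral>x. w x * Z x \<partial>M)) (at_right 0)"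
  proof (rule tendsto_at_right_sequentially[OF \<open>0 < b\<close>])
    fix S :: "nat \<Rightarrow> real" assume S: "\<And>n. 0 < S n" "\<And>n. S n < b" "S \<longlonglongrightarrow> 0"
    have "(\<lambda>n. \<integral>x. w x * ((exp (S n * Z x) - 1) / S n) \<partial>M) \<longlonglongrightarrow> (\<integral>x. w x * Z x \<partial>M)"
    proof (rule integral_dominated_convergence)
      show "integrable M (\<lambda>x. \<bar>w x * Z x\<bar> + (w x * exp (b * Z x) + w x) / b)"
        using w wZ b by auto
      have "(\<lambda>n. w x * ((exp (S n * Z x) - 1) / S n)) \<longlonglongrightarrow> w x * Z x" for x
      proof -
        have "((\<lambda>\<eta>. (exp (\<eta> * Z x) - 1) / \<eta>) \<longlongrightarrow> Z x) (at 0)"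
        proof -
          have "((\<lambda>\<eta>. exp (\<eta> * Z x)) has_real_derivative Z x) (at 0)"
            by (auto intro!: derivative_eq_intros)
          then show ?thesis by (simp add: has_field_derivative_iff)
        qed
        moreover have "filterlim S (at 0) sequentially"
          using S by (auto simp: filterlim_at intro!: always_eventually less_imp_neq[THEN not_sym])
        ultimately show ?thesis
          by (intro tendsto_mult tendsto_const) (rule filterlim_compose)
      qed
      then show "AE x in M. (\<lambda>n. w x * ((exp (S n * Z x) - 1) / S n)) \<longlonglongrightarrow> w x * Z x" by simp
      fix n
      have "\<bar>w x * ((exp (S n * Z x) - 1) / S n)\<bar> \<le> \<bar>w x * Z x\<bar> + (w x * exp (b * Z x) + w x) / b" for x
      proof -
        have "\<bar>(exp (S n * Z x) - 1) / S n\<bar> \<le> \<bar>Z x\<bar> + (exp (b * Z x) + 1) / b"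
        proof -
          have "(exp (b * Z x) - 1) / b \<le> (exp (b * Z x) + 1) / b"
            using b by (intro divide_right_mono) auto
          moreover have "0 \<le> (exp (b * Z x) + 1) / b" using b by (auto intro!: divide_nonneg_pos add_nonneg_nonneg)
          ultimately show ?thesis
          using exp_slope_bounds[OF S(1)[of n] less_imp_le[OF S(2)[of n]], of "Z x"] by linarith
        qed
        from mult_left_mono[OF this w(2)[of x]] show ?thesis
          using w(2)[of x] by (simp add: abs_mult distrib_left)
      qed
      then show "AE x in M. norm (w x * ((exp (S n * Z x) - 1) / S n)) \<le> \<bar>w x * Z x\<bar> + (w x * exp (b * Z x) + w x) / b"
        by simp
    qed measurable
    moreover have "(\<integral>x. w x * ((exp (S n * Z x) - 1) / S n) \<partial>M)
        = ((\<integral>x. w x * exp (S n * Z x) \<partial>M) - (\<integral>x. w x \<partial>M)) / S n" for n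
    proof -
      have "(\<integral>x. w x * ((exp (S n * Z x) - 1) / S n) \<partial>M) = (\<integral>x. (w x * exp (S n * Z x) - w x) / S n \<partial>M)"
        by (simp add: algebra_simps)
      also have "\<dots> = (\<integral>x. w x * exp (S n * Z x) - w x \<partial>M) / S n" by simp
      finally show ?thesis using int[of "S n"] S w by (simp add: less_imp_le)
    qed
    ultimately show "(\<lambda>n. ((\<integral>x. w x * exp (S n * Z x) \<partial>M) - (\<integral>x. w x \<partial>M)) / S n) \<longlonglongrightarrow> (\<integral>x. w x * Z x \<partial>M)"
      by (simp only:)
  qed
qed

section \<open>Exponential moments near the root of the logarithmic moment generating function\<close>

text \<open>
  The law of a centred service time: its moment generating function is finite up to some point
  beyond \<open>\<gamma>\<close> and equals 1 at \<open>\<gamma>\<close>, although the mean is negative.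
\<close>

locale cramer_law = real_distribution D for D :: "real measure" +
  fixes \<gamma> r :: real
  assumes \<gamma>_pos: "\<gamma> > 0" and r_pos: "r > 0"
    and exp_integrable: "\<And>\<theta>. \<lbrakk>0 \<le> \<theta>; \<theta> \<le> \<gamma> + r\<rbrakk> \<Longrightarrow> integrable D (\<lambda>x. exp (\<theta> * x))"
    and mgf_\<gamma>: "(\<integral>x. exp (\<gamma> * x) \<partial>D) = 1"
    and mean_integrable: "integrable D (\<lambda>x. x)" and mean_neg: "(\<integral>x. x \<partial>D) < 0"
begin

definition mgf :: "real \<Rightarrow> real" where
  "mgf \<theta> = (\<integral>x. exp (\<theta> * x) \<partial>D)"

text \<open>
  The mean of the law with density \<open>exp (\<gamma> x)\<close> with respect to \<open>D\<close>, which is the derivative of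
  the logarithmic moment generating function at \<open>\<gamma>\<close>.
\<close>

definition tilted_mean :: real where
  "tilted_mean = (\<integral>x. exp (\<gamma> * x) * x \<partial>D)"

text \<open>
  A walk with this increment law that reaches a high level \<open>L / \<gamma>\<close> typically does so with the
  tilted mean as its speed, hence at time \<open>\<kappa> L\<close>.
\<close>

definition \<kappa> :: real where
  "\<kappa> = 1 / (\<gamma> * tilted_mean)"

lemma tilted_integrable: "integrable D (\<lambda>x. exp (\<gamma> * x) * x)"
proof (rule Bochner_Integration.integrable_bound)
  show "integrable D (\<lambda>x. exp ((\<gamma> + r) * x) / r + \<bar>x\<bar>)"
    using exp_integrable[of "\<gamma> + r"] \<gamma>_pos r_pos mean_integrable by auto
  have "\<bar>exp (\<gamma> * x) * x\<bar> \<le> exp ((\<gamma> + r) * x) / r + \<bar>x\<bar>" for x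
  proof (cases "x \<ge> 0")
    case True
    have "x \<le> exp (r * x) / r" using exp_ge_add_one_self[of "r * x"] r_pos
      unfolding pos_le_divide_eq[OF r_pos] mult.commute[of x] by linarith
    then have "exp (\<gamma> * x) * x \<le> exp (\<gamma> * x) * (exp (r * x) / r)" by (intro mult_left_mono) auto
    also have "\<dots> = exp ((\<gamma> + r) * x) / r" by (simp add: exp_add distrib_right)
    finally show ?thesis using True by (simp add: abs_mult)
  next
    case False
    then have "exp (\<gamma> * x) \<le> 1" using \<gamma>_pos by (simp add: mult_pos_neg less_imp_le)
    then have "exp (\<gamma> * x) * \<bar>x\<bar> \<le> 1 * \<bar>x\<bar>" by (intro mult_right_mono) auto
    then show ?thesis using r_pos by (simp add: abs_mult add_increasing)
  qed
  then show "AE x in D. norm (exp (\<gamma> * x) * x) \<le> norm (exp ((\<gamma> + r) * x) / r + \<bar>x\<bar>)"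
    unfolding real_norm_def by (blast intro: AE_I2 order_trans abs_ge_self)
qed simp

lemma mgf_right_derivative: "((\<lambda>\<eta>. (mgf (\<gamma> + \<eta>) - 1) / \<eta>) \<longlongrightarrow> tilted_mean) (at_right 0)"
proof -
  have eq: "exp (\<gamma> * x) * exp (\<eta> * x) = exp ((\<gamma> + \<eta>) * x)" for \<eta> x
    by (simp add: exp_add distrib_right)
  have "integrable D (\<lambda>x. exp (\<gamma> * x))" "integrable D (\<lambda>x. exp (\<gamma> * x) * exp (r * x))"
    using exp_integrable[of \<gamma>] exp_integrable[of "\<gamma> + r"] \<gamma>_pos r_pos unfolding eq by auto
  from exp_moment_right_derivative(2)[OF _ this(1) _ tilted_integrable r_pos this(2)]
  show ?thesis unfolding eq mgf_\<gamma> mgf_def[symmetric] tilted_mean_def[symmetric] by simp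
qed

lemma mgf_left_derivative: "((\<lambda>\<eta>. (mgf (\<gamma> - \<eta>) - 1) / \<eta>) \<longlongrightarrow> - tilted_mean) (at_right 0)"
proof -
  have eq: "exp (\<gamma> * x) * exp (\<eta> * - x) = exp ((\<gamma> - \<eta>) * x)" for \<eta> x
    by (simp add: left_diff_distrib flip: exp_add)
  have "integrable D (\<lambda>x. exp (\<gamma> * x))" "integrable D (\<lambda>x. exp (\<gamma> * x) * exp (\<gamma> * - x))"
      "integrable D (\<lambda>x. exp (\<gamma> * x) * - x)"
    using exp_integrable[of \<gamma>] \<gamma>_pos r_pos tilted_integrable unfolding eq by auto
  from exp_moment_right_derivative(2)[OF _ this(1) _ this(3) \<gamma>_pos this(2)]
  show ?thesis unfolding eq mgf_\<gamma> mgf_def[symmetric] by (simp add: tilted_mean_def)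
qed

lemma mgf_has_derivative: "(mgf has_real_derivative tilted_mean) (at \<gamma>)"
proof -
  have "((\<lambda>\<eta>. (mgf (\<gamma> + \<eta>) - 1) / \<eta>) \<longlongrightarrow> tilted_mean) (at_left 0)"
    using tendsto_minus[OF mgf_left_derivative]
    by (simp add: at_left_minus[of 0] filterlim_filtermap)
  with mgf_right_derivative have "((\<lambda>\<eta>. (mgf (\<gamma> + \<eta>) - 1) / \<eta>) \<longlongrightarrow> tilted_mean) (at 0)"
    by (simp add: filterlim_split_at)
  then show ?thesis
    by (simp add: DERIV_def mgf_def mgf_\<gamma>)
qed

text \<open>
  Pointwise \<open>1 - exp y + y exp y \<ge> 0\<close> with equality only for \<open>y = 0\<close>. For \<open>y = \<gamma> x\<close> the
  integral is \<open>\<gamma>\<close> times the tilted mean, and equality almost everywhere is excluded by the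
  negative mean.
\<close>

lemma tilted_mean_pos: "tilted_mean > 0"
proof -
  have int: "integrable D (\<lambda>x. 1 - exp (\<gamma> * x) + \<gamma> * (exp (\<gamma> * x) * x))"
    using exp_integrable[of \<gamma>] tilted_integrable \<gamma>_pos r_pos by auto
  have eq: "(\<integral>x. 1 - exp (\<gamma> * x) + \<gamma> * (exp (\<gamma> * x) * x) \<partial>D) = \<gamma> * tilted_mean"
    using exp_integrable[of \<gamma>] tilted_integrable \<gamma>_pos r_pos by (simp add: mgf_\<gamma> tilted_mean_def prob_space[unfolded space_eq_univ])
  have nonneg: "0 \<le> 1 - exp (\<gamma> * x) + \<gamma> * (exp (\<gamma> * x) * x)" for x
  proof -
    have "exp (\<gamma> * x) * (1 - \<gamma> * x) \<le> exp (\<gamma> * x) * exp (- (\<gamma> * x))"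
      using exp_ge_add_one_self[of "- (\<gamma> * x)"] by (intro mult_left_mono) auto
    then show ?thesis by (simp add: exp_minus algebra_simps)
  qed
  have strict: "x = 0" if "1 - exp (\<gamma> * x) + \<gamma> * (exp (\<gamma> * x) * x) = 0" for x
  proof (rule ccontr)
    assume "x \<noteq> 0"
    then have "1 + (- (\<gamma> * x)) < exp (- (\<gamma> * x))"
      using \<gamma>_pos exp_minus_greater[of "\<gamma> * x"] by simp
    then have "exp (\<gamma> * x) * (1 - \<gamma> * x) < exp (\<gamma> * x) * exp (- (\<gamma> * x))" by simp
    then show False using that by (simp add: exp_minus algebra_simps)
  qed
  have "\<gamma> * tilted_mean \<ge> 0" using nonneg by (subst eq[symmetric]) (rule integral_nonneg_AE, simp)
  moreover have "\<gamma> * tilted_mean \<noteq> 0"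
  proof
    assume "\<gamma> * tilted_mean = 0"
    then have "AE x in D. 1 - exp (\<gamma> * x) + \<gamma> * (exp (\<gamma> * x) * x) = 0"
      using integral_nonneg_eq_0_iff_AE[OF int AE_I2[OF nonneg]] unfolding eq by blast
    then have "AE x in D. x = 0" by eventually_elim (rule strict)
    then have "(\<integral>x. x \<partial>D) = (\<integral>x. 0 \<partial>D)" by (intro integral_cong_AE) auto
    then show False using mean_neg by simp
  qed
  ultimately show ?thesis using \<gamma>_pos by (simp add: zero_less_mult_iff order_le_less)
qed

lemma \<kappa>_pos: "\<kappa> > 0"
  unfolding \<kappa>_def using \<gamma>_pos tilted_mean_pos by simp

text \<open>
  Multiplied by \<open>exp (-(\<gamma> \<plusminus> \<eta>) L / \<gamma>)\<close>, these are Chernoff bounds for reaching level \<open>L / \<gamma>\<close>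
  at time \<open>k\<close>: for times at distance at least \<open>\<delta> L\<close> from \<open>\<kappa> L\<close> they are smaller than the value
  \<open>exp (- L)\<close> obtained from the exponent \<open>\<gamma>\<close> by a factor \<open>exp (- c L)\<close>. The first-order
  expansion of the moment generating function at \<open>\<gamma>\<close> suffices, because \<open>\<eta>\<close> is fixed before \<open>L\<close>
  tends to infinity.
\<close>

lemma rate_gap:
  assumes "\<delta> > 0"
  obtains \<eta> c where "0 < \<eta>" "\<eta> < \<gamma>" "\<eta> \<le> r" "0 < c"
    "\<And>L k. \<lbrakk>L \<ge> 0; real k \<le> (\<kappa> - \<delta>) * L\<rbrakk> \<Longrightarrow> mgf (\<gamma> + \<eta>) ^ k \<le> exp ((\<eta> / \<gamma> - c) * L)"
    "\<And>L k. real k \<ge> (\<kappa> + \<delta>) * L \<Longrightarrow> mgf (\<gamma> - \<eta>) ^ k \<le> exp ((- \<eta> / \<gamma> - c) * L)"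
proof -
  define s where "s = tilted_mean"
  \<comment> \<open>The error allowed in the slope is chosen to consume half of the gain \<open>\<delta> s\<close>.\<close>
  define \<rho> where "\<rho> = \<delta> * s / 2 / (\<kappa> + \<delta>)"
  have s: "s > 0" "\<kappa> * s = 1 / \<gamma>" using tilted_mean_pos \<gamma>_pos by (auto simp: s_def \<kappa>_def)
  have t: "\<kappa> + \<delta> > 0" using assms \<kappa>_pos by simp
  have \<rho>: "0 < \<rho>" "\<rho> * (\<kappa> + \<delta>) = \<delta> * s / 2"
    using s(1) assms t nonzero_eq_divide_eq[THEN iffD1, OF _ \<rho>_def] by (simp_all add: \<rho>_def)
  have "\<rho> * (\<kappa> + \<delta>) < s * (\<kappa> + \<delta>)"
    unfolding \<rho>(2) using s(1) assms \<kappa>_pos by (simp add: algebra_simps add_pos_pos)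
  then have \<rho>_less: "\<rho> < s" using assms \<kappa>_pos by simp
  have "eventually (\<lambda>\<eta>. (mgf (\<gamma> + \<eta>) - 1) / \<eta> < s + \<rho>) (at_right 0)"
    using order_tendstoD(2)[OF mgf_right_derivative, of "s + \<rho>"] \<rho> by (simp add: s_def)
  moreover have "eventually (\<lambda>\<eta>. (mgf (\<gamma> - \<eta>) - 1) / \<eta> < - s + \<rho>) (at_right 0)"
    using order_tendstoD(2)[OF mgf_left_derivative, of "- s + \<rho>"] \<rho> by (simp add: s_def)
  moreover have "eventually (\<lambda>\<eta>. \<eta> \<in> {0<..<min \<gamma> r}) (at_right (0::real))"
    using eventually_at_right_real[of 0 "min \<gamma> r"] \<gamma>_pos r_pos by auto
  ultimately have "eventually (\<lambda>\<eta>. (mgf (\<gamma> + \<eta>) - 1) / \<eta> < s + \<rho> \<and> (mgf (\<gamma> - \<eta>) - 1) / \<eta> < - s + \<rho>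
      \<and> \<eta> \<in> {0<..<min \<gamma> r}) (at_right 0)"
    by eventually_elim auto
  then obtain \<eta> where \<eta>: "(mgf (\<gamma> + \<eta>) - 1) / \<eta> < s + \<rho>" "(mgf (\<gamma> - \<eta>) - 1) / \<eta> < - s + \<rho>"
      "0 < \<eta>" "\<eta> < \<gamma>" "\<eta> < r"
    by (auto dest!: eventually_happens)
  have nonneg: "mgf \<theta> \<ge> 0" for \<theta> unfolding mgf_def by (intro integral_nonneg_AE) auto
  have up: "mgf (\<gamma> + \<eta>) \<le> exp (\<eta> * (s + \<rho>))"
    using \<eta>(1) exp_ge_add_one_self[of "\<eta> * (s + \<rho>)"]
    unfolding pos_divide_less_eq[OF \<open>0 < \<eta>\<close>] mult.commute[of _ \<eta>] by linarith
  have lo: "mgf (\<gamma> - \<eta>) \<le> exp (- \<eta> * (s - \<rho>))"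
    using \<eta>(2) exp_ge_add_one_self[of "- \<eta> * (s - \<rho>)"]
    unfolding pos_divide_less_eq[OF \<open>0 < \<eta>\<close>] by (simp add: algebra_simps)
  show thesis
  proof (rule that[of \<eta> "\<eta> * \<delta> * s / 2"])
    fix L :: real and k :: nat assume L: "L \<ge> 0" and k: "real k \<le> (\<kappa> - \<delta>) * L"
    show "mgf (\<gamma> + \<eta>) ^ k \<le> exp ((\<eta> / \<gamma> - \<eta> * \<delta> * s / 2) * L)"
    proof -
      have "mgf (\<gamma> + \<eta>) ^ k \<le> exp (\<eta> * (s + \<rho>)) ^ k" by (intro power_mono up nonneg)
      also have "\<dots> = exp (\<eta> * ((s + \<rho>) * k))" by (simp add: exp_of_nat_mult[symmetric] ac_simps)
      also have "\<dots> \<le> exp ((\<eta> / \<gamma> - \<eta> * \<delta> * s / 2) * L)"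
      proof -
        have "(s + \<rho>) * k \<le> (s + \<rho>) * ((\<kappa> - \<delta>) * L)" using k \<rho> s by (intro mult_left_mono) auto
        also have "\<dots> = (\<kappa> * s - \<delta> * s + \<rho> * (\<kappa> + \<delta>) - 2 * (\<rho> * \<delta>)) * L" by (simp add: algebra_simps)
        also have "\<dots> \<le> (\<kappa> * s - \<delta> * s + \<rho> * (\<kappa> + \<delta>)) * L"
          using L \<rho> assms by (intro mult_right_mono) auto
        also have "\<dots> = (1 / \<gamma> - \<delta> * s / 2) * L" using \<rho>(2) s(2) by simp
        finally have "\<eta> * ((s + \<rho>) * k) \<le> \<eta> * ((1 / \<gamma> - \<delta> * s / 2) * L)" using \<eta> by (intro mult_left_mono) auto
        then show ?thesis by (simp add: algebra_simps)
      qed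
      finally show ?thesis .
    qed
  next
    fix L :: real and k :: nat assume k: "real k \<ge> (\<kappa> + \<delta>) * L"
    show "mgf (\<gamma> - \<eta>) ^ k \<le> exp ((- \<eta> / \<gamma> - \<eta> * \<delta> * s / 2) * L)"
    proof -
      have "mgf (\<gamma> - \<eta>) ^ k \<le> exp (- \<eta> * (s - \<rho>)) ^ k" by (intro power_mono lo nonneg)
      also have "\<dots> = exp (\<eta> * (- (s - \<rho>) * k))" by (simp add: exp_of_nat_mult[symmetric] algebra_simps)
      also have "\<dots> \<le> exp ((- \<eta> / \<gamma> - \<eta> * \<delta> * s / 2) * L)"
      proof -
        have "(s - \<rho>) * k \<ge> (s - \<rho>) * ((\<kappa> + \<delta>) * L)" using k \<rho>_less by (intro mult_left_mono) auto
        also have "(s - \<rho>) * ((\<kappa> + \<delta>) * L) = (\<kappa> * s + \<delta> * s - \<rho> * (\<kappa> + \<delta>)) * L" by (simp add: algebra_simps)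
        also have "\<dots> = (1 / \<gamma> + \<delta> * s / 2) * L" using \<rho>(2) s(2) by simp
        finally have "- (s - \<rho>) * k \<le> - ((1 / \<gamma> + \<delta> * s / 2) * L)"
          unfolding mult_minus_left by linarith
        then have "\<eta> * (- (s - \<rho>) * k) \<le> \<eta> * - ((1 / \<gamma> + \<delta> * s / 2) * L)" using \<eta> by (intro mult_left_mono) auto
        then show ?thesis by (simp add: algebra_simps)
      qed
      finally show ?thesis .
    qed
  qed (use \<eta> s assms in auto)
qed

end

lemma (in real_distribution) negative_drift_mgf:
  assumes "integrable M (\<lambda>x. x)" "(\<integral>x. x \<partial>M) < 0" "b > 0" "integrable M (\<lambda>x. exp (b * x))"
  obtains \<theta> where "0 < \<theta>" "\<theta> \<le> b" "integrable M (\<lambda>x. exp (\<theta> * x))" "(\<integral>x. exp (\<theta> * x) \<partial>M) < 1"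
proof -
  have one: "integrable M (\<lambda>x. 1::real)" by simp
  have "integrable M (\<lambda>x. 1 * x)" "integrable M (\<lambda>x. 1 * exp (b * x))"
    using assms by simp_all
  note R = exp_moment_right_derivative[OF _ one _ this(1) \<open>b > 0\<close> this(2)]
  have D: "integrable M (\<lambda>x. exp (\<eta> * x))" if "0 \<le> \<eta>" "\<eta> \<le> b" for \<eta>
    using R(1)[OF _ _ that] by simp
  have lim: "((\<lambda>\<eta>. ((\<integral>x. exp (\<eta> * x) \<partial>M) - 1) / \<eta>) \<longlongrightarrow> (\<integral>x. x \<partial>M)) (at_right 0)"
    using R(2) by (simp add: prob_space[unfolded space_eq_univ])
  have "eventually (\<lambda>\<eta>. ((\<integral>x. exp (\<eta> * x) \<partial>M) - 1) / \<eta> < 0) (at_right 0)"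
    using order_tendstoD(2)[OF lim assms(2)] .
  moreover have "eventually (\<lambda>\<eta>. \<eta> \<in> {0<..<b}) (at_right (0::real))"
    using eventually_at_right_real assms by auto
  ultimately have "eventually (\<lambda>\<eta>. ((\<integral>x. exp (\<eta> * x) \<partial>M) - 1) / \<eta> < 0 \<and> \<eta> \<in> {0<..<b}) (at_right 0)"
    by eventually_elim auto
  then obtain \<theta> where "((\<integral>x. exp (\<theta> * x) \<partial>M) - 1) / \<theta> < 0" "\<theta> \<in> {0<..<b}"
    by (auto dest!: eventually_happens)
  with D[of \<theta>] show thesis by (intro that[of \<theta>]) (auto simp: divide_less_0_iff)
qed

section \<open>A time at which a high level is likely\<close>

locale cramer_walk = cramer_law D \<gamma> r + walk: prob_space M
  for D :: "real measure" and \<gamma> r :: real and M :: "'a measure" +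
  fixes X :: "nat \<Rightarrow> 'a \<Rightarrow> real"
  assumes X_indep: "walk.indep_vars (\<lambda>_. borel) X UNIV"
    and X_law: "\<And>m. distr M borel (X m) = D"
begin

definition S :: "nat \<Rightarrow> 'a \<Rightarrow> real" where
  "S k \<omega> = (\<Sum>m<k. X m \<omega>)"

lemma X_meas [measurable]: "X m \<in> borel_measurable M"
  using X_indep by (auto simp: walk.indep_vars_def)

lemma S_meas [measurable]: "S k \<in> borel_measurable M"
  unfolding S_def[abs_def] by measurable

lemma exp_S:
  assumes "0 \<le> \<theta>" "\<theta> \<le> \<gamma> + r"
  shows "integrable M (\<lambda>\<omega>. exp (\<theta> * S k \<omega>))" "walk.expectation (\<lambda>\<omega>. exp (\<theta> * S k \<omega>)) = mgf \<theta> ^ k"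
  using walk.expectation_exp_iid_sum[OF finite_lessThan walk.indep_vars_subset[OF X_indep subset_UNIV]
    X_law exp_integrable[OF assms], of k] unfolding S_def mgf_def by auto

lemma S_X_indep: "walk.indep_var borel (X k) borel (S k)"
proof -
  have "walk.indep_vars (\<lambda>_. borel) X (insert k {..<k})"
    by (rule walk.indep_vars_subset[OF X_indep]) auto
  from walk.indep_vars_sum[OF _ _ this] show ?thesis by (simp add: S_def[abs_def])
qed

text \<open>
  The next increment is independent of the walk so far. With \<open>g x = exp (\<gamma> x)\<close>, whose mean is
  1, this says that weighting by the position one step later changes no expectation.
\<close>

lemma expectation_step:
  assumes [measurable]: "f \<in> borel_measurable borel" "g \<in> borel_measurable borel"
    and "integrable M (\<lambda>\<omega>. f (S k \<omega>))" "integrable M (\<lambda>\<omega>. g (X k \<omega>))"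
  shows "integrable M (\<lambda>\<omega>. g (X k \<omega>) * f (S k \<omega>) :: real)"
    "walk.expectation (\<lambda>\<omega>. g (X k \<omega>) * f (S k \<omega>)) = (\<integral>x. g x \<partial>D) * walk.expectation (\<lambda>\<omega>. f (S k \<omega>))"
proof -
  have ind: "walk.indep_var borel (\<lambda>\<omega>. g (X k \<omega>)) borel (\<lambda>\<omega>. f (S k \<omega>))"
    using walk.indep_var_compose[OF S_X_indep, of g borel f borel] assms(1,2) by (simp add: comp_def)
  show "integrable M (\<lambda>\<omega>. g (X k \<omega>) * f (S k \<omega>) :: real)"
    using walk.indep_var_integrable[OF ind assms(4,3)] .
  have "walk.expectation (\<lambda>\<omega>. g (X k \<omega>)) = (\<integral>x. g x \<partial>D)"
    unfolding X_law[of k, symmetric] by (subst integral_distr) auto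
  then show "walk.expectation (\<lambda>\<omega>. g (X k \<omega>) * f (S k \<omega>)) = (\<integral>x. g x \<partial>D) * walk.expectation (\<lambda>\<omega>. f (S k \<omega>))"
    using walk.indep_var_lebesgue_integral[OF ind assms(4,3)] by simp
qed

text \<open>
  The probability of the event \<open>S k < a\<close> under the tilted law, expressed by a weight of mean
  1.
\<close>

definition tilted_below :: "nat \<Rightarrow> real \<Rightarrow> real" where
  "tilted_below k a = walk.expectation (\<lambda>\<omega>. exp (\<gamma> * S k \<omega>) * indicator {..<a} (S k \<omega>))"

lemma tilted_integrable_indicator:
  assumes "A \<in> sets borel"
  shows "integrable M (\<lambda>\<omega>. exp (\<gamma> * S k \<omega>) * indicator A (S k \<omega>))"
proof -
  have "S k -` A \<inter> space M \<in> sets M" using assms by measurable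
  from integrable_mult_indicator[OF this exp_S(1)[of \<gamma> k]] have
    "integrable M (\<lambda>\<omega>. indicator (S k -` A \<inter> space M) \<omega> * exp (\<gamma> * S k \<omega>))"
    using \<gamma>_pos r_pos by simp
  then show ?thesis
    by (rule Bochner_Integration.integrable_cong[THEN iffD1, rotated 2]) (auto simp: indicator_def)
qed

lemma mgf_\<gamma>_eq: "mgf \<gamma> = 1" using mgf_\<gamma> by (simp add: mgf_def)

lemma tilted_below_lower:
  assumes "0 < \<eta>" "\<eta> \<le> r"
  shows "1 - exp (- \<eta> * a) * mgf (\<gamma> + \<eta>) ^ k \<le> tilted_below k a"
proof -
  have "1 - exp (- \<eta> * a) * mgf (\<gamma> + \<eta>) ^ k
      = walk.expectation (\<lambda>\<omega>. exp (\<gamma> * S k \<omega>) - exp (- \<eta> * a) * exp ((\<gamma> + \<eta>) * S k \<omega>))"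
    using exp_S[of \<gamma> k] exp_S[of "\<gamma> + \<eta>" k] assms \<gamma>_pos r_pos mgf_\<gamma>_eq by simp
  also have "\<dots> \<le> tilted_below k a"
    unfolding tilted_below_def
  proof (rule integral_mono)
    show "integrable M (\<lambda>\<omega>. exp (\<gamma> * S k \<omega>) - exp (- \<eta> * a) * exp ((\<gamma> + \<eta>) * S k \<omega>))"
      using exp_S[of \<gamma> k] exp_S[of "\<gamma> + \<eta>" k] assms \<gamma>_pos r_pos by simp
    fix \<omega>
    have "exp (\<gamma> * s) - exp (- \<eta> * a) * exp ((\<gamma> + \<eta>) * s) \<le> exp (\<gamma> * s) * indicator {..<a} s" for s :: real
    proof (cases "s < a")
      case False
      then have "\<gamma> * s \<le> - \<eta> * a + (\<gamma> + \<eta>) * s" using assms mult_left_mono[of a s \<eta>] by (simp add: algebra_simps)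
      then show ?thesis using False by (simp flip: exp_add)
    qed auto
    then show "exp (\<gamma> * S k \<omega>) - exp (- \<eta> * a) * exp ((\<gamma> + \<eta>) * S k \<omega>) \<le> exp (\<gamma> * S k \<omega>) * indicator {..<a} (S k \<omega>)" .
  qed (rule tilted_integrable_indicator, simp)
  finally show ?thesis .
qed

lemma tilted_below_upper:
  assumes "0 < \<eta>" "\<eta> \<le> \<gamma>"
  shows "tilted_below k a \<le> exp (\<eta> * a) * mgf (\<gamma> - \<eta>) ^ k"
proof -
  have "tilted_below k a \<le> walk.expectation (\<lambda>\<omega>. exp (\<eta> * a) * exp ((\<gamma> - \<eta>) * S k \<omega>))"
    unfolding tilted_below_def
  proof (rule integral_mono)
    show "integrable M (\<lambda>\<omega>. exp (\<eta> * a) * exp ((\<gamma> - \<eta>) * S k \<omega>))"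
      using exp_S[of "\<gamma> - \<eta>" k] assms \<gamma>_pos r_pos by simp
    fix \<omega>
    have "exp (\<gamma> * s) * indicator {..<a} s \<le> exp (\<eta> * a) * exp ((\<gamma> - \<eta>) * s)" for s :: real
    proof (cases "s < a")
      case True
      then have "\<gamma> * s \<le> \<eta> * a + (\<gamma> - \<eta>) * s" using assms mult_left_mono[of s a \<eta>] by (simp add: algebra_simps)
      then show ?thesis using True by (simp flip: exp_add)
    qed auto
    then show "exp (\<gamma> * S k \<omega>) * indicator {..<a} (S k \<omega>) \<le> exp (\<eta> * a) * exp ((\<gamma> - \<eta>) * S k \<omega>)" .
  qed (rule tilted_integrable_indicator, simp)
  also have "\<dots> = exp (\<eta> * a) * mgf (\<gamma> - \<eta>) ^ k"
    using exp_S[of "\<gamma> - \<eta>" k] assms \<gamma>_pos r_pos by simp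
  finally show ?thesis .
qed

text \<open>
  If the weight below \<open>a\<close> drops in one step, then that step crosses \<open>a\<close>. Either the increment
  is at most \<open>h\<close>, so the weight is at most \<open>exp (\<gamma> (a + h))\<close> after the step, or the increment
  exceeds \<open>h\<close>, which the larger exponent \<open>\<gamma> + \<eta>\<close> makes unlikely.
\<close>

lemma tilted_below_drop:
  assumes "0 < \<eta>" "\<eta> \<le> r"
  shows "tilted_below k a - tilted_below (Suc k) a
    \<le> exp (\<gamma> * (a + h)) * walk.prob {\<omega>\<in>space M. a \<le> S (Suc k) \<omega>} + exp (- \<eta> * h) * mgf (\<gamma> + \<eta>)"
proof -
  have S_Suc: "S (Suc k) \<omega> = X k \<omega> + S k \<omega>" for \<omega> by (simp add: S_def)
  have intX: "integrable M (\<lambda>\<omega>. exp (\<theta> * X k \<omega>))" if "0 \<le> \<theta>" "\<theta> \<le> \<gamma> + r" for \<theta>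
    using exp_integrable[OF that] unfolding X_law[of k, symmetric]
    by (subst (asm) integrable_distr_eq) auto
  note E1 = expectation_step[where f = "\<lambda>s. exp (\<gamma> * s) * indicator {..<a} s" and g = "\<lambda>x. exp (\<gamma> * x)" and k = k,
      OF _ _ tilted_integrable_indicator intX]
  note E2 = expectation_step[where f = "\<lambda>s. exp (\<gamma> * s)" and g = "\<lambda>x. exp ((\<gamma> + \<eta>) * x)" and k = k,
      OF _ _ exp_S(1) intX]
  have "tilted_below k a - tilted_below (Suc k) a
    = walk.expectation (\<lambda>\<omega>. exp (\<gamma> * X k \<omega>) * (exp (\<gamma> * S k \<omega>) * indicator {..<a} (S k \<omega>))
        - exp (\<gamma> * S (Suc k) \<omega>) * indicator {..<a} (S (Suc k) \<omega>))"
    using E1 tilted_integrable_indicator[of "{..<a}" "Suc k"] \<gamma>_pos r_pos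
    by (simp add: tilted_below_def mgf_\<gamma>)
  also have "\<dots> \<le> walk.expectation (\<lambda>\<omega>. exp (\<gamma> * (a + h)) * indicator {\<omega>\<in>space M. a \<le> S (Suc k) \<omega>} \<omega>
        + exp (- \<eta> * h) * (exp ((\<gamma> + \<eta>) * X k \<omega>) * exp (\<gamma> * S k \<omega>)))"
  proof (rule integral_mono)
    show "integrable M (\<lambda>\<omega>. exp (\<gamma> * X k \<omega>) * (exp (\<gamma> * S k \<omega>) * indicator {..<a} (S k \<omega>))
        - exp (\<gamma> * S (Suc k) \<omega>) * indicator {..<a} (S (Suc k) \<omega>))"
      using E1 tilted_integrable_indicator[of "{..<a}" "Suc k"] \<gamma>_pos r_pos by simp
    have "integrable M (indicat_real {\<omega>\<in>space M. a \<le> S (Suc k) \<omega>})"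
      by (rule walk.integrable_const_bound[where B = 1]) auto
    then show "integrable M (\<lambda>\<omega>. exp (\<gamma> * (a + h)) * indicator {\<omega>\<in>space M. a \<le> S (Suc k) \<omega>} \<omega>
        + exp (- \<eta> * h) * (exp ((\<gamma> + \<eta>) * X k \<omega>) * exp (\<gamma> * S k \<omega>)))"
      using E2 assms \<gamma>_pos r_pos by simp
    fix \<omega> assume \<omega>: "\<omega> \<in> space M"
    define s where "s = S k \<omega>"
    define x where "x = X k \<omega>"
    have "exp (\<gamma> * x) * (exp (\<gamma> * s) * indicator {..<a} s) - exp (\<gamma> * (x + s)) * indicator {..<a} (x + s)
      \<le> exp (\<gamma> * (a + h)) * indicator {a..} (x + s) + exp (- \<eta> * h) * (exp ((\<gamma> + \<eta>) * x) * exp (\<gamma> * s))"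
      (is "?l \<le> ?r")
    proof (cases "s < a \<and> a \<le> x + s")
      case False
      then have "?l \<le> 0" by (auto simp: indicator_def exp_add distrib_left)
      also have "0 \<le> ?r" by auto
      finally show ?thesis .
    next
      case True
      then have l: "?l = exp (\<gamma> * (x + s))" by (simp add: exp_add distrib_left)
      show ?thesis
      proof (cases "x \<le> h")
        case True2: True
        have "exp (\<gamma> * (x + s)) \<le> exp (\<gamma> * (a + h))" using True True2 \<gamma>_pos by simp
        then show ?thesis using True unfolding l by (simp add: add_increasing2)
      next
        case False
        then have "\<eta> * h \<le> \<eta> * x" using assms by simp
        then have "exp (\<gamma> * (x + s)) \<le> exp (- \<eta> * h + ((\<gamma> + \<eta>) * x + \<gamma> * s))" by (simp add: algebra_simps)
        then show ?thesis unfolding l exp_add by (simp add: add_increasing)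
      qed
    qed
    then show "exp (\<gamma> * X k \<omega>) * (exp (\<gamma> * S k \<omega>) * indicator {..<a} (S k \<omega>))
        - exp (\<gamma> * S (Suc k) \<omega>) * indicator {..<a} (S (Suc k) \<omega>)
      \<le> exp (\<gamma> * (a + h)) * indicator {\<omega>\<in>space M. a \<le> S (Suc k) \<omega>} \<omega>
        + exp (- \<eta> * h) * (exp ((\<gamma> + \<eta>) * X k \<omega>) * exp (\<gamma> * S k \<omega>))"
      using \<omega> by (simp add: s_def x_def S_Suc indicator_def)
  qed
  also have "\<dots> = exp (\<gamma> * (a + h)) * walk.prob {\<omega>\<in>space M. a \<le> S (Suc k) \<omega>} + exp (- \<eta> * h) * mgf (\<gamma> + \<eta>)"
  proof -
    have "integrable M (indicat_real {\<omega>\<in>space M. a \<le> S (Suc k) \<omega>})"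
      by (rule walk.integrable_const_bound[where B = 1]) auto
    then show ?thesis
      using E2 exp_S(2)[of \<gamma> k] assms \<gamma>_pos r_pos by (simp add: mgf_\<gamma>_eq mgf_def[symmetric])
  qed
  finally show ?thesis .
qed

text \<open>
  The weight below the level \<open>a = L / \<gamma> - \<epsilon> sqrt L\<close> is at least \<open>3/4\<close> before the window around
  \<open>\<kappa> L\<close> and at most \<open>1/4\<close> after it, so one of the at most \<open>C L\<close> steps in between accounts for
  a drop of \<open>1 / (2 C L)\<close>. Undoing the weight costs the factor
  \<open>exp (- \<gamma> (a + h)) = exp (- L + \<gamma> \<epsilon> / 2 sqrt L)\<close> for the overshoot allowance
  \<open>h = \<epsilon> / 2 sqrt L\<close>; half of the surplus in the exponent absorbs the polynomial factor.
\<close>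

lemma likely_level_time:
  assumes "0 < \<delta>" "\<delta> < \<kappa>" "\<epsilon> > 0"
  shows "eventually (\<lambda>L. \<exists>k. (\<kappa> - \<delta>) * L \<le> k \<and> k \<le> (\<kappa> + \<delta>) * L + 1 \<and>
      exp (- L + \<gamma> * \<epsilon> / 4 * sqrt L) \<le> walk.prob {\<omega>\<in>space M. L / \<gamma> - \<epsilon> * sqrt L \<le> S k \<omega>}) at_top"
proof -
  obtain \<eta> c where \<eta>: "0 < \<eta>" "\<eta> < \<gamma>" "\<eta> \<le> r" and c: "0 < c"
    and low: "\<And>L k. \<lbrakk>L \<ge> 0; real k \<le> (\<kappa> - \<delta>) * L\<rbrakk> \<Longrightarrow> mgf (\<gamma> + \<eta>) ^ k \<le> exp ((\<eta> / \<gamma> - c) * L)"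
    and high: "\<And>L k. real k \<ge> (\<kappa> + \<delta>) * L \<Longrightarrow> mgf (\<gamma> - \<eta>) ^ k \<le> exp ((- \<eta> / \<gamma> - c) * L)"
    using rate_gap[OF assms(1)] by metis
  define C where "C = 2 * \<delta> + 3"
  define K where "K = mgf (\<gamma> + \<eta>)"
  have "eventually (\<lambda>L::real. L \<ge> 1) at_top" by (rule eventually_ge_at_top)
  moreover have "eventually (\<lambda>L. exp (\<eta> * \<epsilon> * sqrt L - c * L) \<le> 1/4) at_top" using \<eta> c assms by real_asymp
  moreover have "eventually (\<lambda>L. exp (- c * L) \<le> 1/4) at_top" using c by real_asymp
  moreover have "eventually (\<lambda>L. exp (- \<eta> * (\<epsilon> / 2 * sqrt L)) * K \<le> 1 / (4 * C * L)) at_top"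
    using \<eta> assms by (real_asymp simp: C_def)
  moreover have "eventually (\<lambda>L. exp (\<gamma> * \<epsilon> / 4 * sqrt L) \<ge> 4 * C * L) at_top"
    using \<gamma>_pos assms by (real_asymp simp: C_def)
  ultimately show ?thesis
  proof eventually_elim
    case (elim L)
    define a where "a = L / \<gamma> - \<epsilon> * sqrt L"
    define h where "h = \<epsilon> / 2 * sqrt L"
    define k1 where "k1 = nat \<lfloor>(\<kappa> - \<delta>) * L\<rfloor>"
    define k2 where "k2 = nat \<lceil>(\<kappa> + \<delta>) * L\<rceil>"
    have pos: "0 \<le> (\<kappa> - \<delta>) * L" "0 \<le> (\<kappa> + \<delta>) * L" using assms \<kappa>_pos elim by auto
    have k1: "real k1 \<le> (\<kappa> - \<delta>) * L" "(\<kappa> - \<delta>) * L \<le> real k1 + 1"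
      using pos unfolding k1_def by linarith+
    have k2: "real k2 \<ge> (\<kappa> + \<delta>) * L" "real k2 \<le> (\<kappa> + \<delta>) * L + 1"
      using pos unfolding k2_def by linarith+
    have "(\<kappa> - \<delta>) * L \<le> (\<kappa> + \<delta>) * L" using assms elim by (intro mult_right_mono) auto
    then have "k1 \<le> k2" using k1(1) k2(1) by linarith
    have len: "real (k2 - k1) \<le> C * L"
      using \<open>k1 \<le> k2\<close> k1 k2 elim by (simp add: C_def algebra_simps of_nat_diff)
    have "3/4 \<le> tilted_below k1 a"
    proof -
      have "exp (- \<eta> * a) * mgf (\<gamma> + \<eta>) ^ k1 \<le> exp (- \<eta> * a) * exp ((\<eta> / \<gamma> - c) * L)"
        using low[OF _ k1(1)] elim by (intro mult_left_mono) auto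
      also have "\<dots> = exp (\<eta> * \<epsilon> * sqrt L - c * L)"
        by (simp add: a_def algebra_simps flip: exp_add)
      also have "\<dots> \<le> 1/4" using elim by simp
      finally show ?thesis using tilted_below_lower[OF \<eta>(1,3), of a k1] by linarith
    qed
    moreover have "tilted_below k2 a \<le> 1/4"
    proof -
      have "tilted_below k2 a \<le> exp (\<eta> * a) * mgf (\<gamma> - \<eta>) ^ k2"
        using tilted_below_upper[of \<eta> k2 a] \<eta> by simp
      also have "\<dots> \<le> exp (\<eta> * a) * exp ((- \<eta> / \<gamma> - c) * L)"
        using high[OF k2(1)] by (intro mult_left_mono) auto
      also have "\<dots> = exp (- c * L - \<eta> * \<epsilon> * sqrt L)"
        by (simp add: a_def algebra_simps flip: exp_add)
      also have "\<dots> \<le> exp (- c * L)" using \<eta> assms elim by simp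
      finally show ?thesis using elim by simp
    qed
    ultimately have drop: "1/2 \<le> tilted_below k1 a - tilted_below k2 a" by simp
    obtain k where k: "k1 \<le> k" "k < k2" "1 / (2 * C * L) \<le> tilted_below k a - tilted_below (Suc k) a"
    proof (rule ccontr)
      assume "\<not> thesis"
      then have small: "tilted_below k a - tilted_below (Suc k) a < 1 / (2 * C * L)" if "k \<in> {k1..<k2}" for k
        using that \<open>\<And>k. _ \<Longrightarrow> _ \<Longrightarrow> _ \<Longrightarrow> thesis\<close> by (force simp: not_le)
      have "k1 < k2" using drop \<open>k1 \<le> k2\<close> by (cases "k1 = k2") auto
      have "tilted_below k1 a - tilted_below k2 a = (\<Sum>k=k1..<k2. tilted_below k a - tilted_below (Suc k) a)"
        using sum_Suc_diff'[OF \<open>k1 \<le> k2\<close>, of "\<lambda>k. tilted_below k a"] by (simp add: sum_subtractf)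
      also have "\<dots> < (\<Sum>k=k1..<k2. 1 / (2 * C * L))"
        using small \<open>k1 < k2\<close> by (intro sum_strict_mono) auto
      also have "\<dots> = real (k2 - k1) / (2 * (C * L))" by simp
      also have "\<dots> \<le> (C * L) / (2 * (C * L))" using len elim assms by (intro divide_right_mono) (auto simp: C_def)
      also have "\<dots> = 1/2" using elim assms by (simp add: C_def)
      finally show False using drop by simp
    qed
    have "exp (\<gamma> * (a + h)) * walk.prob {\<omega>\<in>space M. a \<le> S (Suc k) \<omega>} \<ge> 1 / (4 * C * L)"
    proof -
      have "1 / (2 * t) - 1 / (4 * t) = 1 / (4 * t)" for t :: real
        by (cases "t = 0") (auto simp: field_simps)
      from this[of "C * L"] have "1 / (2 * C * L) - 1 / (4 * C * L) = 1 / (4 * C * L)"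
        by (simp only: mult.assoc)
      moreover have "exp (- \<eta> * h) * mgf (\<gamma> + \<eta>) \<le> 1 / (4 * C * L)" using elim by (simp add: h_def K_def)
      ultimately show ?thesis using tilted_below_drop[OF \<eta>(1,3), of k a h] k(3) by linarith
    qed
    then have "exp (- \<gamma> * (a + h)) * (1 / (4 * C * L))
        \<le> exp (- \<gamma> * (a + h)) * (exp (\<gamma> * (a + h)) * walk.prob {\<omega>\<in>space M. a \<le> S (Suc k) \<omega>})"
      by (intro mult_left_mono) auto
    also have "\<dots> = walk.prob {\<omega>\<in>space M. a \<le> S (Suc k) \<omega>}" by (simp add: exp_minus)
    finally have low_prob: "exp (- \<gamma> * (a + h)) * (1 / (4 * C * L)) \<le> walk.prob {\<omega>\<in>space M. a \<le> S (Suc k) \<omega>}" .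
    have "exp (- L + \<gamma> * \<epsilon> / 4 * sqrt L) = exp (- \<gamma> * (a + h)) * exp (- (\<gamma> * \<epsilon> / 4 * sqrt L))"
      using \<gamma>_pos by (simp add: a_def h_def algebra_simps flip: exp_add)
    also have "\<dots> \<le> exp (- \<gamma> * (a + h)) * (1 / (4 * C * L))"
      using elim assms by (intro mult_left_mono) (auto simp: exp_minus inverse_eq_divide C_def intro!: divide_left_mono)
    finally have "exp (- L + \<gamma> * \<epsilon> / 4 * sqrt L) \<le> walk.prob {\<omega>\<in>space M. a \<le> S (Suc k) \<omega>}" using low_prob by simp
    moreover have "(\<kappa> - \<delta>) * L \<le> real (Suc k)" using k(1) k1(2) by linarith
    moreover have "real (Suc k) \<le> (\<kappa> + \<delta>) * L + 1" using k(2) k2(2) by linarith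
    ultimately show ?case unfolding a_def by blast
  qed
qed

end

section \<open>Random walks of the fork-join queue\<close>

locale fork_join = prob_space M
  for M :: "'a measure" +
  fixes S A U :: "'a \<Rightarrow> real"
    and Serv :: "nat \<Rightarrow> nat \<Rightarrow> 'a \<Rightarrow> real"
    and Arr :: "nat \<Rightarrow> 'a \<Rightarrow> real"
    and lam \<mu> \<sigma> \<gamma> :: real
  assumes S_meas [measurable]: "S \<in> borel_measurable M" and S_nonneg: "AE \<omega> in M. S \<omega> \<ge> 0"
    and A_meas [measurable]: "A \<in> borel_measurable M" and A_nonneg: "AE \<omega> in M. A \<omega> \<ge> 0"
    and inputs_indep: "indep_vars (\<lambda>_. borel) (input_var Serv Arr U) input_indices"
    and Serv_distr: "\<And>i j. i \<ge> 1 \<Longrightarrow> j \<ge> 1 \<Longrightarrow> distr M borel (Serv i j) = distr M borel S"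
    and Arr_distr: "\<And>j. j \<ge> 1 \<Longrightarrow> distr M borel (Arr j) = distr M borel A"
    and lam_pos: "lam > 0"
    and U_distributed: "distributed M lborel U
           (\<lambda>x. ennreal (if x > 0 then lam * \<P>(\<omega> in M. A \<omega> > x) else 0))"
    and A_integrable: "integrable M A" and A_mean: "expectation A = 1 / lam"
    and A_square: "integrable M (\<lambda>\<omega>. (A \<omega>)\<^sup>2)" and A_variance: "variance A = \<sigma>\<^sup>2"
    and \<mu>_pos: "\<mu> > 0"
    and drift_integrable: "integrable M (\<lambda>\<omega>. S \<omega> - A \<omega>)"
    and drift: "expectation (\<lambda>\<omega>. S \<omega> - A \<omega>) = - \<mu>"
    and \<gamma>_pos: "\<gamma> > 0" and log_mgf_zero: "log_mgf M S lam \<gamma> = 0"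
    and \<gamma>_interior: "\<gamma> \<in> interior {\<theta>. log_mgf M S lam \<theta> < \<infinity>}"
begin

lemma input_meas: "v \<in> input_indices \<Longrightarrow> input_var Serv Arr U v \<in> borel_measurable M"
  using inputs_indep by (auto simp: indep_vars_def)

lemma Serv_meas: "i \<ge> 1 \<Longrightarrow> j \<ge> 1 \<Longrightarrow> Serv i j \<in> borel_measurable M"
  using input_meas[of "Service i j"] by (auto simp: input_indices_def)

lemma Arr_meas: "j \<ge> 1 \<Longrightarrow> Arr j \<in> borel_measurable M"
  using input_meas[of "Interarrival j"] by (auto simp: input_indices_def)

lemma U_meas [measurable]: "U \<in> borel_measurable M"
  using input_meas[of Elapsed] by (auto simp: input_indices_def)

lemma AE_equidistributed:
  assumes "distr M borel X = distr M borel Y" "X \<in> borel_measurable M" "Y \<in> borel_measurable M"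
    and "{x. P x} \<in> sets borel" "AE \<omega> in M. P (Y \<omega>)"
  shows "AE \<omega> in M. P (X \<omega>)"
proof -
  have "AE x in distr M borel Y. P x" using assms by (subst AE_distr_iff) auto
  then show ?thesis unfolding assms(1)[symmetric] using assms by (subst (asm) AE_distr_iff) auto
qed

lemma Serv_nonneg: "i \<ge> 1 \<Longrightarrow> j \<ge> 1 \<Longrightarrow> AE \<omega> in M. Serv i j \<omega> \<ge> 0"
  by (rule AE_equidistributed[OF Serv_distr _ _ _ S_nonneg]) (auto intro: Serv_meas)

lemma Arr_nonneg: "j \<ge> 1 \<Longrightarrow> AE \<omega> in M. Arr j \<omega> \<ge> 0"
  by (rule AE_equidistributed[OF Arr_distr _ _ _ A_nonneg]) (auto intro: Arr_meas)

lemma U_nonneg: "AE \<omega> in M. U \<omega> \<ge> 0"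
proof -
  have "AE x in distr M lborel U. x \<ge> 0"
    unfolding distributed_distr_eq_density[OF U_distributed]
    using distributed_borel_measurable[OF U_distributed]
    by (subst AE_density) (auto split: if_splits intro!: AE_I2)
  then show ?thesis by (subst (asm) AE_distr_iff) auto
qed

definition increment_law :: "real measure" where
  "increment_law = distr M borel (\<lambda>\<omega>. S \<omega> - 1 / lam)"

lemma log_mgf_finite_iff: "log_mgf M S lam \<theta> < \<infinity> \<longleftrightarrow> integrable M (\<lambda>\<omega>. exp (\<theta> * (S \<omega> - 1 / lam)))"
  by (simp add: log_mgf_def)

lemma S_integrable: "integrable M S"
  using Bochner_Integration.integrable_add[OF drift_integrable A_integrable] by simp

lemma S_mean: "expectation S = 1 / lam - \<mu>"
  using drift S_integrable A_integrable A_mean by simp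

lemma increment_integral:
  assumes [measurable]: "f \<in> borel_measurable borel"
  shows "(\<integral>x. f x \<partial>increment_law) = expectation (\<lambda>\<omega>. f (S \<omega> - 1 / lam) :: real)"
    "integrable increment_law f \<longleftrightarrow> integrable M (\<lambda>\<omega>. f (S \<omega> - 1 / lam))"
  unfolding increment_law_def by (auto simp: integral_distr integrable_distr_eq)

text \<open>
  Finiteness in a neighbourhood of \<open>\<gamma>\<close> gives a finite exponential moment beyond \<open>\<gamma>\<close>; together
  with the finite mean it dominates all moments between 0 and that point.
\<close>

lemma exists_cramer_radius: "\<exists>r. cramer_law increment_law \<gamma> r"
proof -
  obtain e where e: "e > 0" "ball \<gamma> e \<subseteq> {\<theta>. log_mgf M S lam \<theta> < \<infinity>}"
    using \<gamma>_interior by (auto simp: mem_interior)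
  define r where "r = e / 2"
  have "\<gamma> + r \<in> ball \<gamma> e" using e by (simp add: r_def dist_real_def)
  then have top: "integrable M (\<lambda>\<omega>. exp ((\<gamma> + r) * (S \<omega> - 1 / lam)))"
    using e(2) unfolding log_mgf_finite_iff by blast
  have one: "integrable M (\<lambda>\<omega>. 1::real)" "integrable M (\<lambda>\<omega>. 1 * (S \<omega> - 1 / lam))"
    "integrable M (\<lambda>\<omega>. 1 * exp ((\<gamma> + r) * (S \<omega> - 1 / lam)))"
    using S_integrable top by auto
  have pos: "\<gamma> + r > 0" "r > 0" using \<gamma>_pos e by (auto simp: r_def)
  have exp_int: "integrable M (\<lambda>\<omega>. exp (\<theta> * (S \<omega> - 1 / lam)))" if "0 \<le> \<theta>" "\<theta> \<le> \<gamma> + r" for \<theta>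
    using exp_moment_right_derivative(1)[OF _ one(1) _ one(2) pos(1) one(3) that] by simp
  have int\<gamma>: "integrable M (\<lambda>\<omega>. exp (\<gamma> * (S \<omega> - 1 / lam)))"
    using exp_int[of \<gamma>] \<gamma>_pos pos by simp
  have "ln (expectation (\<lambda>\<omega>. exp (\<gamma> * (S \<omega> - 1 / lam)))) = 0"
    using log_mgf_zero int\<gamma> by (simp add: log_mgf_def)
  moreover have "expectation (\<lambda>\<omega>. exp (\<gamma> * (S \<omega> - 1 / lam))) > 0"
  proof -
    have "expectation (\<lambda>\<omega>. exp (\<gamma> * (S \<omega> - 1 / lam))) \<noteq> 0"
      using integral_nonneg_eq_0_iff_AE[OF int\<gamma>] by (simp add: AE_False)
    moreover have "expectation (\<lambda>\<omega>. exp (\<gamma> * (S \<omega> - 1 / lam))) \<ge> 0" by (rule integral_nonneg_AE) simp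
    ultimately show ?thesis by linarith
  qed
  ultimately have one\<gamma>: "expectation (\<lambda>\<omega>. exp (\<gamma> * (S \<omega> - 1 / lam))) = 1" by simp
  have "cramer_law increment_law \<gamma> r"
  proof (unfold cramer_law_def cramer_law_axioms_def, intro conjI allI impI)
    show "real_distribution increment_law"
      unfolding increment_law_def by (rule real_distribution_distr) simp
    show "integrable increment_law (\<lambda>x. exp (\<theta> * x))" if "0 \<le> \<theta>" "\<theta> \<le> \<gamma> + r" for \<theta>
      using exp_int[OF that] by (subst increment_integral(2)) auto
    show "(\<integral>x. exp (\<gamma> * x) \<partial>increment_law) = 1"
      using one\<gamma> by (subst increment_integral(1)) auto
    show "integrable increment_law (\<lambda>x. x)"
      using S_integrable by (subst increment_integral(2)) auto
    show "(\<integral>x. x \<partial>increment_law) < 0"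
      using S_integrable S_mean \<mu>_pos by (subst increment_integral(1)) (auto simp: prob_space)
  qed (rule \<gamma>_pos, rule pos)
  then show ?thesis ..
qed

text \<open>
  One choice is fixed so that the law of the centred service times becomes a permanent
  instance of \<^locale>\<open>cramer_law\<close>.
\<close>

definition radius :: real where
  "radius = (SOME r. cramer_law increment_law \<gamma> r)"

sublocale law: cramer_law increment_law \<gamma> radius
  unfolding radius_def by (rule someI_ex[OF exists_cramer_radius])

lemma deriv_log_mgf: "deriv (\<lambda>\<theta>. real_of_ereal (log_mgf M S lam \<theta>)) \<gamma> = law.tilted_mean"
proof (rule DERIV_imp_deriv)
  have deriv: "((\<lambda>\<theta>. ln (law.mgf \<theta>)) has_real_derivative law.tilted_mean) (at \<gamma>)"
    using DERIV_chain2[OF DERIV_ln_divide law.mgf_has_derivative] law.mgf_\<gamma>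
    by (simp add: law.mgf_def[of \<gamma>])
  have eq: "eventually (\<lambda>\<theta>. ln (law.mgf \<theta>) = real_of_ereal (log_mgf M S lam \<theta>)) (nhds \<gamma>)"
  proof -
    have "eventually (\<lambda>\<theta>. \<theta> \<in> {0<..<\<gamma> + radius}) (nhds \<gamma>)"
      using \<gamma>_pos law.r_pos by (intro eventually_nhds_in_open) auto
    then show ?thesis
    proof eventually_elim
      case (elim \<theta>)
      then have "integrable M (\<lambda>\<omega>. exp (\<theta> * (S \<omega> - 1 / lam)))"
        using law.exp_integrable[of \<theta>] by (simp add: increment_integral)
      then show ?case by (simp add: log_mgf_def law.mgf_def increment_integral)
    qed
  qed
  show "((\<lambda>\<theta>. real_of_ereal (log_mgf M S lam \<theta>)) has_real_derivative law.tilted_mean) (at \<gamma>)"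
    using deriv by (subst (asm) DERIV_cong_ev[OF refl eq refl])
qed

text \<open>
  In the delay walk the fluctuations of the services (different for every queue) and of the
  arrivals (common to all queues) are entangled. Centring both at \<open>1 / lam\<close> separates them:
  \<open>service_walk\<close> and \<open>arrival_walk\<close> are independent and the constants cancel.
\<close>

definition service_walk :: "nat \<Rightarrow> nat \<Rightarrow> nat \<Rightarrow> 'a \<Rightarrow> real" where
  "service_walk i j k \<omega> = (\<Sum>m=j..<j + k. Serv i (m + 1) \<omega> - 1 / lam)"

definition arrival_walk :: "nat \<Rightarrow> 'a \<Rightarrow> real" where
  "arrival_walk n \<omega> = (\<Sum>m=1..<1 + n. Arr m \<omega> - 1 / lam)"

definition delay_walk :: "nat \<Rightarrow> nat \<Rightarrow> nat \<Rightarrow> 'a \<Rightarrow> real" where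
  "delay_walk i j k \<omega> = (\<Sum>m=j..<j + k. Serv i (m + 1) \<omega> - Arr m \<omega>)"

lemma waiting_time_eq: "waiting_time Serv Arr i j \<omega> = (SUP k. ereal (delay_walk i j k \<omega>))"
  by (simp add: waiting_time_def delay_walk_def)

lemma arrival_age_eq:
  assumes "j \<ge> 1"
  shows "arrival_age Arr U j \<omega> = U \<omega> + (real j - 1) / lam + arrival_walk (j - 1) \<omega>"
  using assms by (simp add: arrival_age_def arrival_walk_def sum_subtractf of_nat_diff)

lemma arrival_walk_diff:
  "arrival_walk (n + k) \<omega> - arrival_walk n \<omega> = (\<Sum>m=1 + n..<1 + n + k. Arr m \<omega> - 1 / lam)"
  using sum.atLeastLessThan_concat[of 1 "1 + n" "1 + n + k" "\<lambda>m. Arr m \<omega> - 1 / lam"]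
  by (simp add: arrival_walk_def)

text \<open>
  The interarrival times that make up the age of task \<open>j\<close> and those that enter its waiting
  time are consecutive, so the arrivals contribute one partial sum of length \<open>j - 1 + k\<close>
  started at the most recent arrival.
\<close>

lemma delay_walk_eq:
  assumes "j \<ge> 1"
  shows "delay_walk i j k \<omega> - arrival_age Arr U j \<omega>
    = service_walk i j k \<omega> - (U \<omega> + (real j - 1) / lam + arrival_walk (j - 1 + k) \<omega>)"
proof -
  have "delay_walk i j k \<omega> = service_walk i j k \<omega> - (arrival_walk (j - 1 + k) \<omega> - arrival_walk (j - 1) \<omega>)"
    unfolding arrival_walk_diff delay_walk_def service_walk_def
    using assms by (simp add: sum_subtractf[symmetric])
  then show ?thesis by (simp add: arrival_age_eq[OF assms])
qed

lemma service_walk_meas: "i \<ge> 1 \<Longrightarrow> service_walk i j k \<in> borel_measurable M"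
  unfolding service_walk_def[abs_def] by (intro borel_measurable_sum borel_measurable_diff Serv_meas) auto

lemma arrival_walk_meas [measurable]: "arrival_walk n \<in> borel_measurable M"
  unfolding arrival_walk_def[abs_def] by (intro borel_measurable_sum borel_measurable_diff Arr_meas) auto

lemma delay_walk_meas: "i \<ge> 1 \<Longrightarrow> j \<ge> 1 \<Longrightarrow> delay_walk i j k \<in> borel_measurable M"
  unfolding delay_walk_def[abs_def] by (intro borel_measurable_sum borel_measurable_diff Serv_meas Arr_meas) auto

lemma arrival_age_meas: "j \<ge> 1 \<Longrightarrow> arrival_age Arr U j \<in> borel_measurable M"
  unfolding arrival_age_def[abs_def] by (intro borel_measurable_sum borel_measurable_add Arr_meas U_meas) auto

lemma waiting_time_meas: "i \<ge> 1 \<Longrightarrow> j \<ge> 1 \<Longrightarrow> waiting_time Serv Arr i j \<in> borel_measurable M"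
  unfolding waiting_time_eq[abs_def]
  by (intro borel_measurable_SUP borel_measurable_ereal delay_walk_meas) auto

lemma centred_service_indep:
  assumes "i \<ge> 1"
  shows "indep_vars (\<lambda>_. borel) (\<lambda>m \<omega>. Serv i (m + 1) \<omega> - 1 / lam) UNIV"
  by (rule indep_vars_blocks[OF inputs_indep, where K = "\<lambda>m. {Service i (m + 1)}"
        and g = "\<lambda>m x. x (Service i (m + 1)) - 1 / lam"])
     (use assms in \<open>auto simp: input_indices_def disjoint_family_on_def\<close>)

lemma centred_service_distr:
  assumes "i \<ge> 1"
  shows "distr M borel (\<lambda>\<omega>. Serv i (m + 1) \<omega> - 1 / lam) = increment_law"
proof -
  have "distr M borel (\<lambda>\<omega>. Serv i (m + 1) \<omega> - 1 / lam) = distr (distr M borel (Serv i (m + 1))) borel (\<lambda>x. x - 1 / lam)"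
    using Serv_meas[OF assms, of "m + 1"] by (subst distr_distr) (auto simp: comp_def)
  also have "\<dots> = distr (distr M borel S) borel (\<lambda>x. x - 1 / lam)"
    using Serv_distr[OF assms, of "m + 1"] by simp
  also have "\<dots> = increment_law"
    unfolding increment_law_def by (subst distr_distr) (auto simp: comp_def)
  finally show ?thesis .
qed

lemma centred_arrivals_indep: "indep_vars (\<lambda>_. borel) (\<lambda>m \<omega>. Arr m \<omega> - 1 / lam) {1..}"
  by (rule indep_vars_blocks[OF inputs_indep, where K = "\<lambda>m. {Interarrival m}"
        and g = "\<lambda>m x. x (Interarrival m) - 1 / lam"])
     (auto simp: input_indices_def disjoint_family_on_def)

lemma Arr_integral:
  assumes "m \<ge> 1" and [measurable]: "f \<in> borel_measurable borel"
  shows "expectation (\<lambda>\<omega>. f (Arr m \<omega>) :: real) = expectation (\<lambda>\<omega>. f (A \<omega>))"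
    "integrable M (\<lambda>\<omega>. f (Arr m \<omega>)) \<longleftrightarrow> integrable M (\<lambda>\<omega>. f (A \<omega>))"
proof -
  note [measurable] = Arr_meas[OF assms(1)]
  have "expectation (\<lambda>\<omega>. f (Arr m \<omega>)) = (\<integral>x. f x \<partial>distr M borel (Arr m))"
    by (simp add: integral_distr)
  then show "expectation (\<lambda>\<omega>. f (Arr m \<omega>) :: real) = expectation (\<lambda>\<omega>. f (A \<omega>))"
    unfolding Arr_distr[OF assms(1)] by (simp add: integral_distr)
  have "integrable M (\<lambda>\<omega>. f (Arr m \<omega>)) \<longleftrightarrow> integrable (distr M borel (Arr m)) f"
    by (simp add: integrable_distr_eq)
  then show "integrable M (\<lambda>\<omega>. f (Arr m \<omega>)) \<longleftrightarrow> integrable M (\<lambda>\<omega>. f (A \<omega>))"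
    unfolding Arr_distr[OF assms(1)] by (simp add: integrable_distr_eq)
qed

lemma Serv_integral:
  assumes "i \<ge> 1" "j \<ge> 1" and [measurable]: "f \<in> borel_measurable borel"
  shows "expectation (\<lambda>\<omega>. f (Serv i j \<omega>) :: real) = expectation (\<lambda>\<omega>. f (S \<omega>))"
    "integrable M (\<lambda>\<omega>. f (Serv i j \<omega>)) \<longleftrightarrow> integrable M (\<lambda>\<omega>. f (S \<omega>))"
proof -
  note [measurable] = Serv_meas[OF assms(1,2)]
  have "expectation (\<lambda>\<omega>. f (Serv i j \<omega>)) = (\<integral>x. f x \<partial>distr M borel (Serv i j))"
    by (simp add: integral_distr)
  then show "expectation (\<lambda>\<omega>. f (Serv i j \<omega>) :: real) = expectation (\<lambda>\<omega>. f (S \<omega>))"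
    unfolding Serv_distr[OF assms(1,2)] by (simp add: integral_distr)
  have "integrable M (\<lambda>\<omega>. f (Serv i j \<omega>)) \<longleftrightarrow> integrable (distr M borel (Serv i j)) f"
    by (simp add: integrable_distr_eq)
  then show "integrable M (\<lambda>\<omega>. f (Serv i j \<omega>)) \<longleftrightarrow> integrable M (\<lambda>\<omega>. f (S \<omega>))"
    unfolding Serv_distr[OF assms(1,2)] by (simp add: integrable_distr_eq)
qed

lemma centred_arrival_moments:
  assumes "m \<ge> 1"
  shows "integrable M (\<lambda>\<omega>. Arr m \<omega> - 1 / lam)" "expectation (\<lambda>\<omega>. Arr m \<omega> - 1 / lam) = 0"
    "integrable M (\<lambda>\<omega>. (Arr m \<omega> - 1 / lam)\<^sup>2)" "expectation (\<lambda>\<omega>. (Arr m \<omega> - 1 / lam)\<^sup>2) = \<sigma>\<^sup>2"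
proof -
  have sq: "integrable M (\<lambda>\<omega>. (A \<omega> - 1 / lam)\<^sup>2)"
    using A_square A_integrable by (auto simp: power2_diff)
  show "integrable M (\<lambda>\<omega>. Arr m \<omega> - 1 / lam)"
    using Arr_integral(2)[OF assms, of "\<lambda>x. x - 1 / lam"] A_integrable by simp
  show "expectation (\<lambda>\<omega>. Arr m \<omega> - 1 / lam) = 0"
    using Arr_integral(1)[OF assms, of "\<lambda>x. x - 1 / lam"] A_integrable A_mean by (simp add: prob_space)
  show "integrable M (\<lambda>\<omega>. (Arr m \<omega> - 1 / lam)\<^sup>2)"
    using Arr_integral(2)[OF assms, of "\<lambda>x. (x - 1 / lam)\<^sup>2"] sq by simp
  show "expectation (\<lambda>\<omega>. (Arr m \<omega> - 1 / lam)\<^sup>2) = \<sigma>\<^sup>2"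
    using Arr_integral(1)[OF assms, of "\<lambda>x. (x - 1 / lam)\<^sup>2"] A_variance A_mean by simp
qed

lemma arrival_walk_maximal:
  fixes n :: nat
  assumes "a \<ge> 1" "c > 0"
  shows "prob {\<omega>\<in>space M. \<exists>k\<le>n. c \<le> \<bar>\<Sum>m=a..<a + k. Arr m \<omega> - 1 / lam\<bar>} \<le> n * \<sigma>\<^sup>2 / c\<^sup>2"
  by (rule kolmogorov_maximal_inequality[OF indep_vars_subset[OF centred_arrivals_indep]])
     (use assms centred_arrival_moments in auto)

lemma service_walk_tail:
  assumes "i \<ge> 1" "0 \<le> \<theta>" "\<theta> \<le> \<gamma> + radius"
  shows "prob {\<omega>\<in>space M. y \<le> service_walk i j k \<omega>} \<le> exp (- \<theta> * y) * law.mgf \<theta> ^ k"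
  using chernoff_iid_sum[OF _ indep_vars_subset[OF centred_service_indep[OF assms(1)] subset_UNIV]
      centred_service_distr[OF assms(1)] law.exp_integrable[OF assms(2,3)] assms(2), of "{j..<j + k}" y]
  by (simp add: service_walk_def law.mgf_def)

lemma service_walk_identically_distributed:
  assumes "i \<ge> 1" "i' \<ge> 1"
  shows "distr M borel (service_walk i j k) = distr M borel (service_walk i' j' k)"
proof -
  have "distr M borel (service_walk i j k) = ((\<lambda>\<nu>. convolution increment_law \<nu>) ^^ k) (return borel 0)"
    if "i \<ge> 1" for i j
    using distr_iid_sum[OF _ indep_vars_subset[OF centred_service_indep[OF that] subset_UNIV]
      centred_service_distr[OF that], of "{j..<j + k}"] by (simp add: service_walk_def[abs_def])
  then show ?thesis using assms by simp
qed

lemma service_walks_indep: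
  assumes "j \<ge> 1"
  shows "indep_vars (\<lambda>_. borel) (\<lambda>i. service_walk i j k) {1..}"
  by (rule indep_vars_blocks[OF inputs_indep, where K = "\<lambda>i. {Service i (m + 1) |m. m \<in> {j..<j + k}}"
        and g = "\<lambda>i x. \<Sum>m=j..<j + k. x (Service i (m + 1)) - 1 / lam"])
     (auto simp: input_indices_def disjoint_family_on_def service_walk_def
        intro!: borel_measurable_sum borel_measurable_diff measurable_component_singleton sum.cong)

lemma delay_increments_indep:
  assumes "i \<ge> 1"
  shows "indep_vars (\<lambda>_. borel) (\<lambda>m \<omega>. Serv i (m + 1) \<omega> - Arr m \<omega>) {1..}"
  by (rule indep_vars_blocks[OF inputs_indep, where K = "\<lambda>m. {Service i (m + 1), Interarrival m}"
        and g = "\<lambda>m x. x (Service i (m + 1)) - x (Interarrival m)"])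
     (use assms in \<open>auto simp: input_indices_def disjoint_family_on_def\<close>)

text \<open>
  The law of a service time minus an independent interarrival time. \<open>S\<close> and \<open>A\<close> themselves
  need not be independent, so this need not be the law of \<open>S - A\<close>; only the means agree.
\<close>

definition delay_law :: "real measure" where
  "delay_law = convolution (distr M borel S) (distr M borel (\<lambda>\<omega>. - A \<omega>))"

lemma delay_increment_distr:
  assumes "i \<ge> 1" "m \<ge> 1"
  shows "distr M borel (\<lambda>\<omega>. Serv i (m + 1) \<omega> - Arr m \<omega>) = delay_law"
proof -
  note [measurable] = Serv_meas[OF assms(1), of "m + 1"] Arr_meas[OF assms(2)] Serv_meas[OF assms(1), of "Suc m"]
  have ind: "indep_var borel (Serv i (m + 1)) borel (\<lambda>\<omega>. - Arr m \<omega>)"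
  proof -
    have "indep_var borel ((\<lambda>x. x (Service i (m + 1))) \<circ> (\<lambda>\<omega>. restrict (\<lambda>v. input_var Serv Arr U v \<omega>) {Service i (m + 1)}))
        borel ((\<lambda>x. - x (Interarrival m)) \<circ> (\<lambda>\<omega>. restrict (\<lambda>v. input_var Serv Arr U v \<omega>) {Interarrival m}))"
      by (rule indep_var_compose[OF indep_var_restrict[OF inputs_indep]])
         (use assms in \<open>auto simp: input_indices_def\<close>)
    then show ?thesis by (simp add: comp_def)
  qed
  have "distr M borel (\<lambda>\<omega>. - Arr m \<omega>) = distr (distr M borel (Arr m)) borel uminus"
    by (subst distr_distr) (auto simp: comp_def)
  also have "\<dots> = distr M borel (\<lambda>\<omega>. - A \<omega>)"
    unfolding Arr_distr[OF assms(2)] by (subst distr_distr) (auto simp: comp_def)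
  finally have neg: "distr M borel (\<lambda>\<omega>. - Arr m \<omega>) = distr M borel (\<lambda>\<omega>. - A \<omega>)" .
  show ?thesis
    using sum_indep_random_variable[OF ind] neg Serv_distr[OF assms(1), of "m + 1"]
    by (simp add: delay_law_def)
qed

lemma delay_law_real_distribution: "real_distribution delay_law"
proof -
  have "(\<lambda>\<omega>. Serv 1 (1 + 1) \<omega> - Arr 1 \<omega>) \<in> borel_measurable M"
    by (intro borel_measurable_diff Serv_meas Arr_meas) auto
  then show ?thesis
    unfolding delay_increment_distr[of 1 1, simplified, symmetric] by (simp add: real_distribution_distr)
qed

text \<open>
  A service time minus an interarrival time has negative mean and, as \<open>A \<ge> 0\<close>, an exponential
  moment. Hence for small \<open>\<theta> > 0\<close> its moment generating function is some \<open>\<rho> < 1\<close>, and the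
  Chernoff bounds at the times \<open>k \<ge> k0\<close> form a geometric series.
\<close>

lemma delay_walk_decay:
  obtains \<theta> \<rho> where "0 < \<theta>" "0 \<le> \<rho>" "\<rho> < 1"
    "\<And>i j k0 y. i \<ge> 1 \<Longrightarrow> j \<ge> 1 \<Longrightarrow>
       prob {\<omega>\<in>space M. \<exists>k\<ge>k0. y \<le> delay_walk i j k \<omega>} \<le> exp (- \<theta> * y) * \<rho> ^ k0 / (1 - \<rho>)"
proof -
  interpret delay: real_distribution delay_law by (rule delay_law_real_distribution)
  have [measurable]: "Serv 1 2 \<in> borel_measurable M" "Arr 1 \<in> borel_measurable M"
    by (intro Serv_meas Arr_meas; simp)+
  have law: "delay_law = distr M borel (\<lambda>\<omega>. Serv 1 2 \<omega> - Arr 1 \<omega>)"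
    using delay_increment_distr[of 1 1] by (simp add: numeral_2_eq_2)
  note Serv_int = Serv_integral[of 1 2]
  have Arr_int: "integrable M (Arr 1)" "expectation (Arr 1) = 1 / lam"
    using Arr_integral[of 1 "\<lambda>x. x"] A_integrable A_mean by auto
  have mean: "integrable delay_law (\<lambda>x. x)" "(\<integral>x. x \<partial>delay_law) < 0"
    unfolding law using Serv_int[of "\<lambda>x. x"] S_integrable S_mean Arr_int \<mu>_pos
    by (simp_all add: integrable_distr_eq integral_distr)
  have "integrable M (\<lambda>\<omega>. exp (\<gamma> * (S \<omega> - 1 / lam)))"
    using law.exp_integrable[of \<gamma>] \<gamma>_pos law.r_pos by (simp add: increment_integral)
  then have "integrable M (\<lambda>\<omega>. exp (\<gamma> / lam) * exp (\<gamma> * (S \<omega> - 1 / lam)))" by simp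
  then have "integrable M (\<lambda>\<omega>. exp (\<gamma> * S \<omega>))"
    by (simp add: right_diff_distrib flip: exp_add)
  then have "integrable M (\<lambda>\<omega>. exp (\<gamma> * Serv 1 2 \<omega>))"
    using Serv_int(2)[of "\<lambda>x. exp (\<gamma> * x)"] by simp
  then have "integrable M (\<lambda>\<omega>. exp (\<gamma> * (Serv 1 2 \<omega> - Arr 1 \<omega>)))"
  proof (rule Bochner_Integration.integrable_bound)
    show "AE \<omega> in M. norm (exp (\<gamma> * (Serv 1 2 \<omega> - Arr 1 \<omega>))) \<le> norm (exp (\<gamma> * Serv 1 2 \<omega>))"
      using Arr_nonneg[of 1] \<gamma>_pos by (auto elim: eventually_mono)
  qed measurable
  then have exp_int: "integrable delay_law (\<lambda>x. exp (\<gamma> * x))"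
    unfolding law by (subst integrable_distr_eq) (simp_all del: One_nat_def)
  obtain \<theta> where \<theta>: "0 < \<theta>" "integrable delay_law (\<lambda>x. exp (\<theta> * x))" "(\<integral>x. exp (\<theta> * x) \<partial>delay_law) < 1"
    using delay.negative_drift_mgf[OF mean \<gamma>_pos exp_int] by metis
  define \<rho> where "\<rho> = (\<integral>x. exp (\<theta> * x) \<partial>delay_law)"
  have \<rho>: "0 \<le> \<rho>" "\<rho> < 1" using \<theta> by (auto simp: \<rho>_def intro!: integral_nonneg_AE)
  show thesis
  proof (rule that[OF \<theta>(1) \<rho>])
    fix i j k0 :: nat and y :: real assume ij: "i \<ge> 1" "j \<ge> 1"
    define E where "E n = {\<omega>\<in>space M. y \<le> delay_walk i j (k0 + n) \<omega>}" for n
    have E: "E n \<in> events" for n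
      unfolding E_def using delay_walk_meas[OF ij, of "k0 + n"] by measurable
    have "{j..<j + (k0 + n)} \<subseteq> {1..}" for n using ij by auto
    then have "prob (E n) \<le> exp (- \<theta> * y) * \<rho> ^ (k0 + n)" for n
      using chernoff_iid_sum[OF _ indep_vars_subset[OF delay_increments_indep[OF ij(1)]]
          delay_increment_distr[OF ij(1)] \<theta>(2) less_imp_le[OF \<theta>(1)], of "{j..<j + (k0 + n)}" y] ij
      by (auto simp: E_def delay_walk_def \<rho>_def)
    then have bound: "prob (E n) \<le> exp (- \<theta> * y) * \<rho> ^ k0 * \<rho> ^ n" for n
      by (simp add: power_add mult.assoc)
    have geo: "(\<lambda>n. exp (- \<theta> * y) * \<rho> ^ k0 * \<rho> ^ n) sums (exp (- \<theta> * y) * \<rho> ^ k0 * (1 / (1 - \<rho>)))"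
      using \<rho> by (intro sums_mult geometric_sums) auto
    have summ: "summable (\<lambda>n. prob (E n))"
      by (rule summable_comparison_test'[OF sums_summable[OF geo], of 0]) (use bound in auto)
    have "{\<omega>\<in>space M. \<exists>k\<ge>k0. y \<le> delay_walk i j k \<omega>} = (\<Union>n. E n)"
      by (auto simp: E_def le_iff_add)
    then have "prob {\<omega>\<in>space M. \<exists>k\<ge>k0. y \<le> delay_walk i j k \<omega>} \<le> (\<Sum>n. prob (E n))"
      using finite_measure_subadditive_countably[of E] E summ by auto
    also have "\<dots> \<le> (\<Sum>n. exp (- \<theta> * y) * \<rho> ^ k0 * \<rho> ^ n)"
      by (intro suminf_le bound summ sums_summable[OF geo])
    also have "\<dots> = exp (- \<theta> * y) * \<rho> ^ k0 / (1 - \<rho>)"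
      using sums_unique[OF geo] by simp
    finally show "prob {\<omega>\<in>space M. \<exists>k\<ge>k0. y \<le> delay_walk i j k \<omega>} \<le> exp (- \<theta> * y) * \<rho> ^ k0 / (1 - \<rho>)" .
  qed
qed

end

section \<open>Queue lengths and unlikely excursions\<close>

lemma (in prob_space) prob_exists_le:
  fixes b :: real
  assumes "finite I" "\<And>i. i \<in> I \<Longrightarrow> {\<omega>\<in>space M. P i \<omega>} \<in> events"
    and "\<And>i. i \<in> I \<Longrightarrow> prob {\<omega>\<in>space M. P i \<omega>} \<le> b"
  shows "prob {\<omega>\<in>space M. \<exists>i\<in>I. P i \<omega>} \<le> card I * b"
proof -
  have "{\<omega>\<in>space M. \<exists>i\<in>I. P i \<omega>} = (\<Union>i\<in>I. {\<omega>\<in>space M. P i \<omega>})" by auto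
  also have "prob \<dots> \<le> (\<Sum>i\<in>I. prob {\<omega>\<in>space M. P i \<omega>})"
    by (rule finite_measure_subadditive_finite) (use assms in auto)
  also have "\<dots> \<le> card I * b" using sum_bounded_above[of I _ b] assms(3) by simp
  finally show ?thesis .
qed

context fork_join
begin

text \<open>
  A queue is served in order of arrival: if task \<open>j + 1\<close>, which arrived before task \<open>j\<close>, has
  not yet entered service, then neither has task \<open>j\<close>. In formulas,
  \<open>W\<^sub>j \<ge> S\<^sub>j\<^sub>+\<^sub>1 - A\<^sub>j + W\<^sub>j\<^sub>+\<^sub>1\<close> and \<open>T\<^sub>j\<^sub>+\<^sub>1 = T\<^sub>j + A\<^sub>j\<close>.
\<close>

lemma waiting_exceeds_age_pred:
  assumes "j \<ge> 1" "Serv i (j + 1) \<omega> \<ge> 0"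
    and wait: "ereal (arrival_age Arr U (j + 1) \<omega>) \<le> waiting_time Serv Arr i (j + 1) \<omega>"
  shows "ereal (arrival_age Arr U j \<omega>) \<le> waiting_time Serv Arr i j \<omega>"
  unfolding waiting_time_eq le_SUP_iff
proof (intro allI impI)
  have age: "arrival_age Arr U (j + 1) \<omega> = arrival_age Arr U j \<omega> + Arr j \<omega>"
    using assms(1) by (simp add: arrival_age_def)
  have walk: "delay_walk i j (Suc k) \<omega> = Serv i (j + 1) \<omega> - Arr j \<omega> + delay_walk i (j + 1) k \<omega>" for k
    by (simp add: delay_walk_def sum.atLeast_Suc_lessThan)
  fix y assume y: "y < ereal (arrival_age Arr U j \<omega>)"
  show "\<exists>k\<in>UNIV. y < ereal (delay_walk i j k \<omega>)"
  proof (cases y)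
    case (real z)
    with y have "z < arrival_age Arr U j \<omega>" by simp
    then have "ereal (z + Arr j \<omega>) < ereal (arrival_age Arr U (j + 1) \<omega>)"
      unfolding age by simp
    also note wait
    finally obtain k where "z + Arr j \<omega> < delay_walk i (j + 1) k \<omega>"
      unfolding waiting_time_eq less_SUP_iff by auto
    then have "z < delay_walk i j (Suc k) \<omega>" using walk[of k] assms(2) by linarith
    then show ?thesis using real by auto
  qed (use y in auto)
qed

text \<open>
  The waiting tasks are an initial segment of the backward numbering, so the segment has at
  least \<open>j\<close> elements iff it contains \<open>j\<close>.
\<close>

lemma queue_length_ge_iff:
  assumes serv: "\<And>m. m \<ge> 1 \<Longrightarrow> Serv i m \<omega> \<ge> 0"
    and fin: "\<exists>j\<ge>1. \<not> ereal (arrival_age Arr U j \<omega>) \<le> waiting_time Serv Arr i j \<omega>"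
    and j: "j \<ge> 1"
  shows "queue_length Serv Arr U i \<omega> \<ge> j \<longleftrightarrow> ereal (arrival_age Arr U j \<omega>) \<le> waiting_time Serv Arr i j \<omega>"
proof -
  define P where "P j \<longleftrightarrow> ereal (arrival_age Arr U j \<omega>) \<le> waiting_time Serv Arr i j \<omega>" for j
  define n where "n = (LEAST n. n \<ge> 1 \<and> \<not> P n)"
  have n: "n \<ge> 1" "\<not> P n"
    using LeastI_ex[of "\<lambda>n. n \<ge> 1 \<and> \<not> P n"] fin unfolding n_def P_def by blast+
  have below: "P m" if "1 \<le> m" "m < n" for m
    using not_less_Least[of m "\<lambda>n. n \<ge> 1 \<and> \<not> P n"] that unfolding n_def by blast
  have above: "\<not> P (n + d)" for d
  proof (induction d)
    case (Suc d)
    show ?case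
    proof
      assume "P (n + Suc d)"
      then have "P (n + d)"
        using waiting_exceeds_age_pred[of "n + d" i \<omega>] serv[of "n + d + 1"] n(1) by (simp add: P_def)
      then show False using Suc by simp
    qed
  qed (use n in simp)
  have iff: "P m \<longleftrightarrow> m < n" if "m \<ge> 1" for m
    using below[of m] above[of "m - n"] that by (cases "m < n") auto
  then have "{j. j \<ge> 1 \<and> P j} = {1..<n}" by auto
  then have "queue_length Serv Arr U i \<omega> = n - 1"
    unfolding queue_length_def P_def by simp
  then show ?thesis using iff[OF j] n(1) j unfolding P_def by auto
qed

lemma arrival_sum_meas:
  assumes "a \<ge> 1"
  shows "(\<lambda>\<omega>. \<Sum>m=a..<a + k. Arr m \<omega> - 1 / lam) \<in> borel_measurable M"
  using assms by (intro borel_measurable_sum borel_measurable_diff Arr_meas) auto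

lemma arrival_maximal_sets:
  assumes "a \<ge> 1"
  shows "{\<omega>\<in>space M. \<exists>k\<le>n. c \<le> \<bar>\<Sum>m=a..<a + k. Arr m \<omega> - 1 / lam\<bar>} \<in> events"
proof -
  note [measurable] = arrival_sum_meas[OF assms]
  show ?thesis by measurable
qed

lemma waiting_age_sets:
  assumes "i \<ge> 1" "j \<ge> 1"
  shows "{\<omega>\<in>space M. ereal (arrival_age Arr U j \<omega>) \<le> waiting_time Serv Arr i j \<omega>} \<in> events"
proof -
  note [measurable] = waiting_time_meas[OF assms] arrival_age_meas[OF assms(2)]
  show ?thesis by measurable
qed

lemma delay_exceeds_sets:
  assumes "i \<ge> 1" "j \<ge> 1"
  shows "{\<omega>\<in>space M. \<exists>k\<ge>k0. y \<le> delay_walk i j k \<omega>} \<in> events"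
proof -
  note [measurable] = delay_walk_meas[OF assms]
  show ?thesis by measurable
qed

text \<open>
  Task \<open>n + 1\<close> waits with a probability that tends to 0: its age is at least \<open>n / (2 lam)\<close> by
  Kolmogorov's inequality, unless an event of probability \<open>O(1 / n)\<close> occurs, and the waiting
  time has an exponential tail. All tasks waiting at once is at most as likely as each of
  these events.
\<close>

lemma AE_queue_finite:
  assumes i: "i \<ge> 1"
  shows "AE \<omega> in M. \<exists>j\<ge>1. \<not> ereal (arrival_age Arr U j \<omega>) \<le> waiting_time Serv Arr i j \<omega>"
proof -
  define W where "W j = {\<omega>\<in>space M. ereal (arrival_age Arr U j \<omega>) \<le> waiting_time Serv Arr i j \<omega>}" for j
  obtain \<theta> \<rho> where \<theta>: "0 < \<theta>" "0 \<le> \<rho>" "\<rho> < 1"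
    and decay: "\<And>i j k0 y. i \<ge> 1 \<Longrightarrow> j \<ge> 1 \<Longrightarrow>
       prob {\<omega>\<in>space M. \<exists>k\<ge>k0. y \<le> delay_walk i j k \<omega>} \<le> exp (- \<theta> * y) * \<rho> ^ k0 / (1 - \<rho>)"
    by (rule delay_walk_decay, rule that) (assumption | blast)+
  have bound: "prob (W (n + 1)) \<le> 4 * lam\<^sup>2 * \<sigma>\<^sup>2 / n + exp (- \<theta> * (n / (2 * lam) - 1)) / (1 - \<rho>)"
    if n: "n \<ge> 1" for n :: nat
  proof -
    define c where "c = n / (2 * lam)"
    have c: "c > 0" using n lam_pos by (simp add: c_def)
    define B1 where "B1 = {\<omega>\<in>space M. \<exists>k\<le>n. c \<le> \<bar>\<Sum>m=1..<1 + k. Arr m \<omega> - 1 / lam\<bar>}"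
    define B2 where "B2 = {\<omega>\<in>space M. \<exists>k\<ge>0. c - 1 \<le> delay_walk i (n + 1) k \<omega>}"
    have sets: "B1 \<in> events" "B2 \<in> events"
      unfolding B1_def B2_def by (rule arrival_maximal_sets delay_exceeds_sets[OF i]; simp)+
    have "AE \<omega> in M. \<omega> \<in> W (n + 1) \<longrightarrow> \<omega> \<in> B1 \<union> B2"
      using U_nonneg
    proof eventually_elim
      case (elim \<omega>)
      show ?case
      proof
        assume W: "\<omega> \<in> W (n + 1)"
        show "\<omega> \<in> B1 \<union> B2"
        proof (cases "\<omega> \<in> B1")
          case False
          then have "\<bar>arrival_walk n \<omega>\<bar> < c" using W by (auto simp: B1_def W_def arrival_walk_def not_le)
          moreover have "n / lam = 2 * c" using lam_pos by (simp add: c_def)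
          ultimately have "c < arrival_age Arr U (n + 1) \<omega>"
            using elim arrival_age_eq[of "n + 1" \<omega>] by simp
          then have "ereal (c - 1) < ereal (arrival_age Arr U (n + 1) \<omega>)" by simp
          also have "\<dots> \<le> waiting_time Serv Arr i (n + 1) \<omega>" using W by (simp add: W_def)
          finally obtain k where "c - 1 < delay_walk i (n + 1) k \<omega>"
            unfolding waiting_time_eq less_SUP_iff by auto
          then have "\<omega> \<in> B2" using W by (auto simp: B2_def W_def intro: less_imp_le)
          then show ?thesis by simp
        qed simp
      qed
    qed
    then have "prob (W (n + 1)) \<le> prob (B1 \<union> B2)"
      by (intro finite_measure_mono_AE) (use sets in auto)
    also have "\<dots> \<le> prob B1 + prob B2" using sets by (rule measure_Un_le)
    also have "\<dots> \<le> n * \<sigma>\<^sup>2 / c\<^sup>2 + exp (- \<theta> * (c - 1)) * \<rho> ^ 0 / (1 - \<rho>)"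
      unfolding B1_def B2_def
      by (intro add_mono arrival_walk_maximal decay) (use c i in auto)
    also have "n * \<sigma>\<^sup>2 / c\<^sup>2 = 4 * lam\<^sup>2 * \<sigma>\<^sup>2 / n"
      using n lam_pos by (simp add: c_def power2_eq_square field_simps)
    finally show ?thesis by (simp add: c_def)
  qed
  define F where "F = {\<omega>\<in>space M. \<forall>j\<ge>1. ereal (arrival_age Arr U j \<omega>) \<le> waiting_time Serv Arr i j \<omega>}"
  have W_sets: "W j \<in> events" if "j \<ge> 1" for j
    unfolding W_def by (rule waiting_age_sets[OF i that])
  have F_eq: "F = (\<Inter>n. W (n + 1))"
  proof -
    have "Q j" if "\<forall>n. Q (n + 1)" "j \<ge> 1" for Q and j :: nat
      using that(1)[rule_format, of "j - 1"] that(2) by simp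
    from this[of "\<lambda>j. ereal (arrival_age Arr U j \<omega>) \<le> waiting_time Serv Arr i j \<omega>" for \<omega>]
    show ?thesis unfolding F_def W_def by fastforce
  qed
  have F_sets: "F \<in> events" unfolding F_eq using W_sets by auto
  have "prob F \<le> 0"
  proof (rule tendsto_lowerbound)
    show "((\<lambda>n::nat. 4 * lam\<^sup>2 * \<sigma>\<^sup>2 / n + exp (- \<theta> * (n / (2 * lam) - 1)) / (1 - \<rho>)) \<longlongrightarrow> 0) sequentially"
      using \<theta> lam_pos by real_asymp
    show "eventually (\<lambda>n. prob F \<le> 4 * lam\<^sup>2 * \<sigma>\<^sup>2 / n + exp (- \<theta> * (n / (2 * lam) - 1)) / (1 - \<rho>)) sequentially"
      using eventually_ge_at_top[of 1]
    proof eventually_elim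
      case (elim n)
      have "prob F \<le> prob (W (n + 1))"
        by (rule finite_measure_mono) (use F_eq W_sets in auto)
      also note bound[OF elim]
      finally show ?case .
    qed
  qed simp
  then have "prob F = 0" by (simp add: measure_le_0_iff)
  then have "AE \<omega> in M. \<omega> \<notin> F" using F_sets by (simp add: prob_eq_0)
  then show ?thesis using AE_space by eventually_elim (auto simp: F_def)
qed

lemma AE_queue_length_iff:
  "AE \<omega> in M. \<forall>i\<ge>1. \<forall>j\<ge>1. queue_length Serv Arr U i \<omega> \<ge> j \<longleftrightarrow>
     ereal (arrival_age Arr U j \<omega>) \<le> waiting_time Serv Arr i j \<omega>"
proof -
  have "AE \<omega> in M. \<forall>i\<in>{1..}. \<forall>m\<in>{1..}. Serv i m \<omega> \<ge> 0"
    by (intro AE_ball_countable' countableI_type) (auto intro: Serv_nonneg)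
  moreover have "AE \<omega> in M. \<forall>i\<in>{1..}. \<exists>j\<ge>1. \<not> ereal (arrival_age Arr U j \<omega>) \<le> waiting_time Serv Arr i j \<omega>"
    by (intro AE_ball_countable' countableI_type) (use AE_queue_finite in auto)
  ultimately show ?thesis
  proof eventually_elim
    case (elim \<omega>)
    then show ?case by (intro allI impI queue_length_ge_iff) simp_all
  qed
qed

text \<open>
  Outside an event of small probability the arrival walk is constant up to \<open>\<epsilon> sqrt L\<close> over the
  relevant window of times. The exceptional event \<open>G\<close> is a measurable cover of the set on
  which the bound fails.
\<close>

definition arrivals_flat :: "real \<Rightarrow> real \<Rightarrow> real \<Rightarrow> bool" where
  "arrivals_flat \<epsilon> \<delta> L \<longleftrightarrow> (\<forall>j\<ge>1. \<exists>G\<in>events. prob G \<le> \<epsilon> \<and>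
     (\<forall>\<omega>\<in>space M - G. \<forall>k. \<bar>real k - law.\<kappa> * L\<bar> \<le> \<delta> * L + 1 \<longrightarrow>
        \<bar>arrival_walk (j - 1 + k) \<omega> - arrival_walk (j - 1 + nat \<lfloor>law.\<kappa> * L\<rfloor>) \<omega>\<bar> < \<epsilon> * sqrt L))"

text \<open>
  Over a window of length \<open>2 \<delta> L + 2\<close> the arrival walk has variance about \<open>2 \<delta> \<sigma>\<^sup>2 L\<close>. By
  Kolmogorov's inequality an oscillation of order \<open>\<epsilon> sqrt L\<close> has probability of order
  \<open>\<delta> \<sigma>\<^sup>2 / \<epsilon>\<^sup>2\<close>, hence \<open>\<delta>\<close> of order \<open>\<epsilon>\<^sup>3 / \<sigma>\<^sup>2\<close> works. Bounding the oscillation relative to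
  the left end of the window costs a factor 2 in the level.
\<close>

lemma arrival_window:
  assumes "\<epsilon> > 0"
  obtains \<delta> where "0 < \<delta>" "\<delta> < law.\<kappa>"
    "eventually (arrivals_flat \<epsilon> \<delta>) at_top"
proof -
  define \<delta> where "\<delta> = min (law.\<kappa> / 2) (\<epsilon> ^ 3 / (16 * (\<sigma>\<^sup>2 + 1)))"
  have \<sigma>1: "\<sigma>\<^sup>2 + 1 > 0" by (simp add: add_nonneg_pos)
  have \<delta>: "0 < \<delta>" "\<delta> < law.\<kappa>"
    using law.\<kappa>_pos assms \<sigma>1 by (auto simp: \<delta>_def)
  have "\<delta> \<le> \<epsilon> ^ 3 / (16 * (\<sigma>\<^sup>2 + 1))" by (simp add: \<delta>_def)
  then have "\<delta> * (16 * (\<sigma>\<^sup>2 + 1)) \<le> \<epsilon> ^ 3" using \<sigma>1 by (simp add: pos_le_divide_eq)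
  then have \<delta>_small: "16 * \<delta> * \<sigma>\<^sup>2 \<le> \<epsilon> ^ 3" using \<delta>(1) by (simp add: algebra_simps)
  have "eventually (\<lambda>L::real. L \<ge> 1) at_top" by (rule eventually_ge_at_top)
  moreover have "eventually (\<lambda>L. 16 * \<sigma>\<^sup>2 \<le> \<epsilon> ^ 3 * L) at_top" using assms by real_asymp
  ultimately have ev: "eventually (arrivals_flat \<epsilon> \<delta>) at_top"
  proof eventually_elim
    case (elim L)
    show ?case
      unfolding arrivals_flat_def
    proof (intro allI impI)
      fix j :: nat assume j: "j \<ge> 1"
      define k1 where "k1 = nat \<lceil>law.\<kappa> * L - \<delta> * L - 1\<rceil>"
      define w where "w = nat \<lfloor>2 * \<delta> * L + 2\<rfloor>"
      define a where "a = 1 + (j - 1 + k1)"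
      define c where "c = \<epsilon> / 2 * sqrt L"
      define G where "G = {\<omega>\<in>space M. \<exists>l\<le>w. c \<le> \<bar>\<Sum>m=a..<a + l. Arr m \<omega> - 1 / lam\<bar>}"
      have c: "c > 0" using assms elim by (simp add: c_def)
      have "prob G \<le> w * \<sigma>\<^sup>2 / c\<^sup>2"
        unfolding G_def by (rule arrival_walk_maximal) (use c in \<open>auto simp: a_def\<close>)
      also have "\<dots> \<le> (2 * \<delta> * L + 2) * \<sigma>\<^sup>2 / c\<^sup>2"
        using \<delta>(1) elim by (intro divide_right_mono mult_right_mono) (auto simp: w_def)
      also have "c\<^sup>2 = \<epsilon>\<^sup>2 * L / 4" using elim by (simp add: c_def power_mult_distrib power_divide)
      also have "(2 * \<delta> * L + 2) * \<sigma>\<^sup>2 / (\<epsilon>\<^sup>2 * L / 4) = (16 * \<delta> * \<sigma>\<^sup>2 * L + 16 * \<sigma>\<^sup>2) / (2 * \<epsilon>\<^sup>2 * L)"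
        using assms elim by (simp add: field_simps)
      also have "\<dots> \<le> (\<epsilon> ^ 3 * L + \<epsilon> ^ 3 * L) / (2 * \<epsilon>\<^sup>2 * L)"
        using assms elim \<delta>_small by (intro divide_right_mono add_mono mult_right_mono) auto
      also have "\<dots> = \<epsilon>" using assms elim by (simp add: power2_eq_square power3_eq_cube)
      finally have "prob G \<le> \<epsilon>" .
      moreover have "G \<in> events" unfolding G_def by (rule arrival_maximal_sets) (simp add: a_def)
      moreover have "\<bar>arrival_walk (j - 1 + k) \<omega> - arrival_walk (j - 1 + nat \<lfloor>law.\<kappa> * L\<rfloor>) \<omega>\<bar> < \<epsilon> * sqrt L"
        if \<omega>: "\<omega> \<in> space M - G" and k: "\<bar>real k - law.\<kappa> * L\<bar> \<le> \<delta> * L + 1" for \<omega> k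
      proof -
        have near: "\<bar>arrival_walk (j - 1 + k') \<omega> - arrival_walk (j - 1 + k1) \<omega>\<bar> < c"
          if k': "\<bar>real k' - law.\<kappa> * L\<bar> \<le> \<delta> * L + 1" for k'
        proof -
          have low: "k1 \<le> k'" using k' unfolding k1_def by linarith
          have "real k1 \<ge> law.\<kappa> * L - \<delta> * L - 1" unfolding k1_def by linarith
          then have "real (k' - k1) \<le> 2 * \<delta> * L + 2" using k' low by (simp add: of_nat_diff)
          then have "k' - k1 \<le> w" unfolding w_def by linarith
          then have "\<bar>\<Sum>m=a..<a + (k' - k1). Arr m \<omega> - 1 / lam\<bar> < c"
            using \<omega> unfolding G_def not_le[symmetric] by blast
          then show ?thesis
            using arrival_walk_diff[of "j - 1 + k1" "k' - k1" \<omega>] low by (simp add: a_def)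
        qed
        have "law.\<kappa> * L \<ge> 0" "\<delta> * L \<ge> 0" using law.\<kappa>_pos \<delta> elim by auto
        then have "\<bar>real (nat \<lfloor>law.\<kappa> * L\<rfloor>) - law.\<kappa> * L\<bar> \<le> \<delta> * L + 1" by linarith
        from near[OF this] near[OF k] show ?thesis unfolding c_def by (simp add: abs_if split: if_splits)
      qed
      ultimately show "\<exists>G\<in>events. prob G \<le> \<epsilon> \<and> (\<forall>\<omega>\<in>space M - G. \<forall>k. \<bar>real k - law.\<kappa> * L\<bar> \<le> \<delta> * L + 1 \<longrightarrow>
        \<bar>arrival_walk (j - 1 + k) \<omega> - arrival_walk (j - 1 + nat \<lfloor>law.\<kappa> * L\<rfloor>) \<omega>\<bar> < \<epsilon> * sqrt L)" by blast
    qed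
  qed
  show thesis by (rule that[OF \<delta> ev])
qed

definition far_decay :: "real \<Rightarrow> real \<Rightarrow> real \<Rightarrow> bool" where
  "far_decay \<delta> \<zeta> c \<longleftrightarrow> (\<forall>L k i j. 0 \<le> L \<longrightarrow> 1 \<le> i \<longrightarrow> \<delta> * L \<le> \<bar>real k - law.\<kappa> * L\<bar> \<longrightarrow>
     prob {\<omega>\<in>space M. (1 / \<gamma> - \<zeta>) * L \<le> service_walk i j k \<omega>} \<le> exp (- (1 + c) * L))"

text \<open>
  The Chernoff bound with exponent \<open>\<gamma> + \<eta>\<close> at early and \<open>\<gamma> - \<eta>\<close> at late times. A part of the
  gain from \<open>rate_gap\<close> is spent on lowering the level by \<open>\<zeta> L\<close>, which leaves room for
  fluctuations of the arrivals that are much larger than their actual size.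
\<close>

lemma far_service_tail:
  assumes "\<delta> > 0"
  obtains \<zeta> c where "0 < \<zeta>" "0 < c" "far_decay \<delta> \<zeta> c"
proof -
  obtain \<eta> c where \<eta>: "0 < \<eta>" "\<eta> < \<gamma>" "\<eta> \<le> radius" and c: "0 < c"
    and low: "\<And>L k. \<lbrakk>L \<ge> 0; real k \<le> (law.\<kappa> - \<delta>) * L\<rbrakk> \<Longrightarrow> law.mgf (\<gamma> + \<eta>) ^ k \<le> exp ((\<eta> / \<gamma> - c) * L)"
    and high: "\<And>L k. real k \<ge> (law.\<kappa> + \<delta>) * L \<Longrightarrow> law.mgf (\<gamma> - \<eta>) ^ k \<le> exp ((- \<eta> / \<gamma> - c) * L)"
    using law.rate_gap[OF assms] by metis
  define \<zeta> where "\<zeta> = c / (4 * \<gamma>)"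
  have \<zeta>: "\<zeta> > 0" "\<gamma> * \<zeta> = c / 4" using c \<gamma>_pos by (auto simp: \<zeta>_def)
  have \<eta>\<zeta>: "0 \<le> \<eta> * \<zeta>" "\<eta> * \<zeta> \<le> c / 4"
    using \<eta> \<zeta> mult_right_mono[of \<eta> \<gamma> \<zeta>] by auto
  show thesis
  proof (rule that[of \<zeta> "c / 2"], goal_cases)
    case 3
    show ?case unfolding far_decay_def
    proof (intro allI impI)
      fix L :: real and k i j :: nat
      assume L: "L \<ge> 0" and i: "i \<ge> 1" and far: "\<delta> * L \<le> \<bar>real k - law.\<kappa> * L\<bar>"
      define y where "y = (1 / \<gamma> - \<zeta>) * L"
      consider "real k \<le> (law.\<kappa> - \<delta>) * L" | "real k \<ge> (law.\<kappa> + \<delta>) * L"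
        using far by (auto simp: algebra_simps abs_if split: if_splits)
      then show "prob {\<omega>\<in>space M. (1 / \<gamma> - \<zeta>) * L \<le> service_walk i j k \<omega>} \<le> exp (- (1 + c / 2) * L)"
      proof cases
        case 1
        have "prob {\<omega>\<in>space M. y \<le> service_walk i j k \<omega>} \<le> exp (- (\<gamma> + \<eta>) * y) * law.mgf (\<gamma> + \<eta>) ^ k"
          using service_walk_tail[OF i, of "\<gamma> + \<eta>" y j k] \<eta> \<gamma>_pos by simp
        also have "\<dots> \<le> exp (- (\<gamma> + \<eta>) * y) * exp ((\<eta> / \<gamma> - c) * L)"
          using low[OF L 1] by (intro mult_left_mono) auto
        also have "\<dots> = exp ((- 1 + \<gamma> * \<zeta> + \<eta> * \<zeta> - c) * L)"
        proof -
          have "- (\<gamma> + \<eta>) * y + (\<eta> / \<gamma> - c) * L = (- 1 + \<gamma> * \<zeta> + \<eta> * \<zeta> - c) * L"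
            using \<gamma>_pos by (simp add: y_def field_simps)
          then show ?thesis by (simp flip: exp_add)
        qed
        also have "\<dots> \<le> exp (- (1 + c / 2) * L)"
          unfolding exp_le_cancel_iff using \<zeta> \<eta>\<zeta> L by (intro mult_right_mono) auto
        finally show ?thesis unfolding y_def .
      next
        case 2
        have "prob {\<omega>\<in>space M. y \<le> service_walk i j k \<omega>} \<le> exp (- (\<gamma> - \<eta>) * y) * law.mgf (\<gamma> - \<eta>) ^ k"
          using service_walk_tail[OF i, of "\<gamma> - \<eta>" y j k] \<eta> \<gamma>_pos law.r_pos by simp
        also have "\<dots> \<le> exp (- (\<gamma> - \<eta>) * y) * exp ((- \<eta> / \<gamma> - c) * L)"
          using high[OF 2] by (intro mult_left_mono) auto
        also have "\<dots> = exp ((- 1 + \<gamma> * \<zeta> - \<eta> * \<zeta> - c) * L)"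
        proof -
          have "- (\<gamma> - \<eta>) * y + (- \<eta> / \<gamma> - c) * L = (- 1 + \<gamma> * \<zeta> - \<eta> * \<zeta> - c) * L"
            using \<gamma>_pos by (simp add: y_def field_simps)
          then show ?thesis by (simp flip: exp_add)
        qed
        also have "\<dots> \<le> exp (- (1 + c / 2) * L)"
          unfolding exp_le_cancel_iff using \<zeta> \<eta>\<zeta> c L by (intro mult_right_mono) auto
        finally show ?thesis unfolding y_def .
      qed
    qed
  qed (use \<zeta> c in auto)
qed

end

section \<open>Upper bound for the overload probability\<close>

context fork_join
begin

definition overload :: "nat \<Rightarrow> nat \<Rightarrow> 'a set" where
  "overload N j = {\<omega>\<in>space M. \<exists>i\<in>{1..N}. ereal (arrival_age Arr U j \<omega>) \<le> waiting_time Serv Arr i j \<omega>}"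

lemma overload_sets: "j \<ge> 1 \<Longrightarrow> overload N j \<in> events"
proof -
  assume j: "j \<ge> 1"
  have "overload N j = (\<Union>i\<in>{1..N}. {\<omega>\<in>space M. ereal (arrival_age Arr U j \<omega>) \<le> waiting_time Serv Arr i j \<omega>})"
    by (auto simp: overload_def)
  also have "\<dots> \<in> events" using j by (intro sets.finite_UN waiting_age_sets) auto
  finally show ?thesis .
qed

lemma AE_arrival_age_nonneg: "AE \<omega> in M. \<forall>j. arrival_age Arr U j \<omega> \<ge> 0"
proof -
  have "AE \<omega> in M. \<forall>m\<in>{1..}. Arr m \<omega> \<ge> 0"
    by (intro AE_ball_countable' countableI_type) (auto intro: Arr_nonneg)
  then show ?thesis using U_nonneg
    by eventually_elim (auto simp: arrival_age_def intro!: add_nonneg_nonneg sum_nonneg)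
qed

lemma service_union_bound:
  fixes b y :: real
  assumes "finite K" "\<And>i k. i \<ge> 1 \<Longrightarrow> k \<in> K \<Longrightarrow> prob {\<omega>\<in>space M. y \<le> service_walk i j k \<omega>} \<le> b"
  shows "{\<omega>\<in>space M. \<exists>i\<in>{1..N}. \<exists>k\<in>K. y \<le> service_walk i j k \<omega>} \<in> events"
    "prob {\<omega>\<in>space M. \<exists>i\<in>{1..N}. \<exists>k\<in>K. y \<le> service_walk i j k \<omega>} \<le> real N * (real (card K) * b)"
proof -
  have sets: "{\<omega>\<in>space M. y \<le> service_walk (fst p) j (snd p) \<omega>} \<in> events" if "p \<in> {1..N} \<times> K" for p
  proof -
    have "service_walk (fst p) j (snd p) \<in> borel_measurable M" using that by (intro service_walk_meas) auto
    then show ?thesis by measurable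
  qed
  have eq: "{\<omega>\<in>space M. \<exists>i\<in>{1..N}. \<exists>k\<in>K. y \<le> service_walk i j k \<omega>}
      = {\<omega>\<in>space M. \<exists>p\<in>{1..N} \<times> K. y \<le> service_walk (fst p) j (snd p) \<omega>}" by force
  have "{\<omega>\<in>space M. \<exists>p\<in>{1..N} \<times> K. y \<le> service_walk (fst p) j (snd p) \<omega>}
      = (\<Union>p\<in>{1..N} \<times> K. {\<omega>\<in>space M. y \<le> service_walk (fst p) j (snd p) \<omega>})" by blast
  also have "\<dots> \<in> events" by (rule sets.finite_UN[OF _ sets]) (use assms in auto)
  finally show "{\<omega>\<in>space M. \<exists>i\<in>{1..N}. \<exists>k\<in>K. y \<le> service_walk i j k \<omega>} \<in> events" unfolding eq .
  have "prob {\<omega>\<in>space M. \<exists>p\<in>{1..N} \<times> K. y \<le> service_walk (fst p) j (snd p) \<omega>} \<le> card ({1..N} \<times> K) * b"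
    by (rule prob_exists_le[OF _ sets]) (use assms in auto)
  then show "prob {\<omega>\<in>space M. \<exists>i\<in>{1..N}. \<exists>k\<in>K. y \<le> service_walk i j k \<omega>} \<le> real N * (real (card K) * b)"
    unfolding eq card_cartesian_product by (simp add: mult.assoc)
qed

text \<open>
  Some queue is long only if one of six events occurs: the arrival walk is low at time \<open>n\<close>
  (\<open>B0\<close>); it is not flat near that time (\<open>G\<close>); it is of order \<open>L\<close> somewhere (\<open>B2\<close>); a service
  walk exceeds \<open>L / \<gamma>\<close> by a multiple of \<open>sqrt L\<close> at a time near \<open>\<kappa> L\<close> (\<open>B3\<close>); a service walk
  comes within \<open>\<zeta> L\<close> of \<open>L / \<gamma>\<close> at a time away from \<open>\<kappa> L\<close> (\<open>B4\<close>); or a delay walk is still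
  about 0 after a time \<open>C L\<close> (\<open>B5\<close>). All but the first are unlikely, even after a union bound
  over the \<open>exp L\<close> queues. The constant \<open>C\<close> is such that \<open>\<rho> ^ (C L) \<le> exp (- 2 L)\<close>.
\<close>

lemma overload_upper:
  assumes "\<epsilon> > 0"
  shows "eventually (\<lambda>L. \<forall>N j. real N = exp L \<longrightarrow> j \<ge> 1 \<longrightarrow> lam / \<gamma> * L + x * sqrt L \<le> real j \<longrightarrow>
      real j \<le> lam / \<gamma> * L + x * sqrt L + 1 \<longrightarrow>
      prob (overload N j) \<le> prob {\<omega>\<in>space M. \<not> - arrival_walk (j - 1 + nat \<lfloor>law.\<kappa> * L\<rfloor>) \<omega> \<le> (x / lam - \<epsilon>) * sqrt L} + \<epsilon>)
    at_top"
proof -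
  define e where "e = \<epsilon> / 8"
  have e: "e > 0" using assms by (simp add: e_def)
  obtain \<delta> where \<delta>: "0 < \<delta>" "\<delta> < law.\<kappa>" and window: "eventually (arrivals_flat e \<delta>) at_top"
    using arrival_window[OF e] by metis
  obtain \<zeta> c where \<zeta>: "0 < \<zeta>" and c: "0 < c" and far: "far_decay \<delta> \<zeta> c"
    using far_service_tail[OF \<delta>(1)] by metis
  obtain \<theta> \<rho> where \<theta>: "0 < \<theta>" "0 \<le> \<rho>" "\<rho> < 1"
    and decay: "\<And>i j k0 y. i \<ge> 1 \<Longrightarrow> j \<ge> 1 \<Longrightarrow>
       prob {\<omega>\<in>space M. \<exists>k\<ge>k0. y \<le> delay_walk i j k \<omega>} \<le> exp (- \<theta> * y) * \<rho> ^ k0 / (1 - \<rho>)"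
    by (rule delay_walk_decay, rule that) (assumption | blast)+
  define C where "C = 2 / (1 - \<rho>)"
  have C: "C > 0" "C * (1 - \<rho>) = 2" using \<theta> nonzero_eq_divide_eq[THEN iffD1, OF _ C_def] by (simp_all add: C_def)
  define C2 where "C2 = lam / \<gamma> + C + 1"
  define kd where "kd = law.\<kappa> + \<delta>"
  have kd: "kd > 0" using law.\<kappa>_pos \<delta>(1) by (simp add: kd_def)
  have "eventually (\<lambda>L::real. L \<ge> 1) at_top" by (rule eventually_ge_at_top)
  moreover note window
  moreover have "eventually (\<lambda>L. (\<epsilon> / 2) * sqrt L + 1 / lam + 1 \<le> 7 / 8 * \<epsilon> * sqrt L) at_top"
    using assms by real_asymp
  moreover have "eventually (\<lambda>L. 0 \<le> x / lam * sqrt L - 1 / lam - 1 + \<zeta> / 2 * L) at_top"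
    using \<zeta> by real_asymp
  moreover have "eventually (\<lambda>L. (C2 * L + 1) * \<sigma>\<^sup>2 / (\<zeta> / 2 * L)\<^sup>2 \<le> e) at_top"
    using \<zeta> e by real_asymp
  moreover have "eventually (\<lambda>L. (kd * L + 2) * exp (- (\<gamma> * \<epsilon> / 2 * sqrt L)) \<le> e) at_top"
    using \<gamma>_pos assms e kd by real_asymp
  moreover have "eventually (\<lambda>L. (C * L + 2) * exp (- c * L) \<le> e) at_top"
    using c e C(1) by real_asymp
  moreover have "eventually (\<lambda>L. exp (\<theta> - L) / (1 - \<rho>) \<le> e) at_top"
    using \<theta> e by real_asymp
  moreover have "eventually (\<lambda>L. x * sqrt L + 2 \<le> L) at_top"
    by real_asymp
  ultimately show ?thesis
  proof eventually_elim
    case (elim L)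
    show ?case
    proof (intro allI impI)
      fix N j :: nat
      assume N: "real N = exp L" and j: "j \<ge> 1" "lam / \<gamma> * L + x * sqrt L \<le> real j" "real j \<le> lam / \<gamma> * L + x * sqrt L + 1"
      define n where "n = j - 1 + nat \<lfloor>law.\<kappa> * L\<rfloor>"
      from elim(2)[unfolded arrivals_flat_def, THEN spec, THEN mp, OF j(1), folded n_def]
      obtain G where G0: "G \<in> events" and G1: "prob G \<le> e \<and> (\<forall>\<omega>\<in>space M - G. \<forall>k. \<bar>real k - law.\<kappa> * L\<bar> \<le> \<delta> * L + 1 \<longrightarrow>
          \<bar>arrival_walk (j - 1 + k) \<omega> - arrival_walk n \<omega>\<bar> < e * sqrt L)" by (rule bexE)
      note G = G0 G1[THEN conjunct1]
      have fluct: "\<bar>arrival_walk (j - 1 + k) \<omega> - arrival_walk n \<omega>\<bar> < e * sqrt L"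
        if "\<omega> \<in> space M" "\<omega> \<notin> G" "\<bar>real k - law.\<kappa> * L\<bar> \<le> \<delta> * L + 1" for \<omega> k
        using G1[THEN conjunct2, THEN bspec, of \<omega>, THEN spec, of k] that by simp
      define k0 where "k0 = nat \<lceil>C * L\<rceil>"
      define n2 where "n2 = nat \<lceil>C2 * L\<rceil>"
      have k0: "C * L \<le> k0" "k0 \<le> C * L + 1" using C elim(1) by (auto simp: k0_def intro: less_imp_le)
      have wide: "lam / \<gamma> * L + x * sqrt L + 1 + (C * L + 1) \<le> C2 * L"
        using elim(9) by (simp add: C2_def algebra_simps)
      have C2L: "C2 * L \<ge> 0" using C lam_pos \<gamma>_pos elim(1) by (simp add: C2_def)
      have n2: "C2 * L \<le> n2" "n2 \<le> C2 * L + 1" using C2L unfolding n2_def by linarith+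
      define K1 where "K1 = {k. \<bar>real k - law.\<kappa> * L\<bar> \<le> \<delta> * L + 1}"
      define y1 where "y1 = L / \<gamma> + \<epsilon> / 2 * sqrt L"
      define y2 where "y2 = (1 / \<gamma> - \<zeta>) * L"
      define B0 where "B0 = {\<omega>\<in>space M. \<not> - arrival_walk n \<omega> \<le> (x / lam - \<epsilon>) * sqrt L}"
      define B2 where "B2 = {\<omega>\<in>space M. \<exists>k\<le>n2. \<zeta> / 2 * L \<le> \<bar>\<Sum>m=1..<1 + k. Arr m \<omega> - 1 / lam\<bar>}"
      define B3 where "B3 = {\<omega>\<in>space M. \<exists>i\<in>{1..N}. \<exists>k\<in>K1. y1 \<le> service_walk i j k \<omega>}"
      define B4 where "B4 = {\<omega>\<in>space M. \<exists>i\<in>{1..N}. \<exists>k\<in>{..k0} - K1. y2 \<le> service_walk i j k \<omega>}"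
      define B5 where "B5 = {\<omega>\<in>space M. \<exists>i\<in>{1..N}. \<exists>k\<ge>k0. - 1 \<le> delay_walk i j k \<omega>}"
      have K1_sub: "K1 \<subseteq> {..nat \<lfloor>(law.\<kappa> + \<delta>) * L + 1\<rfloor>}"
      proof
        fix k assume "k \<in> K1"
        then have "real k \<le> (law.\<kappa> + \<delta>) * L + 1" unfolding K1_def by (simp add: distrib_right)
        then show "k \<in> {..nat \<lfloor>(law.\<kappa> + \<delta>) * L + 1\<rfloor>}" unfolding atMost_iff by (rule le_nat_floor)
      qed
      have pos: "(law.\<kappa> + \<delta>) * L \<ge> 0" using law.\<kappa>_pos \<delta> elim(1) by simp
      have "card K1 \<le> nat \<lfloor>(law.\<kappa> + \<delta>) * L + 1\<rfloor> + 1"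
        using card_mono[OF finite_atMost K1_sub] by simp
      then have card_K1: "real (card K1) \<le> (law.\<kappa> + \<delta>) * L + 2"
        using pos by linarith
      have finite_K1: "finite K1" using K1_sub finite_subset by blast
      have B0: "B0 \<in> events" unfolding B0_def by measurable
      have B2: "B2 \<in> events" "prob B2 \<le> e"
      proof -
        show "B2 \<in> events" unfolding B2_def by (rule arrival_maximal_sets) simp
        have "prob B2 \<le> n2 * \<sigma>\<^sup>2 / (\<zeta> / 2 * L)\<^sup>2"
          unfolding B2_def by (rule arrival_walk_maximal) (use \<zeta> elim(1) in auto)
        also have "\<dots> \<le> (C2 * L + 1) * \<sigma>\<^sup>2 / (\<zeta> / 2 * L)\<^sup>2"
          using n2(2) by (intro divide_right_mono mult_right_mono) auto
        finally show "prob B2 \<le> e" using elim(5) by simp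
      qed
      have B3: "B3 \<in> events" "prob B3 \<le> e"
      proof -
        have b: "prob {\<omega>\<in>space M. y1 \<le> service_walk i j k \<omega>} \<le> exp (- \<gamma> * y1)" if "i \<ge> 1" for i k
          using service_walk_tail[OF that, of \<gamma> y1 j k] \<gamma>_pos law.r_pos law.mgf_\<gamma>
          by (simp add: law.mgf_def)
        note U = service_union_bound[where K = K1 and N = N and y = y1 and j = j and b = "exp (- \<gamma> * y1)", OF finite_K1 b]
        show "B3 \<in> events" unfolding B3_def using U(1) by simp
        have "prob B3 \<le> exp L * (real (card K1) * exp (- \<gamma> * y1))"
          unfolding B3_def using U(2) N by simp
        also have "\<dots> = real (card K1) * exp (- (\<gamma> * \<epsilon> / 2 * sqrt L))"
          using \<gamma>_pos by (simp add: y1_def algebra_simps flip: exp_add)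
        also have "\<dots> \<le> ((law.\<kappa> + \<delta>) * L + 2) * exp (- (\<gamma> * \<epsilon> / 2 * sqrt L))"
          using card_K1 by (intro mult_right_mono) auto
        finally show "prob B3 \<le> e" using elim(6) by (simp add: kd_def)
      qed
      have B4: "B4 \<in> events" "prob B4 \<le> e"
      proof -
        have b: "prob {\<omega>\<in>space M. y2 \<le> service_walk i j k \<omega>} \<le> exp (- (1 + c) * L)" if "i \<ge> 1" "k \<in> {..k0} - K1" for i k
          unfolding y2_def by (rule far[unfolded far_decay_def, rule_format]) (use that elim(1) in \<open>auto simp: K1_def\<close>)
        note U = service_union_bound[where K = "{..k0} - K1" and N = N and y = y2 and j = j and b = "exp (- (1 + c) * L)", OF _ b]
        show "B4 \<in> events" unfolding B4_def using U(1) by simp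
        have card: "real (card ({..k0} - K1)) \<le> C * L + 2"
          using card_mono[of "{..k0}" "{..k0} - K1"] k0(2) by simp
        have "prob B4 \<le> exp L * (real (card ({..k0} - K1)) * exp (- (1 + c) * L))"
          unfolding B4_def using U(2) N by simp
        also have "\<dots> = real (card ({..k0} - K1)) * exp (- c * L)"
          by (simp add: algebra_simps flip: exp_add)
        also have "\<dots> \<le> (C * L + 2) * exp (- c * L)"
          using card by (intro mult_right_mono) auto
        finally show "prob B4 \<le> e" using elim(7) by simp
      qed
      have B5: "B5 \<in> events" "prob B5 \<le> e"
      proof -
        have sets: "{\<omega>\<in>space M. \<exists>k\<ge>k0. - 1 \<le> delay_walk i j k \<omega>} \<in> events" if "i \<in> {1..N}" for i
          using that j(1) by (intro delay_exceeds_sets) auto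
        have "B5 = (\<Union>i\<in>{1..N}. {\<omega>\<in>space M. \<exists>k\<ge>k0. - 1 \<le> delay_walk i j k \<omega>})"
          by (auto simp: B5_def)
        also have "\<dots> \<in> events" by (rule sets.finite_UN[OF _ sets]) auto
        finally show "B5 \<in> events" .
        have "\<rho> ^ k0 \<le> exp (- (1 - \<rho>)) ^ k0"
          using exp_ge_add_one_self[of "- (1 - \<rho>)"] \<theta> by (intro power_mono) auto
        also have "exp (- (1 - \<rho>)) ^ k0 = exp (- ((1 - \<rho>) * k0))"
          by (simp add: exp_of_nat_mult[symmetric] algebra_simps)
        also have "\<dots> \<le> exp (- ((1 - \<rho>) * (C * L)))"
          using \<theta> k0(1) by (simp add: mult_left_mono)
        also have "(1 - \<rho>) * (C * L) = 2 * L" using C(2) by (simp only: mult.assoc[symmetric] mult.commute)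
        finally have decayed: "\<rho> ^ k0 \<le> exp (- (2 * L))" .
        have "prob B5 \<le> card {1..N} * (exp (- \<theta> * - 1) * \<rho> ^ k0 / (1 - \<rho>))"
          unfolding B5_def by (rule prob_exists_le[OF _ sets decay]) (use j(1) in auto)
        also have "\<dots> = exp L * (exp \<theta> * \<rho> ^ k0 / (1 - \<rho>))" using N by simp
        also have "\<dots> \<le> exp L * (exp \<theta> * exp (- (2 * L)) / (1 - \<rho>))"
          using decayed \<theta> by (intro mult_left_mono divide_right_mono) auto
        also have "\<dots> = exp (\<theta> - L) / (1 - \<rho>)"
          by (simp flip: exp_add)
        also have "\<dots> \<le> e" by (rule elim(8))
        finally show "prob B5 \<le> e" .
      qed
      have "AE \<omega> in M. \<omega> \<in> overload N j \<longrightarrow> \<omega> \<in> B0 \<union> (G \<union> (B2 \<union> (B3 \<union> (B4 \<union> B5))))"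
        using U_nonneg AE_arrival_age_nonneg
      proof eventually_elim
        case (elim \<omega>)
        note large = \<open>1 \<le> L\<close> \<open>\<epsilon> / 2 * sqrt L + 1 / lam + 1 \<le> 7 / 8 * \<epsilon> * sqrt L\<close>
          \<open>0 \<le> x / lam * sqrt L - 1 / lam - 1 + \<zeta> / 2 * L\<close> wide
        show ?case
        proof (rule impI, rule ccontr)
          assume over: "\<omega> \<in> overload N j" and "\<omega> \<notin> B0 \<union> (G \<union> (B2 \<union> (B3 \<union> (B4 \<union> B5))))"
          then have notin: "\<omega> \<notin> B0" "\<omega> \<notin> G" "\<omega> \<notin> B2" "\<omega> \<notin> B3" "\<omega> \<notin> B4" "\<omega> \<notin> B5" by auto
          obtain i where i: "i \<in> {1..N}" and \<omega>: "\<omega> \<in> space M"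
            and wait: "ereal (arrival_age Arr U j \<omega>) \<le> waiting_time Serv Arr i j \<omega>"
            using over by (auto simp: overload_def)
          \<comment> \<open>The supremum need not be attained, so one unit is given away.\<close>
          have "ereal (arrival_age Arr U j \<omega> - 1) < ereal (arrival_age Arr U j \<omega>)" by simp
          also note wait
          finally obtain k where k: "arrival_age Arr U j \<omega> - 1 < delay_walk i j k \<omega>"
            unfolding waiting_time_eq less_SUP_iff by auto
          have "(real j - 1) / lam \<ge> (lam / \<gamma> * L + x * sqrt L - 1) / lam"
            using j(2) lam_pos by (intro divide_right_mono) auto
          also have "(lam / \<gamma> * L + x * sqrt L - 1) / lam = L / \<gamma> + x / lam * sqrt L - 1 / lam"
            using lam_pos by (simp add: field_simps)
          finally have age: "L / \<gamma> + x / lam * sqrt L - 1 / lam \<le> (real j - 1) / lam" .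
          have serv: "L / \<gamma> + x / lam * sqrt L - 1 / lam + arrival_walk (j - 1 + k) \<omega> - 1 < service_walk i j k \<omega>"
            using delay_walk_eq[OF j(1), of i k \<omega>] k age \<open>0 \<le> U \<omega>\<close> by linarith
          show False
          proof (cases "k \<in> K1")
            case True
            then have "arrival_walk n \<omega> - e * sqrt L < arrival_walk (j - 1 + k) \<omega>"
              using fluct[OF \<omega> notin(2), of k] by (auto simp: K1_def)
            moreover have "- arrival_walk n \<omega> \<le> x / lam * sqrt L - \<epsilon> * sqrt L"
              using notin(1) \<omega> by (simp add: B0_def left_diff_distrib)
            ultimately have "y1 \<le> service_walk i j k \<omega>"
              using serv large(2) unfolding y1_def e_def by simp
            then have "\<omega> \<in> B3" using True i \<omega> by (auto simp: B3_def)
            then show False using notin by simp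
          next
            case out: False
            show False
            proof (cases "k \<le> k0")
              case True
              have "real (j - 1 + k) \<le> C2 * L" using j True k0(2) large(4) by (simp add: of_nat_diff)
              then have "j - 1 + k \<le> n2" using n2(1) by linarith
              then have "\<bar>arrival_walk (j - 1 + k) \<omega>\<bar> < \<zeta> / 2 * L"
                using notin(3) \<omega> unfolding B2_def arrival_walk_def not_le[symmetric] by blast
              moreover have "(1 / \<gamma> - \<zeta>) * L = L / \<gamma> - \<zeta> / 2 * L - \<zeta> / 2 * L" by (simp add: algebra_simps)
              ultimately have "y2 \<le> service_walk i j k \<omega>"
                using serv large(3) unfolding y2_def by linarith
              then have "\<omega> \<in> B4" using True out i \<omega> by (auto simp: B4_def)
              then show False using notin by simp
            next
              case False
              have "- 1 \<le> delay_walk i j k \<omega>" using k elim(2)[rule_format, of j] by linarith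
              then have "\<omega> \<in> B5" using False i \<omega> by (auto simp: B5_def intro!: exI[of _ k])
              then show False using notin by simp
            qed
          qed
        qed
      qed
      then have "prob (overload N j) \<le> prob (B0 \<union> (G \<union> (B2 \<union> (B3 \<union> (B4 \<union> B5)))))"
        by (rule finite_measure_mono_AE) (use B0 G B2 B3 B4 B5 in blast)
      also have "\<dots> \<le> prob B0 + (prob G + (prob B2 + (prob B3 + (prob B4 + prob B5))))"
        using B0 G B2 B3 B4 B5
        by (intro order_trans[OF measure_Un_le] add_mono order_refl sets.Un) auto
      also have "\<dots> \<le> prob B0 + \<epsilon>"
        using G B2 B3 B4 B5 assms by (simp add: e_def)
      finally show "prob (overload N j) \<le> prob {\<omega>\<in>space M. \<not> - arrival_walk (j - 1 + nat \<lfloor>law.\<kappa> * L\<rfloor>) \<omega> \<le> (x / lam - \<epsilon>) * sqrt L} + \<epsilon>"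
        unfolding B0_def n_def .
    qed
  qed
qed

end

section \<open>Lower bound for the overload probability\<close>

context fork_join
begin

lemma U_tail:
  assumes "\<epsilon> > 0"
  shows "eventually (\<lambda>t. prob {\<omega>\<in>space M. t < U \<omega>} \<le> \<epsilon>) at_top"
proof -
  interpret D: real_distribution "distr M borel U" by (rule real_distribution_distr) simp
  have "eventually (\<lambda>t. cdf (distr M borel U) t > 1 - \<epsilon>) at_top"
    using order_tendstoD(1)[OF D.cdf_lim_at_top_prob, of "1 - \<epsilon>"] assms by simp
  then show ?thesis
  proof eventually_elim
    case (elim t)
    have "cdf (distr M borel U) t = prob {\<omega>\<in>space M. U \<omega> \<le> t}"
      by (simp add: cdf_def measure_distr vimage_def Int_def conj_commute)
    moreover have "{\<omega>\<in>space M. t < U \<omega>} = space M - {\<omega>\<in>space M. U \<omega> \<le> t}" by auto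
    then have "prob {\<omega>\<in>space M. t < U \<omega>} = 1 - prob {\<omega>\<in>space M. U \<omega> \<le> t}"
      by (simp add: prob_compl)
    ultimately show ?case using elim by simp
  qed
qed

text \<open>
  The services of different queues are independent, and \<open>(1 - p) ^ N \<le> exp (- N p)\<close>. The
  probability \<open>p\<close> is stated for one reference queue and starting task, so that a time \<open>k\<close>
  chosen for it serves all queues at once.
\<close>

lemma prob_all_services_low:
  assumes "j \<ge> 1" "N \<ge> 1"
  shows "prob {\<omega>\<in>space M. \<forall>i\<in>{1..N}. service_walk i j k \<omega> < a}
    \<le> exp (- (real N * prob {\<omega>\<in>space M. a \<le> service_walk 1 0 k \<omega>}))"
proof -
  define p where "p = prob {\<omega>\<in>space M. a \<le> service_walk 1 0 k \<omega>}"
  have low: "prob (service_walk i j k -` {..<a} \<inter> space M) = 1 - p" if "i \<ge> 1" for i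
  proof -
    note [measurable] = service_walk_meas[OF that, of j k] service_walk_meas[of 1 0 k, OF order_refl]
    have "p = measure (distr M borel (service_walk 1 0 k)) {a..}"
      unfolding p_def by (subst measure_distr) (auto intro!: arg_cong[where f = prob] simp del: One_nat_def)
    also have "\<dots> = measure (distr M borel (service_walk i j k)) {a..}"
      using service_walk_identically_distributed[of 1 i 0 k j] that by simp
    also have "\<dots> = prob {\<omega>\<in>space M. a \<le> service_walk i j k \<omega>}"
      by (subst measure_distr) (auto intro!: arg_cong[where f = prob])
    finally have p: "p = prob {\<omega>\<in>space M. a \<le> service_walk i j k \<omega>}" .
    have "service_walk i j k -` {..<a} \<inter> space M = space M - {\<omega>\<in>space M. a \<le> service_walk i j k \<omega>}" by auto
    then show ?thesis unfolding p by (simp add: prob_compl)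
  qed
  have "{\<omega>\<in>space M. \<forall>i\<in>{1..N}. service_walk i j k \<omega> < a} = (\<Inter>i\<in>{1..N}. service_walk i j k -` {..<a} \<inter> space M)"
    using assms(2) by auto
  also have "prob \<dots> = (\<Prod>i\<in>{1..N}. prob (service_walk i j k -` {..<a} \<inter> space M))"
    by (rule indep_varsD[OF service_walks_indep[OF assms(1)]]) (use assms(2) in auto)
  also have "\<dots> = (\<Prod>i\<in>{1..N}. 1 - p)" by (intro prod.cong refl low) simp
  also have "\<dots> = (1 - p) ^ N" by simp
  also have "\<dots> \<le> exp (- p) ^ N"
    using exp_ge_add_one_self[of "- p"] by (intro power_mono) (auto simp: p_def)
  also have "\<dots> = exp (- (real N * p))" by (simp add: exp_of_nat_mult[symmetric])
  finally show ?thesis unfolding p_def .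
qed

text \<open>
  At the time \<open>k\<close> from \<open>likely_level_time\<close> some service walk is above
  \<open>a = L / \<gamma> - \<epsilon> / 2 sqrt L\<close>, except with probability at most \<open>exp (- exp (\<gamma> \<epsilon> / 8 sqrt L))\<close>.
  If moreover the arrival walk is low at time \<open>n\<close> and flat near it, and \<open>U\<close> is at most
  \<open>\<epsilon> / 8 sqrt L\<close>, then this walk alone makes the waiting time of task \<open>j\<close> exceed its age.
\<close>

lemma overload_lower:
  assumes "\<epsilon> > 0"
  shows "eventually (\<lambda>L. \<forall>N j. real N = exp L \<longrightarrow> j \<ge> 1 \<longrightarrow>
      real j \<le> lam / \<gamma> * L + x * sqrt L + 1 \<longrightarrow>
      prob {\<omega>\<in>space M. \<not> - arrival_walk (j - 1 + nat \<lfloor>law.\<kappa> * L\<rfloor>) \<omega> \<le> (x / lam + \<epsilon>) * sqrt L} \<le> prob (overload N j) + \<epsilon>)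
    at_top"
proof -
  define e where "e = \<epsilon> / 8"
  have e: "e > 0" using assms by (simp add: e_def)
  obtain \<delta> where \<delta>: "0 < \<delta>" "\<delta> < law.\<kappa>" and window: "eventually (arrivals_flat e \<delta>) at_top"
    using arrival_window[OF e] by metis
  interpret walk: cramer_walk increment_law \<gamma> radius M "\<lambda>m \<omega>. Serv 1 (m + 1) \<omega> - 1 / lam"
  proof
    show "indep_vars (\<lambda>_. borel) (\<lambda>m \<omega>. Serv 1 (m + 1) \<omega> - 1 / lam) UNIV"
      by (rule centred_service_indep) simp
    show "distr M borel (\<lambda>\<omega>. Serv 1 (m + 1) \<omega> - 1 / lam) = increment_law" for m
      by (rule centred_service_distr) simp
  qed
  have walk_eq: "walk.S k \<omega> = service_walk 1 0 k \<omega>" for k \<omega>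
    unfolding walk.S_def service_walk_def by (simp add: lessThan_atLeast0)
  have reach: "eventually (\<lambda>L. \<exists>k. (law.\<kappa> - \<delta>) * L \<le> k \<and> k \<le> (law.\<kappa> + \<delta>) * L + 1 \<and>
      exp (- L + \<gamma> * (\<epsilon> / 2) / 4 * sqrt L) \<le> prob {\<omega>\<in>space M. L / \<gamma> - \<epsilon> / 2 * sqrt L \<le> service_walk 1 0 k \<omega>}) at_top"
    using walk.likely_level_time[OF \<delta>, of "\<epsilon> / 2"] assms unfolding walk_eq by simp
  have "filterlim (\<lambda>L. e * sqrt L) at_top at_top" using e by real_asymp
  from eventually_compose_filterlim[OF U_tail[OF e] this]
  have U_small: "eventually (\<lambda>L. prob {\<omega>\<in>space M. e * sqrt L < U \<omega>} \<le> e) at_top" .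
  have "eventually (\<lambda>L::real. L \<ge> 1) at_top" by (rule eventually_ge_at_top)
  moreover note window reach U_small
  moreover have "eventually (\<lambda>L. exp (- exp (\<gamma> * (\<epsilon> / 2) / 4 * sqrt L)) \<le> e) at_top"
    using \<gamma>_pos assms e by real_asymp
  ultimately show ?thesis
  proof eventually_elim
    case (elim L)
    show ?case
    proof (intro allI impI)
      fix N j :: nat
      assume N: "real N = exp L" and j: "j \<ge> 1" "real j \<le> lam / \<gamma> * L + x * sqrt L + 1"
      have N1: "N \<ge> 1" using N exp_gt_zero[of L] by (cases N) auto
      define n where "n = j - 1 + nat \<lfloor>law.\<kappa> * L\<rfloor>"
      from elim(2)[unfolded arrivals_flat_def, THEN spec, THEN mp, OF j(1), folded n_def]
      obtain G where G0: "G \<in> events" and G1: "prob G \<le> e \<and> (\<forall>\<omega>\<in>space M - G. \<forall>k. \<bar>real k - law.\<kappa> * L\<bar> \<le> \<delta> * L + 1 \<longrightarrow>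
          \<bar>arrival_walk (j - 1 + k) \<omega> - arrival_walk n \<omega>\<bar> < e * sqrt L)" by (rule bexE)
      note G = G0 G1[THEN conjunct1]
      obtain k where k: "(law.\<kappa> - \<delta>) * L \<le> k" "k \<le> (law.\<kappa> + \<delta>) * L + 1"
        and likely: "exp (- L + \<gamma> * (\<epsilon> / 2) / 4 * sqrt L) \<le> prob {\<omega>\<in>space M. L / \<gamma> - \<epsilon> / 2 * sqrt L \<le> service_walk 1 0 k \<omega>}"
        using elim(3) by (elim exE conjE)
      have k_near: "\<bar>real k - law.\<kappa> * L\<bar> \<le> \<delta> * L + 1"
        using k by (simp add: algebra_simps abs_le_iff)
      define a where "a = L / \<gamma> - \<epsilon> / 2 * sqrt L"
      define B0 where "B0 = {\<omega>\<in>space M. \<not> - arrival_walk n \<omega> \<le> (x / lam + \<epsilon>) * sqrt L}"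
      define B6 where "B6 = {\<omega>\<in>space M. e * sqrt L < U \<omega>}"
      define B7 where "B7 = {\<omega>\<in>space M. \<forall>i\<in>{1..N}. service_walk i j k \<omega> < a}"
      have B6: "B6 \<in> events" "prob B6 \<le> e" using elim(4) by (auto simp: B6_def)
      have B7: "B7 \<in> events" "prob B7 \<le> e"
      proof -
        have [measurable]: "service_walk i j k \<in> borel_measurable M" if "i \<in> {1..N}" for i
          using that by (intro service_walk_meas) auto
        have "B7 = (\<Inter>i\<in>{1..N}. {\<omega>\<in>space M. service_walk i j k \<omega> < a})"
          unfolding B7_def using N1 by auto
        also have "\<dots> \<in> events"
          by (rule sets.finite_INT) (use N1 in \<open>auto simp: borel_measurable_less service_walk_meas\<close>)
        finally show "B7 \<in> events" .
        have "exp (\<gamma> * (\<epsilon> / 2) / 4 * sqrt L) = exp L * exp (- L + \<gamma> * (\<epsilon> / 2) / 4 * sqrt L)"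
          by (simp flip: exp_add)
        also have "\<dots> \<le> real N * prob {\<omega>\<in>space M. a \<le> service_walk 1 0 k \<omega>}"
          unfolding N a_def by (intro mult_left_mono likely) simp
        finally have "exp (- (real N * prob {\<omega>\<in>space M. a \<le> service_walk 1 0 k \<omega>})) \<le> exp (- exp (\<gamma> * (\<epsilon> / 2) / 4 * sqrt L))"
          by simp
        then show "prob B7 \<le> e"
          using prob_all_services_low[OF j(1) N1, of k a] elim(5) unfolding B7_def by linarith
      qed
      have "B0 \<subseteq> overload N j \<union> (G \<union> (B6 \<union> B7))"
      proof (rule subsetI, rule ccontr)
        fix \<omega> assume \<omega>0: "\<omega> \<in> B0" and notin: "\<omega> \<notin> overload N j \<union> (G \<union> (B6 \<union> B7))"
        have \<omega>: "\<omega> \<in> space M" using \<omega>0 by (simp add: B0_def)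
        have "\<bar>arrival_walk (j - 1 + k) \<omega> - arrival_walk n \<omega>\<bar> < e * sqrt L"
          using G1[THEN conjunct2, THEN bspec, of \<omega>, THEN spec, of k] notin \<omega> k_near by simp
        moreover have "- arrival_walk n \<omega> > x / lam * sqrt L + \<epsilon> * sqrt L"
          using \<omega>0 by (simp add: B0_def distrib_right)
        moreover have "U \<omega> \<le> e * sqrt L" using notin \<omega> by (simp add: B6_def not_less)
        moreover have "(real j - 1) / lam \<le> L / \<gamma> + x / lam * sqrt L"
        proof -
          have "(real j - 1) / lam \<le> (lam / \<gamma> * L + x * sqrt L) / lam"
            using j lam_pos by (intro divide_right_mono) auto
          also have "\<dots> = L / \<gamma> + x / lam * sqrt L" using lam_pos by (simp add: field_simps)
          finally show ?thesis .
        qed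
        moreover have "e * sqrt L = \<epsilon> / 8 * sqrt L" "0 \<le> \<epsilon> * sqrt L" using assms elim(1) by (auto simp: e_def)
        ultimately have level: "U \<omega> + (real j - 1) / lam + arrival_walk (j - 1 + k) \<omega> \<le> a"
          unfolding a_def by linarith
        obtain i where i: "i \<in> {1..N}" "a \<le> service_walk i j k \<omega>"
          using notin \<omega> by (auto simp: B7_def not_less)
        have "arrival_age Arr U j \<omega> \<le> delay_walk i j k \<omega>"
          using delay_walk_eq[OF j(1), of i k \<omega>] level i(2) by linarith
        then have "ereal (arrival_age Arr U j \<omega>) \<le> waiting_time Serv Arr i j \<omega>"
          unfolding waiting_time_eq by (intro SUP_upper2[of k]) auto
        then have "\<omega> \<in> overload N j" using i(1) \<omega> by (auto simp: overload_def)
        then show False using notin by simp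
      qed
      then have "prob B0 \<le> prob (overload N j \<union> (G \<union> (B6 \<union> B7)))"
        by (rule finite_measure_mono) (use G B6 B7 overload_sets[OF j(1)] in blast)
      also have "\<dots> \<le> prob (overload N j) + (prob G + (prob B6 + prob B7))"
        using G B6 B7 overload_sets[OF j(1), of N]
        by (intro order_trans[OF measure_Un_le] add_mono order_refl sets.Un) auto
      also have "\<dots> \<le> prob (overload N j) + \<epsilon>"
        using G B6 B7 assms by (simp add: e_def)
      finally show "prob {\<omega>\<in>space M. \<not> - arrival_walk (j - 1 + nat \<lfloor>law.\<kappa> * L\<rfloor>) \<omega> \<le> (x / lam + \<epsilon>) * sqrt L} \<le> prob (overload N j) + \<epsilon>"
        unfolding B0_def n_def .
    qed
  qed
qed

end

section \<open>Gaussian limit\<close>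

text \<open>
  Monotonicity turns pointwise convergence into convergence at moving arguments: near a
  continuity point the moving argument is squeezed between two fixed ones.
\<close>

lemma cdf_tendsto_at_moving_point:
  fixes F :: "nat \<Rightarrow> real \<Rightarrow> real"
  assumes mono: "\<And>n. mono (F n)" and lim: "\<And>t. (\<lambda>n. F n t) \<longlonglongrightarrow> G t"
    and cont: "isCont G t0" and t: "t \<longlonglongrightarrow> t0"
  shows "(\<lambda>n. F n (t n)) \<longlonglongrightarrow> G t0"
proof (rule order_tendstoI)
  fix a assume "a < G t0"
  then have "eventually (\<lambda>u. a < G u) (at t0)"
    using cont by (intro order_tendstoD(1)[of G "G t0"]) (auto simp: isCont_def)
  then have "eventually (\<lambda>u. a < G u) (at_left t0)" by (simp add: eventually_at_split)
  moreover have "eventually (\<lambda>u. u < t0) (at_left t0)" by (simp add: eventually_at_filter)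
  ultimately have "eventually (\<lambda>u. a < G u \<and> u < t0) (at_left t0)" by eventually_elim simp
  then obtain u where u: "a < G u" "u < t0" by (auto dest!: eventually_happens)
  have "eventually (\<lambda>n. a < F n u) sequentially" using order_tendstoD(1)[OF lim u(1)] .
  moreover have "eventually (\<lambda>n. u < t n) sequentially" using order_tendstoD(1)[OF t u(2)] .
  ultimately show "eventually (\<lambda>n. a < F n (t n)) sequentially"
    by eventually_elim (meson mono monoD less_imp_le less_le_trans)
next
  fix a assume "G t0 < a"
  then have "eventually (\<lambda>u. G u < a) (at t0)"
    using cont by (intro order_tendstoD(2)[of G "G t0"]) (auto simp: isCont_def)
  then have "eventually (\<lambda>u. G u < a) (at_right t0)" by (simp add: eventually_at_split)
  moreover have "eventually (\<lambda>u. t0 < u) (at_right t0)" by (simp add: eventually_at_filter)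
  ultimately have "eventually (\<lambda>u. G u < a \<and> t0 < u) (at_right t0)" by eventually_elim simp
  then obtain u where u: "G u < a" "t0 < u" by (auto dest!: eventually_happens)
  have "eventually (\<lambda>n. F n u < a) sequentially" using order_tendstoD(2)[OF lim u(1)] .
  moreover have "eventually (\<lambda>n. t n < u) sequentially" using order_tendstoD(2)[OF t u(2)] .
  ultimately show "eventually (\<lambda>n. F n (t n) < a) sequentially"
    by eventually_elim (meson mono monoD less_imp_le le_less_trans)
qed

lemma isCont_cdf_std_normal: "isCont (cdf std_normal_distribution) x"
proof -
  interpret N: real_distribution std_normal_distribution by (rule real_dist_normal_dist)
  have "emeasure std_normal_distribution {x} = (\<integral>\<^sup>+y. ennreal (std_normal_density y) * indicator {x} y \<partial>lborel)"
    by (rule emeasure_density) auto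
  also have "\<dots> = ennreal (std_normal_density x) * emeasure lborel {x}"
    by (subst nn_integral_indicator_singleton) auto
  also have "\<dots> = 0" by simp
  finally show ?thesis by (simp add: N.isCont_cdf measure_def)
qed

lemma cdf_scaled_std_normal:
  assumes "c \<ge> 0"
  shows "cdf (distr std_normal_distribution borel (\<lambda>x. c * x)) s
    = (if c = 0 then (if s \<ge> 0 then 1 else 0) else cdf std_normal_distribution (s / c))"
proof -
  interpret N: real_distribution std_normal_distribution by (rule real_dist_normal_dist)
  have "cdf (distr std_normal_distribution borel (\<lambda>x. c * x)) s = N.prob {x. c * x \<le> s}"
    by (simp add: cdf_def measure_distr vimage_def)
  moreover have "{x. c * x \<le> s} = {..s / c}" if "c > 0"
    using that by (auto simp: field_simps)
  ultimately show ?thesis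
    using assms N.prob_space by (auto simp: cdf_def)
qed

context fork_join
begin

text \<open>
  The sign is reversed because a long queue corresponds to short interarrival times.
  Deterministic interarrival times are treated separately: the central limit theorem does not
  apply to them, but both sides are then the distribution function of the point mass at 0, so
  convergence holds at every \<open>s\<close>, also at the discontinuity.
\<close>

lemma arrival_walk_clt:
  assumes L: "filterlim L at_top sequentially" and n: "(\<lambda>N. real (n N) / L N) \<longlonglongrightarrow> \<nu>" and \<nu>: "\<nu> > 0"
  shows "(\<lambda>N. prob {\<omega>\<in>space M. - arrival_walk (n N) \<omega> \<le> s * sqrt (L N)})
    \<longlonglongrightarrow> cdf (distr std_normal_distribution borel (\<lambda>x. sqrt (\<sigma>\<^sup>2 * \<nu>) * x)) s"
proof (cases "\<sigma> = 0")
  case True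
  have zero: "AE \<omega> in M. arrival_walk k \<omega> = 0" for k
  proof -
    have "AE \<omega> in M. (Arr m \<omega> - 1 / lam)\<^sup>2 = 0" if "m \<ge> 1" for m
      using integral_nonneg_eq_0_iff_AE[OF centred_arrival_moments(3)[OF that]]
        centred_arrival_moments(4)[OF that] True by simp
    then have "AE \<omega> in M. \<forall>m\<in>{1..<1 + k}. Arr m \<omega> - 1 / lam = 0"
      by (intro AE_finite_allI) auto
    then show ?thesis by eventually_elim (simp add: arrival_walk_def)
  qed
  have "prob {\<omega>\<in>space M. - arrival_walk (n N) \<omega> \<le> s * sqrt (L N)} = (if s \<ge> 0 then 1 else 0)" if "L N > 0" for N
  proof -
    have "prob {\<omega>\<in>space M. - arrival_walk (n N) \<omega> \<le> s * sqrt (L N)} = prob {\<omega>\<in>space M. 0 \<le> s}"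
    proof (rule measure_eq_AE)
      show "AE \<omega> in M. (\<omega> \<in> {\<omega>\<in>space M. - arrival_walk (n N) \<omega> \<le> s * sqrt (L N)}) = (\<omega> \<in> {\<omega>\<in>space M. 0 \<le> s})"
        using zero[of "n N"] by eventually_elim (use that in \<open>auto simp: zero_le_mult_iff\<close>)
    qed auto
    then show ?thesis by (auto simp: prob_space)
  qed
  moreover have "eventually (\<lambda>N. L N > 0) sequentially"
    using L by (rule filterlim_at_top_dense[THEN iffD1, THEN spec])
  ultimately have "eventually (\<lambda>N. prob {\<omega>\<in>space M. - arrival_walk (n N) \<omega> \<le> s * sqrt (L N)} = (if s \<ge> 0 then 1 else 0)) sequentially"
    by (auto elim: eventually_mono)
  then show ?thesis
    using True by (subst cdf_scaled_std_normal) (auto intro: tendsto_eventually)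
next
  case False
  define X where "X i \<omega> = - Arr (i + 1) \<omega>" for i \<omega>
  define F where "F k = cdf (distr M borel (\<lambda>\<omega>. (\<Sum>i<k. X i \<omega> - - (1 / lam)) / sqrt (k * \<bar>\<sigma>\<bar>\<^sup>2)))" for k
  have sum: "(\<Sum>i<k. X i \<omega> - - (1 / lam)) = - arrival_walk k \<omega>" for k \<omega>
  proof -
    have "arrival_walk k \<omega> = (\<Sum>i<k. Arr (i + 1) \<omega> - 1 / lam)"
      unfolding arrival_walk_def
      using sum.shift_bounds_nat_ivl[of "\<lambda>m. Arr m \<omega> - 1 / lam" 0 1 k]
      by (simp add: lessThan_atLeast0 add.commute)
    then show ?thesis by (simp add: X_def sum_negf[symmetric])
  qed
  have "weak_conv_m (\<lambda>k. distr M borel (\<lambda>\<omega>. (\<Sum>i<k. X i \<omega> - - (1 / lam)) / sqrt (k * \<bar>\<sigma>\<bar>\<^sup>2))) std_normal_distribution"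
  proof (rule central_limit_theorem[where \<mu> = "distr M borel (\<lambda>\<omega>. - A \<omega>)"])
    show "indep_vars (\<lambda>i. borel) X UNIV"
      by (rule indep_vars_blocks[OF inputs_indep, where K = "\<lambda>m. {Interarrival (m + 1)}"
            and g = "\<lambda>m x. - x (Interarrival (m + 1))"])
         (auto simp: input_indices_def disjoint_family_on_def X_def)
    show mean: "expectation (X i) = - (1 / lam)" for i
      using Arr_integral(1)[of "i + 1" "\<lambda>x. - x"] A_integrable A_mean by (simp add: X_def[abs_def])
    show "integrable M (\<lambda>\<omega>. (X i \<omega>)\<^sup>2)" for i
      using Arr_integral(2)[of "i + 1" "\<lambda>x. x\<^sup>2"] A_square by (simp add: X_def)
    show "variance (X i) = \<bar>\<sigma>\<bar>\<^sup>2" for i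
    proof -
      have "(X i \<omega> - expectation (X i))\<^sup>2 = (Arr (i + 1) \<omega> - 1 / lam)\<^sup>2" for \<omega>
        unfolding mean by (simp add: X_def power2_eq_square algebra_simps)
      then show ?thesis using centred_arrival_moments(4)[of "i + 1"] by simp
    qed
    show "distr M borel (X i) = distr M borel (\<lambda>\<omega>. - A \<omega>)" for i
    proof -
      have "distr M borel (X i) = distr (distr M borel (Arr (i + 1))) borel uminus"
        using Arr_meas[of "i + 1"] by (subst distr_distr) (auto simp: comp_def X_def[abs_def])
      also have "\<dots> = distr (distr M borel A) borel uminus"
        using Arr_distr[of "i + 1"] by simp
      also have "\<dots> = distr M borel (\<lambda>\<omega>. - A \<omega>)"
        by (subst distr_distr) (auto simp: comp_def)
      finally show ?thesis .
    qed
  qed (use False in simp)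
  then have lim: "(\<lambda>k. F k t) \<longlonglongrightarrow> cdf std_normal_distribution t" for t
    using isCont_cdf_std_normal unfolding weak_conv_m_def weak_conv_def F_def by blast
  have F_meas: "(\<lambda>\<omega>. (\<Sum>i<k. X i \<omega> - - (1 / lam)) / sqrt (k * \<bar>\<sigma>\<bar>\<^sup>2)) \<in> borel_measurable M" for k
    unfolding sum by measurable
  have mono: "mono (F k)" for k
  proof -
    interpret D: real_distribution "distr M borel (\<lambda>\<omega>. (\<Sum>i<k. X i \<omega> - - (1 / lam)) / sqrt (k * \<bar>\<sigma>\<bar>\<^sup>2))"
      by (rule real_distribution_distr[OF F_meas])
    show ?thesis unfolding F_def mono_def using D.cdf_nondecreasing by blast
  qed
  have n_top: "filterlim n at_top sequentially"
  proof -
    have "filterlim (\<lambda>N. real (n N) / L N * L N) at_top sequentially"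
      by (rule filterlim_tendsto_pos_mult_at_top[OF n \<nu> L])
    moreover have "eventually (\<lambda>N. real (n N) / L N * L N = real (n N)) sequentially"
      using filterlim_at_top_dense[THEN iffD1, THEN spec, OF L, of 0] by eventually_elim simp
    ultimately have "filterlim (\<lambda>N. real (n N)) at_top sequentially"
      by (rule filterlim_cong[THEN iffD1, OF refl refl, rotated])
    then show ?thesis by (simp add: filterlim_sequentially_iff_filterlim_real)
  qed
  define t where "t N = s * sqrt (L N) / sqrt (n N * \<bar>\<sigma>\<bar>\<^sup>2)" for N
  have t_lim: "t \<longlonglongrightarrow> s / sqrt (\<sigma>\<^sup>2 * \<nu>)"
  proof -
    have "(\<lambda>N. s / sqrt (\<sigma>\<^sup>2 * (real (n N) / L N))) \<longlonglongrightarrow> s / sqrt (\<sigma>\<^sup>2 * \<nu>)"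
      using n \<nu> False by (intro tendsto_intros) auto
    moreover have "eventually (\<lambda>N. s / sqrt (\<sigma>\<^sup>2 * (real (n N) / L N)) = t N) sequentially"
      using filterlim_at_top_dense[THEN iffD1, THEN spec, OF L, of 0]
      by eventually_elim (simp add: t_def real_sqrt_mult real_sqrt_divide mult.commute)
    ultimately show ?thesis by (rule Lim_transform_eventually)
  qed
  have "(\<lambda>N. F (n N) (t N)) \<longlonglongrightarrow> cdf std_normal_distribution (s / sqrt (\<sigma>\<^sup>2 * \<nu>))"
    by (rule cdf_tendsto_at_moving_point[OF mono filterlim_compose[OF lim n_top] isCont_cdf_std_normal t_lim])
  moreover have "eventually (\<lambda>N. F (n N) (t N) = prob {\<omega>\<in>space M. - arrival_walk (n N) \<omega> \<le> s * sqrt (L N)}) sequentially"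
  proof -
    have "eventually (\<lambda>N. n N \<ge> 1) sequentially" using n_top by (simp add: filterlim_at_top)
    then show ?thesis
    proof eventually_elim
      case (elim N)
      define d where "d = sqrt (n N * \<bar>\<sigma>\<bar>\<^sup>2)"
      have "d > 0" using elim False by (simp add: d_def)
      then have "- arrival_walk (n N) \<omega> / d \<le> t N \<longleftrightarrow> - arrival_walk (n N) \<omega> \<le> s * sqrt (L N)" for \<omega>
        unfolding t_def d_def[symmetric] divide_le_cancel by auto
      then show ?case
        unfolding F_def sum d_def[symmetric] cdf_def
        by (subst measure_distr) (auto intro!: arg_cong[where f = prob])
    qed
  qed
  ultimately have "(\<lambda>N. prob {\<omega>\<in>space M. - arrival_walk (n N) \<omega> \<le> s * sqrt (L N)})
    \<longlonglongrightarrow> cdf std_normal_distribution (s / sqrt (\<sigma>\<^sup>2 * \<nu>))"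
    by (rule Lim_transform_eventually)
  moreover have "sqrt (\<sigma>\<^sup>2 * \<nu>) > 0" using False \<nu> by simp
  ultimately show ?thesis by (subst cdf_scaled_std_normal) auto
qed

lemma queue_max_meas:
  assumes "N \<ge> 1"
  shows "(\<lambda>\<omega>. real (Max ((\<lambda>i. queue_length Serv Arr U i \<omega>) ` {1..N}))) \<in> borel_measurable M"
proof -
  have "queue_length Serv Arr U i \<in> measurable M (count_space UNIV)" if "i \<ge> 1" for i
    unfolding queue_length_def[abs_def]
  proof (rule measurable_card)
    fix j
    have "{\<omega>\<in>space M. j \<in> {j. j \<ge> 1 \<and> ereal (arrival_age Arr U j \<omega>) \<le> waiting_time Serv Arr i j \<omega>}}
      = (if j \<ge> 1 then {\<omega>\<in>space M. ereal (arrival_age Arr U j \<omega>) \<le> waiting_time Serv Arr i j \<omega>} else {})" by auto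
    then show "{\<omega>\<in>space M. j \<in> {j. j \<ge> 1 \<and> ereal (arrival_age Arr U j \<omega>) \<le> waiting_time Serv Arr i j \<omega>}} \<in> events"
      using waiting_age_sets[OF that] by auto
  qed
  then have meas: "(\<lambda>\<omega>. real (queue_length Serv Arr U i \<omega>)) \<in> borel_measurable M" if "i \<in> {1..N}" for i
    using that by (auto intro: measurable_compose)
  have "real (Max ((\<lambda>i. queue_length Serv Arr U i \<omega>) ` {1..N})) = Max ((\<lambda>i. real (queue_length Serv Arr U i \<omega>)) ` {1..N})" for \<omega>
    using assms by (subst mono_Max_commute) (auto simp: mono_def image_image)
  then show ?thesis using meas by (simp add: borel_measurable_Max)
qed

lemma prob_queue_max_le:
  assumes "N \<ge> 1" "0 \<le> y"
  shows "prob {\<omega>\<in>space M. real (Max ((\<lambda>i. queue_length Serv Arr U i \<omega>) ` {1..N})) \<le> y}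
    = 1 - prob (overload N (nat (\<lfloor>y\<rfloor> + 1)))"
proof -
  define j where "j = nat (\<lfloor>y\<rfloor> + 1)"
  have j: "j \<ge> 1" using assms(2) by (simp add: j_def le_nat_iff)
  have less: "real q \<le> y \<longleftrightarrow> \<not> j \<le> q" for q :: nat
    using assms(2) unfolding j_def by linarith
  have "prob {\<omega>\<in>space M. real (Max ((\<lambda>i. queue_length Serv Arr U i \<omega>) ` {1..N})) \<le> y} = prob (space M - overload N j)"
  proof (rule measure_eq_AE)
    show "AE \<omega> in M. (\<omega> \<in> {\<omega>\<in>space M. real (Max ((\<lambda>i. queue_length Serv Arr U i \<omega>) ` {1..N})) \<le> y}) = (\<omega> \<in> space M - overload N j)"
      using AE_queue_length_iff AE_space
    proof eventually_elim
      case (elim \<omega>)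
      have "j \<le> Max ((\<lambda>i. queue_length Serv Arr U i \<omega>) ` {1..N}) \<longleftrightarrow> (\<exists>i\<in>{1..N}. j \<le> queue_length Serv Arr U i \<omega>)"
        using assms(1) by (subst Max_ge_iff) auto
      also have "\<dots> \<longleftrightarrow> \<omega> \<in> overload N j"
        using elim j by (auto simp: overload_def)
      finally show ?case using elim(2) unfolding less by simp
    qed
    show "{\<omega>\<in>space M. real (Max ((\<lambda>i. queue_length Serv Arr U i \<omega>) ` {1..N})) \<le> y} \<in> events"
      using queue_max_meas[OF assms(1)] by measurable
  qed (use overload_sets[OF j] in auto)
  then show ?thesis using overload_sets[OF j] by (simp add: prob_compl j_def)
qed

text \<open>
  For every \<open>\<epsilon>\<close> the two overload bounds squeeze the distribution function of the longest queue
  between those of \<open>- B(n) / sqrt L\<close> at \<open>x / lam \<plusminus> \<epsilon>\<close>, up to \<open>\<epsilon>\<close>. First \<open>N\<close> tends to infinity,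
  then \<open>\<epsilon>\<close> to 0 at a continuity point of the limit.
\<close>

lemma queue_max_cdf_tendsto:
  fixes x :: real
  defines "H \<equiv> cdf (distr std_normal_distribution borel (\<lambda>z. sqrt (\<sigma>\<^sup>2 * (lam / \<gamma> + law.\<kappa>)) * z))"
  assumes cont: "isCont H (x / lam)"
  shows "(\<lambda>N. prob {\<omega>\<in>space M. real (Max ((\<lambda>i. queue_length Serv Arr U i \<omega>) ` {1..N}))
      \<le> lam / \<gamma> * ln (real N) + x * sqrt (ln (real N))}) \<longlonglongrightarrow> H (x / lam)"
proof -
  define L where "L N = ln (real N)" for N :: nat
  define y where "y N = lam / \<gamma> * L N + x * sqrt (L N)" for N
  define j where "j N = nat (\<lfloor>y N\<rfloor> + 1)" for N
  define n where "n N = j N - 1 + nat \<lfloor>law.\<kappa> * L N\<rfloor>" for N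
  define P where "P N = prob {\<omega>\<in>space M. real (Max ((\<lambda>i. queue_length Serv Arr U i \<omega>) ` {1..N})) \<le> y N}" for N
  define Q where "Q N s = prob {\<omega>\<in>space M. - arrival_walk (n N) \<omega> \<le> s * sqrt (L N)}" for N s
  have L_top: "filterlim L at_top sequentially" unfolding L_def by real_asymp
  have y_pos: "eventually (\<lambda>l. 0 \<le> lam / \<gamma> * l + x * sqrt l \<and> 0 \<le> l) at_top"
  proof -
    have "eventually (\<lambda>l. 0 \<le> lam / \<gamma> * l + x * sqrt l) at_top" using lam_pos \<gamma>_pos by real_asymp
    then show ?thesis using eventually_ge_at_top[of 0] by eventually_elim simp
  qed
  have good: "eventually (\<lambda>N. N \<ge> 1 \<and> 0 \<le> y N \<and> 0 \<le> L N) sequentially"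
    using eventually_compose_filterlim[OF y_pos L_top] eventually_ge_at_top[of 1]
    by eventually_elim (simp add: y_def)
  have j: "j N \<ge> 1" "y N \<le> real (j N)" "real (j N) \<le> y N + 1" if "0 \<le> y N" for N
    using that unfolding j_def by linarith+
  have n_lim: "(\<lambda>N. real (n N) / L N) \<longlonglongrightarrow> lam / \<gamma> + law.\<kappa>"
  proof (rule tendsto_sandwich)
    have n_bounds: "y N + law.\<kappa> * L N - 2 \<le> real (n N) \<and> real (n N) \<le> y N + law.\<kappa> * L N"
      if "0 \<le> y N" "0 \<le> L N" for N
    proof -
      have "0 \<le> law.\<kappa> * L N" using law.\<kappa>_pos that by simp
      moreover have "real (n N) = real (j N) - 1 + real (nat \<lfloor>law.\<kappa> * L N\<rfloor>)"
        using j(1)[OF that(1)] by (simp add: n_def of_nat_diff)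
      ultimately show ?thesis using j[OF that(1)] by linarith
    qed
    show "eventually (\<lambda>N. (y N + law.\<kappa> * L N - 2) / L N \<le> real (n N) / L N) sequentially"
      using good by eventually_elim (use n_bounds in \<open>auto intro: divide_right_mono\<close>)
    show "eventually (\<lambda>N. real (n N) / L N \<le> (y N + law.\<kappa> * L N) / L N) sequentially"
      using good by eventually_elim (use n_bounds in \<open>auto intro: divide_right_mono\<close>)
    define k where "k = lam / \<gamma> + law.\<kappa>"
    have k: "k > 0" using lam_pos \<gamma>_pos law.\<kappa>_pos by (simp add: k_def add_pos_pos)
    have sum_eq: "y N + law.\<kappa> * L N = k * L N + x * sqrt (L N)" for N
      by (simp add: y_def k_def distrib_right)
    have "((\<lambda>l. (k * l + x * sqrt l - 2) / l) \<longlongrightarrow> k) at_top" using k by real_asymp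
    from filterlim_compose[OF this L_top]
    show "(\<lambda>N. (y N + law.\<kappa> * L N - 2) / L N) \<longlonglongrightarrow> lam / \<gamma> + law.\<kappa>"
      unfolding sum_eq k_def[symmetric] .
    have "((\<lambda>l. (k * l + x * sqrt l) / l) \<longlongrightarrow> k) at_top" using k by real_asymp
    from filterlim_compose[OF this L_top]
    show "(\<lambda>N. (y N + law.\<kappa> * L N) / L N) \<longlonglongrightarrow> lam / \<gamma> + law.\<kappa>"
      unfolding sum_eq k_def[symmetric] .
  qed
  have Q_lim: "(\<lambda>N. Q N s) \<longlonglongrightarrow> H s" for s
    unfolding Q_def H_def
    by (rule arrival_walk_clt[OF L_top n_lim]) (use lam_pos \<gamma>_pos law.\<kappa>_pos in \<open>simp add: add_pos_pos\<close>)
  have Q_compl: "prob {\<omega>\<in>space M. \<not> - arrival_walk (n N) \<omega> \<le> s * sqrt (L N)} = 1 - Q N s" for N s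
  proof -
    have "{\<omega>\<in>space M. \<not> - arrival_walk (n N) \<omega> \<le> s * sqrt (L N)}
        = space M - {\<omega>\<in>space M. - arrival_walk (n N) \<omega> \<le> s * sqrt (L N)}" by auto
    moreover have "{\<omega>\<in>space M. - arrival_walk (n N) \<omega> \<le> s * sqrt (L N)} \<in> events" by measurable
    ultimately show ?thesis unfolding Q_def by (simp only: prob_compl)
  qed
  have P_eq: "P N = 1 - prob (overload N (j N))" if "N \<ge> 1" "0 \<le> y N" for N
    unfolding P_def j_def by (rule prob_queue_max_le[OF that])
  have low: "eventually (\<lambda>N. Q N (x / lam - \<epsilon>) - \<epsilon> \<le> P N) sequentially" if "\<epsilon> > 0" for \<epsilon>
    using good eventually_compose_filterlim[OF overload_upper[OF that, of x] L_top]
  proof eventually_elim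
    case (elim N)
    have "prob (overload N (j N)) \<le> prob {\<omega>\<in>space M. \<not> - arrival_walk (n N) \<omega> \<le> (x / lam - \<epsilon>) * sqrt (L N)} + \<epsilon>"
      using elim(2)[rule_format, of N "j N"] elim(1) j[of N] unfolding n_def y_def by (simp add: L_def)
    then show ?case using Q_compl[of N "x / lam - \<epsilon>"] P_eq[of N] elim(1) by simp
  qed
  have up: "eventually (\<lambda>N. P N \<le> Q N (x / lam + \<epsilon>) + \<epsilon>) sequentially" if "\<epsilon> > 0" for \<epsilon>
    using good eventually_compose_filterlim[OF overload_lower[OF that, of x] L_top]
  proof eventually_elim
    case (elim N)
    have "prob {\<omega>\<in>space M. \<not> - arrival_walk (n N) \<omega> \<le> (x / lam + \<epsilon>) * sqrt (L N)} \<le> prob (overload N (j N)) + \<epsilon>"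
      using elim(2)[rule_format, of N "j N"] elim(1) j[of N] unfolding n_def y_def by (simp add: L_def)
    then show ?case using Q_compl[of N "x / lam + \<epsilon>"] P_eq[of N] elim(1) by simp
  qed
  have H_lim: "((\<lambda>u. H (x / lam + u)) \<longlongrightarrow> H (x / lam)) (at 0)"
    using cont by (simp add: isCont_iff)
  have "P \<longlonglongrightarrow> H (x / lam)"
  proof (rule order_tendstoI)
    fix a assume a: "a < H (x / lam)"
    have "((\<lambda>\<epsilon>. H (x / lam - \<epsilon>) - \<epsilon>) \<longlongrightarrow> H (x / lam) - 0) (at 0)"
    proof -
      have "filterlim (\<lambda>u. - u) (at (0::real)) (at 0)"
        unfolding filterlim_at using tendsto_minus[OF tendsto_ident_at[of 0 UNIV]]
        by (auto simp: eventually_at_filter)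
      from tendsto_diff[OF filterlim_compose[OF H_lim this] tendsto_ident_at] show ?thesis by simp
    qed
    then have "eventually (\<lambda>\<epsilon>. a < H (x / lam - \<epsilon>) - \<epsilon>) (at_right 0)"
      using a by (auto dest!: order_tendstoD(1)[of _ _ _ a] simp: eventually_at_split)
    moreover have "eventually (\<lambda>\<epsilon>. \<epsilon> > 0) (at_right (0::real))" by (simp add: eventually_at_filter)
    ultimately have "eventually (\<lambda>\<epsilon>. a < H (x / lam - \<epsilon>) - \<epsilon> \<and> \<epsilon> > 0) (at_right 0)" by eventually_elim simp
    then obtain \<epsilon> where "a < H (x / lam - \<epsilon>) - \<epsilon>" "\<epsilon> > 0" by (auto dest!: eventually_happens)
    then have \<epsilon>: "a + \<epsilon> < H (x / lam - \<epsilon>)" "\<epsilon> > 0" by linarith+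
    show "eventually (\<lambda>N. a < P N) sequentially"
      using order_tendstoD(1)[OF Q_lim \<epsilon>(1)] low[OF \<epsilon>(2)] by eventually_elim simp
  next
    fix a assume a: "H (x / lam) < a"
    have "((\<lambda>\<epsilon>. H (x / lam + \<epsilon>) + \<epsilon>) \<longlongrightarrow> H (x / lam) + 0) (at 0)"
      using H_lim by (intro tendsto_intros)
    then have "eventually (\<lambda>\<epsilon>. H (x / lam + \<epsilon>) + \<epsilon> < a) (at_right 0)"
      using a by (auto dest!: order_tendstoD(2)[of _ _ _ a] simp: eventually_at_split)
    moreover have "eventually (\<lambda>\<epsilon>. \<epsilon> > 0) (at_right (0::real))" by (simp add: eventually_at_filter)
    ultimately have "eventually (\<lambda>\<epsilon>. H (x / lam + \<epsilon>) + \<epsilon> < a \<and> \<epsilon> > 0) (at_right 0)" by eventually_elim simp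
    then obtain \<epsilon> where "H (x / lam + \<epsilon>) + \<epsilon> < a" "\<epsilon> > 0" by (auto dest!: eventually_happens)
    then have \<epsilon>: "H (x / lam + \<epsilon>) < a - \<epsilon>" "\<epsilon> > 0" by linarith+
    show "eventually (\<lambda>N. P N < a) sequentially"
      using order_tendstoD(2)[OF Q_lim \<epsilon>(1)] up[OF \<epsilon>(2)] by eventually_elim simp
  qed
  then show ?thesis unfolding P_def y_def L_def .
qed

lemma queue_max_weak_limit:
  "weak_conv_m
    (\<lambda>N::nat. distr M borel (\<lambda>\<omega>.
       (real (Max ((\<lambda>i. queue_length Serv Arr U i \<omega>) ` {1..N})) - lam / \<gamma> * ln (real N))
         / sqrt (ln (real N))))
    (distr std_normal_distribution borel (\<lambda>x.
       sqrt (lam\<^sup>2 * \<sigma>\<^sup>2 / (deriv (\<lambda>\<theta>. real_of_ereal (log_mgf M S lam \<theta>)) \<gamma> * \<gamma>)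
             + lam ^ 3 * \<sigma>\<^sup>2 / \<gamma>) * x))"
  unfolding weak_conv_m_def weak_conv_def
proof (intro allI impI)
  define c where "c = sqrt (\<sigma>\<^sup>2 * (lam / \<gamma> + law.\<kappa>))"
  define H where "H = cdf (distr std_normal_distribution borel (\<lambda>z. c * z))"
  define T where "T = cdf (distr std_normal_distribution borel (\<lambda>x.
       sqrt (lam\<^sup>2 * \<sigma>\<^sup>2 / (deriv (\<lambda>\<theta>. real_of_ereal (log_mgf M S lam \<theta>)) \<gamma> * \<gamma>)
             + lam ^ 3 * \<sigma>\<^sup>2 / \<gamma>) * x))"
  have "lam\<^sup>2 * \<sigma>\<^sup>2 / (law.tilted_mean * \<gamma>) + lam ^ 3 * \<sigma>\<^sup>2 / \<gamma> = lam\<^sup>2 * (\<sigma>\<^sup>2 * (lam / \<gamma> + law.\<kappa>))"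
    by (simp add: law.\<kappa>_def power2_eq_square power3_eq_cube distrib_left mult_ac add_divide_distrib)
  then have coeff: "sqrt (lam\<^sup>2 * \<sigma>\<^sup>2 / (deriv (\<lambda>\<theta>. real_of_ereal (log_mgf M S lam \<theta>)) \<gamma> * \<gamma>)
             + lam ^ 3 * \<sigma>\<^sup>2 / \<gamma>) = lam * c"
    using lam_pos by (simp add: deriv_log_mgf c_def real_sqrt_mult)
  have TH: "T u = H (u / lam)" for u
  proof -
    have "lam * c * z \<le> u \<longleftrightarrow> c * z \<le> u / lam" for z
      using lam_pos by (simp add: pos_le_divide_eq mult_ac)
    then show ?thesis
      unfolding T_def H_def coeff by (simp add: cdf_def measure_distr vimage_def)
  qed
  fix x assume "isCont (cdf (distr std_normal_distribution borel (\<lambda>x.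
       sqrt (lam\<^sup>2 * \<sigma>\<^sup>2 / (deriv (\<lambda>\<theta>. real_of_ereal (log_mgf M S lam \<theta>)) \<gamma> * \<gamma>)
             + lam ^ 3 * \<sigma>\<^sup>2 / \<gamma>) * x))) x"
  then have "isCont T x" unfolding T_def .
  then have "isCont T (lam * (x / lam))" using lam_pos by simp
  then have "isCont (\<lambda>s. T (lam * s)) (x / lam)"
    by (rule isCont_o2[rotated]) (intro continuous_intros)
  moreover have "(\<lambda>s. T (lam * s)) = H" using lam_pos by (simp add: TH fun_eq_iff)
  ultimately have "isCont H (x / lam)" by simp
  then have lim: "(\<lambda>N. prob {\<omega>\<in>space M. real (Max ((\<lambda>i. queue_length Serv Arr U i \<omega>) ` {1..N}))
      \<le> lam / \<gamma> * ln (real N) + x * sqrt (ln (real N))}) \<longlonglongrightarrow> T x"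
    unfolding TH H_def c_def by (rule queue_max_cdf_tendsto)
  have "eventually (\<lambda>N. prob {\<omega>\<in>space M. real (Max ((\<lambda>i. queue_length Serv Arr U i \<omega>) ` {1..N}))
      \<le> lam / \<gamma> * ln (real N) + x * sqrt (ln (real N))}
    = cdf (distr M borel (\<lambda>\<omega>.
       (real (Max ((\<lambda>i. queue_length Serv Arr U i \<omega>) ` {1..N})) - lam / \<gamma> * ln (real N))
         / sqrt (ln (real N)))) x) sequentially"
    using eventually_ge_at_top[of 2]
  proof eventually_elim
    case (elim N)
    have pos: "sqrt (ln (real N)) > 0" using elim by simp
    have [measurable]: "(\<lambda>\<omega>. real (Max ((\<lambda>i. queue_length Serv Arr U i \<omega>) ` {1..N}))) \<in> borel_measurable M"
      using elim by (intro queue_max_meas) simp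
    have "m \<le> lam / \<gamma> * ln (real N) + x * sqrt (ln (real N)) \<longleftrightarrow> (m - lam / \<gamma> * ln (real N)) / sqrt (ln (real N)) \<le> x" for m
      unfolding pos_divide_le_eq[OF pos] by linarith
    then show ?case
      unfolding cdf_def by (subst measure_distr) (measurable, auto intro!: arg_cong[where f = prob])
  qed
  from Lim_transform_eventually[OF lim this]
  show "(\<lambda>N. cdf (distr M borel (\<lambda>\<omega>.
       (real (Max ((\<lambda>i. queue_length Serv Arr U i \<omega>) ` {1..N})) - lam / \<gamma> * ln (real N))
         / sqrt (ln (real N)))) x) \<longlonglongrightarrow> cdf (distr std_normal_distribution borel (\<lambda>x.
       sqrt (lam\<^sup>2 * \<sigma>\<^sup>2 / (deriv (\<lambda>\<theta>. real_of_ereal (log_mgf M S lam \<theta>)) \<gamma> * \<gamma>)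
             + lam ^ 3 * \<sigma>\<^sup>2 / \<gamma>) * x)) x"
    unfolding T_def .
qed

end

theorem theorem2:
  fixes M :: "'a measure"
    and S A U :: "'a \<Rightarrow> real"
    and Serv :: "nat \<Rightarrow> nat \<Rightarrow> 'a \<Rightarrow> real"
    and Arr :: "nat \<Rightarrow> 'a \<Rightarrow> real"
    and lam \<mu> \<sigma> \<gamma> :: real
  assumes "prob_space M"
    and "S \<in> borel_measurable M" and "AE \<omega> in M. S \<omega> \<ge> 0"
    and "A \<in> borel_measurable M" and "AE \<omega> in M. A \<omega> \<ge> 0"
    and "prob_space.indep_vars M (\<lambda>_. borel) (input_var Serv Arr U) input_indices"
    and "\<And>i j. i \<ge> 1 \<Longrightarrow> j \<ge> 1 \<Longrightarrow> distr M borel (Serv i j) = distr M borel S"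
    and "\<And>j. j \<ge> 1 \<Longrightarrow> distr M borel (Arr j) = distr M borel A"
    and "lam > 0"
    and "distributed M lborel U
           (\<lambda>x. ennreal (if x > 0 then lam * \<P>(\<omega> in M. A \<omega> > x) else 0))"
    and "integrable M A" and "prob_space.expectation M A = 1 / lam"
    and "integrable M (\<lambda>\<omega>. (A \<omega>)\<^sup>2)" and "prob_space.variance M A = \<sigma>\<^sup>2"
    and "\<mu> > 0"
    and "integrable M (\<lambda>\<omega>. S \<omega> - A \<omega>)" and "prob_space.expectation M (\<lambda>\<omega>. S \<omega> - A \<omega>) = - \<mu>"
    and "\<gamma> > 0" and "log_mgf M S lam \<gamma> = 0"
    and "\<gamma> \<in> interior {\<theta>. log_mgf M S lam \<theta> < \<infinity>}"
  shows "weak_conv_m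
    (\<lambda>N::nat. distr M borel (\<lambda>\<omega>.
       (real (Max ((\<lambda>i. queue_length Serv Arr U i \<omega>) ` {1..N})) - lam / \<gamma> * ln (real N))
         / sqrt (ln (real N))))
    (distr std_normal_distribution borel (\<lambda>x.
       sqrt (lam\<^sup>2 * \<sigma>\<^sup>2 / (deriv (\<lambda>\<theta>. real_of_ereal (log_mgf M S lam \<theta>)) \<gamma> * \<gamma>)
             + lam ^ 3 * \<sigma>\<^sup>2 / \<gamma>) * x))"
proof -
  interpret fork_join M S A U Serv Arr lam \<mu> \<sigma> \<gamma>
    using assms by (simp only: fork_join_def fork_join_axioms_def) blast
  show ?thesis by (rule queue_max_weak_limit)
qed

end
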